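(* Let $D_\lambda\subset\mathbb{P}^{n-1}$ be the diagonal hypersurface $X_1^d+\cdots+X_n^d=d\lambda X_1^{h_1}\cdots X_n^{h_n}$ over $\mathbb{F}_q$, where $d,n\ge2$, $h_i\ge1$, $\sum_i h_i=d$, $\gcd(d,h_1,\dots,h_n)=1$, and $dh_i\mid q-1$ for all $i$. Suppose that $w\in W$ satisfies $w\sim0$, i.e. $w=mh$ for some $m\in\{0,\dots,d-1\}$. Then for any $\lambda\in\mathbb{F}_q^\times$, $$N_1(D_\lambda;\chi^w)=(-1)^n j(\varphi_d^w)^{1-\delta(m)}F^w(\mathrm{red.}\ \varphi_d^m;\lambda)+\frac{1-q^{n-1}}{1-q}+C,$$ where $$C=(-1)^{n-1}\sum_{\substack{w'\in W,\ w'\sim w\\ w'_i=0\text{ for some but not all } i}} j(\varphi_d^{w'}),$$ $\delta(m)=1$ if $m=0$ and $\delta(m)=0$ otherwise, and $F^w(\mathrm{red.}\ \varphi_d^m;\lambda)$ is the function obtained by removing one $\varphi_d^m$ from both the numerator (upper) and the denominator (lower) parameters in $F^w(\lambda)$. Furthermore, if $\gcd(d,h_i)=1$ for all $i=1,\dots,n$, then $$N_1(D_\lambda;\chi^w)=(-1)^n j(\varphi_d^w)^{1-\delta(m)}F^w_{\rm red}(\lambda)+\frac{1-q^{n-1}}{1-q}.$$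
   Context: **Characters and hypergeometric functions.** Let $\widehat{\mathbb{F}_q^\times}=\mathrm{Hom}(\mathbb{F}_q^\times,\overline{\mathbb{Q}}^\times)$, with trivial character $\varepsilon$; put $\eta(0)=0$ for every $\eta$ (including $\varepsilon$), and $\delta(\eta)=1$ if $\eta=\varepsilon$, $0$ otherwise. Fix a nontrivial additive character $\psi$ of $\mathbb{F}_q$ and put $g(\eta)=-\sum_{x\in \mathbb{F}_q^\times}\eta(x)\psi(x)$, $g^\circ(\eta)=q^{\delta(\eta)}g(\eta)$, $(\alpha)_\nu=g(\alpha\nu)/g(\alpha)$, $(\alpha)_\nu^\circ=g^\circ(\alpha\nu)/g^\circ(\alpha)$, and $$F(\alpha_1,\dots,\alpha_m;\beta_1,\dots,\beta_m;z)_q=\frac{1}{1-q}\sum_{\nu\in\widehat{\mathbb{F}_q^\times}}\frac{(\alpha_1)_\nu\cdots(\alpha_m)_\nu}{(\beta_1)^\circ_\nu\cdots(\beta_m)^\circ_\nu}\,\nu(z).$$ Jacobi sum: $j(\eta_1,\dots,\eta_n)=(-1)^{n-1}\sum_{x_i\in\mathbb{F}_q^\times,\ x_1+\cdots+x_n=1}\eta_1(x_1)\cdots\eta_n(x_n)$. Fix a generator $\varphi$ of $\widehat{\mathbb{F}_q^\times}$; for $m\mid q-1$ put $\varphi_m=\varphi^{(q-1)/m}$. Write $j(\varphi_d^w)=j(\varphi_d^{w_1},\dots,\varphi_d^{w_n})$. **Group action and point counts.** Let $h=(h_1,\dots,h_n)$, $\mu_d\subset\mathbb{F}_q^\times$ the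 $d$th roots of unity, $\widetilde G=\{\xi\in\mu_d^n\mid \xi_1^{h_1}\cdots\xi_n^{h_n}=1\}$, $\Delta\subset\widetilde G$ the diagonal subgroup, $G=\widetilde G/\Delta$, acting on $D_\lambda$ by coordinatewise multiplication. Let $W=\{w\in(\mathbb{Z}/d\mathbb{Z})^n\mid w_1+\cdots+w_n=0\}$. For $w\in W$, $\chi^w(\xi)=\varphi(\xi_1^{w_1}\cdots\xi_n^{w_n})$ defines a character of $G$. Write $w\sim w'$ if $\chi^w=\chi^{w'}$, equivalently $w-w'=mh$ in $(\mathbb{Z}/d\mathbb{Z})^n$ for some $m\in\{0,\dots,d-1\}$. With $\Phi$ the $q$-Frobenius, $$N_1(D_\lambda;\chi^w)=\frac{1}{\#G}\sum_{\xi\in G}\chi^w(\xi)\,\#\{X\in D_\lambda(\overline{\mathbb{F}_q})\mid \xi^{-1}\Phi(X)=X\}.$$ **The function $F^w$.** $F^w(\lambda)$ is the value $F(\cdots;\varepsilon,\varphi_d,\dots,\varphi_d^{d-1};(\prod_{j=1}^n h_j^{h_j})\lambda^d)_q$ whose $d$ upper parameters are $\varphi_{dh_i}^{w_i},\varphi_{dh_i}^{w_i+d},\dots,\varphi_{dh_i}^{w_i+d(h_i-1)}$ for $i=1,\dots,n$, where in the exponents $w_i$ means its representative in $\{0,\dots,d-1\}$. (When $w=mh$, $\varphi_d^m$ occurs among both the upper and the lower parameters.) $F^w_{\rm red}(\lambda)$ is the value obtained from $F^w(\lambda)$ by cancelling, with multiplicity, all parameters common to the upper and lower lists until the lists are disjoint.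 *)

theory Defs
  imports "HOL-Library.Multiset" "HOL-Library.Cardinality" "HOL-Algebra.Coset" "HOL-Algebra.Algebraic_Closure_Type"
begin

section \<open>Characters, Gauss sums and hypergeometric functions over a finite field\<close>

text \<open>
  The finite field with \<open>q\<close> elements is a type \<open>'a :: {field, finite}\<close> with \<open>q = CARD('a)\<close>.
  All character values lie in the algebraic closure of the rationals.
\<close>

type_synonym qbar = "rat alg_closure"

text \<open>
  Multiplicative characters are total functions with the convention \<open>\<eta>(0) = 0\<close>,
  also for the trivial one.
\<close>

definition mchars :: "('a :: {field, finite} \<Rightarrow> qbar) set" where
  "mchars = {\<eta>. \<eta> 0 = 0 \<and> (\<forall>x. x \<noteq> 0 \<longrightarrow> \<eta> x \<noteq> 0) \<and>
                 (\<forall>x y. x \<noteq> 0 \<longrightarrow> y \<noteq> 0 \<longrightarrow> \<eta> (x * y) = \<eta> x * \<eta> y)}"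

definition triv_char :: "'a :: {field, finite} \<Rightarrow> qbar" where
  "triv_char x = (if x = 0 then 0 else 1)"

definition char_mult :: "('a :: {field, finite} \<Rightarrow> qbar) \<Rightarrow> ('a \<Rightarrow> qbar) \<Rightarrow> 'a \<Rightarrow> qbar" where
  "char_mult \<alpha> \<beta> x = \<alpha> x * \<beta> x"

text \<open>The case distinction makes the zeroth power the trivial character (as \<open>0 ^ 0 = 1\<close>).\<close>

definition char_pow :: "('a :: {field, finite} \<Rightarrow> qbar) \<Rightarrow> nat \<Rightarrow> 'a \<Rightarrow> qbar" where
  "char_pow \<eta> k x = (if x = 0 then 0 else \<eta> x ^ k)"

definition generates_mchars :: "('a :: {field, finite} \<Rightarrow> qbar) \<Rightarrow> bool" where
  "generates_mchars \<phi> \<longleftrightarrow> \<phi> \<in> mchars \<and> (\<forall>\<eta>\<in>mchars. \<exists>k. \<eta> = char_pow \<phi> k)"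

text \<open>\<open>\<phi>\<^sub>m = \<phi>\<^bsup>(q - 1) / m\<^esup>\<close>, meant for \<open>m\<close> dividing \<open>q - 1\<close>.\<close>

definition root_char :: "('a :: {field, finite} \<Rightarrow> qbar) \<Rightarrow> nat \<Rightarrow> 'a \<Rightarrow> qbar" where
  "root_char \<phi> m = char_pow \<phi> ((CARD('a) - 1) div m)"

definition nontrivial_additive_char :: "('a :: {field, finite} \<Rightarrow> qbar) \<Rightarrow> bool" where
  "nontrivial_additive_char \<psi> \<longleftrightarrow>
     (\<forall>x. \<psi> x \<noteq> 0) \<and> (\<forall>x y. \<psi> (x + y) = \<psi> x * \<psi> y) \<and> (\<exists>x. \<psi> x \<noteq> 1)"

definition gauss :: "('a :: {field, finite} \<Rightarrow> qbar) \<Rightarrow> ('a \<Rightarrow> qbar) \<Rightarrow> qbar" where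
  "gauss \<psi> \<eta> = - (\<Sum>x\<in>{x. x \<noteq> 0}. \<eta> x * \<psi> x)"

definition gauss_circ :: "('a :: {field, finite} \<Rightarrow> qbar) \<Rightarrow> ('a \<Rightarrow> qbar) \<Rightarrow> qbar" where
  "gauss_circ \<psi> \<eta> = of_nat CARD('a) ^ of_bool (\<eta> = triv_char) * gauss \<psi> \<eta>"

definition poch :: "('a :: {field, finite} \<Rightarrow> qbar) \<Rightarrow> ('a \<Rightarrow> qbar) \<Rightarrow> ('a \<Rightarrow> qbar) \<Rightarrow> qbar" where
  "poch \<psi> \<alpha> \<nu> = gauss \<psi> (char_mult \<alpha> \<nu>) / gauss \<psi> \<alpha>"

definition poch_circ :: "('a :: {field, finite} \<Rightarrow> qbar) \<Rightarrow> ('a \<Rightarrow> qbar) \<Rightarrow> ('a \<Rightarrow> qbar) \<Rightarrow> qbar" where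
  "poch_circ \<psi> \<alpha> \<nu> = gauss_circ \<psi> (char_mult \<alpha> \<nu>) / gauss_circ \<psi> \<alpha>"

text \<open>
  The value depends only on the parameters counted with multiplicity, so the upper parameters
  \<open>A\<close> and the lower parameters \<open>B\<close> are multisets; removing and cancelling parameters is then
  multiset difference.
\<close>

definition hyp_F ::
  "('a :: {field, finite} \<Rightarrow> qbar) \<Rightarrow> ('a \<Rightarrow> qbar) multiset \<Rightarrow> ('a \<Rightarrow> qbar) multiset \<Rightarrow> 'a \<Rightarrow> qbar"
where
  "hyp_F \<psi> A B z =
     1 / (1 - of_nat CARD('a)) *
     (\<Sum>\<nu>\<in>mchars. (\<Prod>\<alpha>\<in>#A. poch \<psi> \<alpha> \<nu>) / (\<Prod>\<beta>\<in>#B. poch_circ \<psi> \<beta> \<nu>) * \<nu> z)"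

definition jacobi :: "('n :: finite \<Rightarrow> 'a :: {field, finite} \<Rightarrow> qbar) \<Rightarrow> qbar" where
  "jacobi \<eta> =
     (- 1) ^ (CARD('n) - 1) *
     (\<Sum>x\<in>{x :: 'n \<Rightarrow> 'a. (\<forall>i. x i \<noteq> 0) \<and> (\<Sum>i\<in>UNIV. x i) = 1}. \<Prod>i\<in>UNIV. \<eta> i (x i))"

text \<open>The Jacobi sum \<open>j(\<phi>\<^sub>d\<^bsup>w\<^esup>)\<close>.\<close>

definition jacobi_pow ::
  "('a :: {field, finite} \<Rightarrow> qbar) \<Rightarrow> nat \<Rightarrow> ('n :: finite \<Rightarrow> nat) \<Rightarrow> qbar" where
  "jacobi_pow \<phi> d w = jacobi (\<lambda>i. char_pow (root_char \<phi> d) (w i))"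


section \<open>Diagonal hypersurfaces and their group action\<close>

text \<open>
  Points of projective space over the algebraic closure are lines through the origin with the
  origin removed. Coordinates are indexed by the finite type \<open>'n\<close>.
\<close>

definition proj_point :: "('n \<Rightarrow> 'k :: field) \<Rightarrow> ('n \<Rightarrow> 'k) set" where
  "proj_point x = {\<lambda>i. c * x i | c. c \<noteq> 0}"

definition proj_space :: "('n \<Rightarrow> 'k :: field) set set" where
  "proj_space = {proj_point x | x. x \<noteq> (\<lambda>_. 0)}"

text \<open>
  The equation is homogeneous, since \<open>\<Sum>i. h i = d\<close>, so it may be tested on all representatives.
\<close>

definition D_hyp ::
  "nat \<Rightarrow> ('n :: finite \<Rightarrow> nat) \<Rightarrow> 'a :: {field, finite} \<Rightarrow> ('n \<Rightarrow> 'a alg_closure) set set" where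
  "D_hyp d h l =
     {P \<in> proj_space. \<forall>x\<in>P. (\<Sum>i\<in>UNIV. x i ^ d) = of_nat d * to_ac l * (\<Prod>i\<in>UNIV. x i ^ h i)}"

definition G_tilde :: "nat \<Rightarrow> ('n :: finite \<Rightarrow> nat) \<Rightarrow> ('n \<Rightarrow> 'a :: {field, finite}) monoid" where
  "G_tilde d h =
     \<lparr> carrier = {\<xi>. (\<forall>i. \<xi> i ^ d = 1) \<and> (\<Prod>i\<in>UNIV. \<xi> i ^ h i) = 1},
       monoid.mult = (\<lambda>\<xi> \<zeta> i. \<xi> i * \<zeta> i),
       one = (\<lambda>_. 1) \<rparr>"

definition Delta :: "nat \<Rightarrow> ('n :: finite \<Rightarrow> nat) \<Rightarrow> ('n \<Rightarrow> 'a :: {field, finite}) set" where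
  "Delta d h = {\<xi> \<in> carrier (G_tilde d h). \<exists>\<zeta>. \<xi> = (\<lambda>_. \<zeta>)}"

definition G_grp :: "nat \<Rightarrow> ('n :: finite \<Rightarrow> nat) \<Rightarrow> ('n \<Rightarrow> 'a :: {field, finite}) set monoid" where
  "G_grp d h = G_tilde d h Mod Delta d h"

text \<open>
  The set of all products of a representative of the coset \<open>c\<close> and a representative of the
  point \<open>P\<close>: this is again a single point, as \<open>\<Delta>\<close> acts by scalars.
\<close>

definition G_act ::
  "('n \<Rightarrow> 'a :: {field, finite}) set \<Rightarrow> ('n \<Rightarrow> 'a alg_closure) set \<Rightarrow> ('n \<Rightarrow> 'a alg_closure) set" where
  "G_act c P = {\<lambda>i. to_ac (\<xi> i) * x i | \<xi> x. \<xi> \<in> c \<and> x \<in> P}"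

text \<open>
  The image of a line under the \<open>q\<close>-power map is again a line, as every element of the algebraic
  closure has a \<open>q\<close>-th root.
\<close>

definition frob :: "('n \<Rightarrow> 'a :: {field, finite} alg_closure) set \<Rightarrow> ('n \<Rightarrow> 'a alg_closure) set" where
  "frob P = (\<lambda>x i. x i ^ CARD('a)) ` P"

text \<open>
  Elements of \<open>\<int>/d\<int>\<close> are represented by their representatives in \<open>{0..<d}\<close>.
\<close>

definition W_set :: "nat \<Rightarrow> ('n :: finite \<Rightarrow> nat) set" where
  "W_set d = {w. (\<forall>i. w i < d) \<and> d dvd (\<Sum>i\<in>UNIV. w i)}"

text \<open>
  For \<open>w \<in> W\<close> the map \<open>\<xi> \<mapsto> \<phi>(\<Prod>i. \<xi>\<^sub>i\<^bsup>w\<^sub>i\<^esup>)\<close> is constant on the cosets of \<open>\<Delta>\<close>;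
  its value on the coset \<open>c\<close> is the only element of the image of \<open>c\<close>.
\<close>

definition chi ::
  "('a :: {field, finite} \<Rightarrow> qbar) \<Rightarrow> ('n :: finite \<Rightarrow> nat) \<Rightarrow> ('n \<Rightarrow> 'a) set \<Rightarrow> qbar" where
  "chi \<phi> w c = the_elem ((\<lambda>\<xi>. \<phi> (\<Prod>i\<in>UNIV. \<xi> i ^ w i)) ` c)"

definition W_sim ::
  "('a :: {field, finite} \<Rightarrow> qbar) \<Rightarrow> nat \<Rightarrow> ('n :: finite \<Rightarrow> nat) \<Rightarrow> ('n \<Rightarrow> nat) \<Rightarrow> ('n \<Rightarrow> nat) \<Rightarrow> bool"
where
  "W_sim \<phi> d h w w' \<longleftrightarrow> (\<forall>c\<in>carrier (G_grp d h). chi \<phi> w c = chi \<phi> w' c)"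

definition N1 ::
  "('a :: {field, finite} \<Rightarrow> qbar) \<Rightarrow> nat \<Rightarrow> ('n :: finite \<Rightarrow> nat) \<Rightarrow> 'a \<Rightarrow> ('n \<Rightarrow> nat) \<Rightarrow> qbar" where
  "N1 \<phi> d h l w =
     1 / of_nat (Coset.order (G_grp d h :: ('n \<Rightarrow> 'a) set monoid)) *
     (\<Sum>c\<in>carrier (G_grp d h).
        chi \<phi> w c * of_nat (card {P \<in> D_hyp d h l. G_act (inv\<^bsub>G_grp d h\<^esub> c) (frob P) = P}))"


section \<open>The functions attached to \<open>w\<close>\<close>

definition upper_params ::
  "('a :: {field, finite} \<Rightarrow> qbar) \<Rightarrow> nat \<Rightarrow> ('n :: finite \<Rightarrow> nat) \<Rightarrow> ('n \<Rightarrow> nat) \<Rightarrow> ('a \<Rightarrow> qbar) multiset"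
where
  "upper_params \<phi> d h w =
     (\<Sum>i\<in>UNIV. image_mset (\<lambda>k. char_pow (root_char \<phi> (d * h i)) (w i + d * k)) (mset_set {..<h i}))"

definition lower_params ::
  "('a :: {field, finite} \<Rightarrow> qbar) \<Rightarrow> nat \<Rightarrow> ('a \<Rightarrow> qbar) multiset" where
  "lower_params \<phi> d = image_mset (\<lambda>k. char_pow (root_char \<phi> d) k) (mset_set {..<d})"

definition F_arg :: "nat \<Rightarrow> ('n :: finite \<Rightarrow> nat) \<Rightarrow> 'a :: {field, finite} \<Rightarrow> 'a" where
  "F_arg d h l = (\<Prod>j\<in>UNIV. of_nat (h j) ^ h j) * l ^ d"

text \<open>
  \<open>F\<^sup>w(red. \<eta>; \<lambda>)\<close> and the fully reduced \<open>F\<^sup>w\<^sub>r\<^sub>e\<^sub>d(\<lambda>)\<close>. For multisets, \<open>A - B\<close> and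
  \<open>B - A\<close> are what remains of \<open>A\<close> and \<open>B\<close> after all common members have been cancelled with
  multiplicity.
\<close>

definition F_remove ::
  "('a :: {field, finite} \<Rightarrow> qbar) \<Rightarrow> ('a \<Rightarrow> qbar) \<Rightarrow> nat \<Rightarrow> ('n :: finite \<Rightarrow> nat) \<Rightarrow> ('n \<Rightarrow> nat) \<Rightarrow>
     ('a \<Rightarrow> qbar) \<Rightarrow> 'a \<Rightarrow> qbar" where
  "F_remove \<psi> \<phi> d h w \<eta> l =
     hyp_F \<psi> (upper_params \<phi> d h w - {#\<eta>#}) (lower_params \<phi> d - {#\<eta>#}) (F_arg d h l)"

definition F_red ::
  "('a :: {field, finite} \<Rightarrow> qbar) \<Rightarrow> ('a \<Rightarrow> qbar) \<Rightarrow> nat \<Rightarrow> ('n :: finite \<Rightarrow> nat) \<Rightarrow> ('n \<Rightarrow> nat) \<Rightarrow>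
     'a \<Rightarrow> qbar" where
  "F_red \<psi> \<phi> d h w l =
     hyp_F \<psi> (upper_params \<phi> d h w - lower_params \<phi> d) (lower_params \<phi> d - upper_params \<phi> d h w)
       (F_arg d h l)"

end

theory Submission
  imports Defs "HOL-Algebra.Multiplicative_Group"
begin

text \<open>
  As \<open>w = m h\<close>, the character \<open>\<chi>\<^sup>w\<close> is trivial on \<open>G\<close>, so that \<open>N\<^sub>1\<close> does not depend on \<open>m\<close>. A point fixed
  by \<open>\<xi>\<^bsup>-1\<^esup> \<Phi>\<close> has a representative with \<open>x\<^sub>i\<^bsup>q\<^esup> = \<xi>\<^sub>i x\<^sub>i\<close>, unique up to \<open>q - 1\<close> scalars, and \<open>N\<^sub>1\<close> becomes
  a count of pairs \<open>(\<xi>, x)\<close> (\<open>N1_eq_twisted_points\<close>).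

  The vectors with nonzero coordinates are counted through \<open>t\<^sub>i = x\<^sub>i\<^bsup>d\<^esup> / \<Prod>j. x\<^sub>j\<^bsup>h j\<^esup>\<close>, which runs through the
  points of the torus \<open>\<Prod>i. t\<^sub>i\<^bsup>h i\<^esup> = 1\<close> on a hyperplane (\<open>card_nonzero_points\<close>). Expanding the torus
  equation in characters \<open>\<nu>\<close> gives the Jacobi sums \<open>j(\<nu>\<^bsup>h 1\<^esup>, ..., \<nu>\<^bsup>h n\<^esup>)\<close>, hence the ratios
  \<open>\<Prod>i. g(\<nu>\<^bsup>h i\<^esup>) / g\<^sup>\<circ>(\<nu>\<^bsup>d\<^esup>)\<close> (\<open>card_torus_section\<close>). If a coordinate vanishes, so does the monomial of
  the equation, and the condition \<open>\<Prod>i. \<xi>\<^sub>i\<^bsup>h i\<^esup> = 1\<close> is expanded in the characters of the \<open>d\<close>th roots of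
  unity. The trivial one counts points on a hyperplane, and the \<open>k\<close>th one contributes a
  Jacobi sum \<open>j(\<phi>\<^sub>d\<^bsup>k h\<^esup>)\<close> if some but not all \<open>k h\<^sub>i\<close> vanish modulo \<open>d\<close>; these are the terms of \<open>C\<close>
  (\<open>card_boundary_points\<close>, \<open>boundary_contribution\<close>).

  On the hypergeometric side, put \<open>\<alpha> = \<phi>\<^sub>d\<^bsup>m\<^esup>\<close>. The upper parameters belonging to \<open>i\<close> are the products of
  \<open>\<alpha>\<close> with the characters of order dividing \<open>h\<^sub>i\<close>, and the lower ones are the characters of order
  dividing \<open>d\<close>. The product formula of Davenport and Hasse contracts them to \<open>g((\<alpha>\<nu>)\<^bsup>h i\<^esup>)\<close> and \<open>g\<^sup>\<circ>(\<nu>\<^bsup>d\<^esup>)\<close>,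
  so that \<open>\<mu> = \<alpha>\<nu>\<close> leads back to the sum of the point count. Removing \<open>\<alpha>\<close> from both lists changes only
  the term of trivial \<open>\<mu>\<close>, and this change is the remaining constant (\<open>F_remove_eq\<close>). What
  is left over, a power of \<open>q\<close> and the Gauss sums \<open>g(\<alpha>\<^bsup>h i\<^esup>)\<close>, is the inverse of \<open>j(\<phi>\<^sub>d\<^sup>w)\<close> for nonzero \<open>m\<close>,
  and \<open>1\<close> for \<open>m = 0\<close>. If \<open>d\<close> is
  coprime to all \<open>h\<^sub>i\<close>, then \<open>\<alpha>\<close> is the only common parameter and \<open>C\<close> is an empty sum.

  The product formula \<open>davenport_hasse_product\<close> is proved by comparing L-functions along the covering
  \<open>x \<mapsto> x\<^bsup>n\<^esup>\<close> of the multiplicative group. The function \<open>\<chi>\<close>(product of the roots) times \<open>\<psi>\<close>(sum of the roots)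
  on monic polynomials has the L-series \<open>1 - g(\<chi>) X\<close>. Its pullback along the covering has
  the L-series \<open>\<Prod>k. 1 - g(\<chi> \<phi>\<^sub>n\<^bsup>k\<^esup>) X\<close>, whose coefficient of \<open>X\<^bsup>n\<^esup>\<close> is a sum over monic polynomials of
  degree \<open>n\<close> of \<open>\<chi>\<^bsup>n\<^esup>\<close> of the product times \<open>\<psi>\<close> of the \<open>n\<close>th power sum of the roots. By Newton's identities
  this power sum is \<open>- n\<close> times the constant coefficient plus a function of the other ones; so
  the sum is \<open>g(\<chi>\<^bsup>n\<^esup>) / \<chi>(n)\<^bsup>n\<^esup>\<close> times a factor independent of \<open>\<chi>\<close>, which is found by taking \<open>\<chi>\<close> trivial.
\<close>


section \<open>Multiplicative characters of a finite field\<close>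

lemma card_ge_2: "CARD('a :: {field, finite}) \<ge> 2"
proof -
  have "card {0, 1 :: 'a} \<le> CARD('a)" by (intro card_mono) auto
  thus ?thesis by simp
qed

text \<open>
  The map \<open>y \<mapsto> x * y\<close> permutes the nonzero elements, so their product is unchanged by
  the factor \<open>x\<close> to the power of their number.
\<close>

lemma power_card_minus_1:
  fixes x :: "'a :: {field, finite}"
  assumes "x \<noteq> 0"
  shows "x ^ (CARD('a) - 1) = 1"
proof -
  have "(\<Prod>y\<in>UNIV-{0}. x * y) = (\<Prod>y\<in>UNIV-{0}. y)"
    by (rule prod.reindex_bij_witness[of _ "\<lambda>y. y / x" "\<lambda>y. x * y"]) (use assms in auto)
  hence "x ^ card (UNIV - {0 :: 'a}) * (\<Prod>y\<in>UNIV-{0}. y) = (\<Prod>y\<in>UNIV-{0::'a}. y)"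
    by (simp add: prod.distrib)
  moreover have "(\<Prod>y\<in>UNIV-{0::'a}. y) \<noteq> 0" by simp
  ultimately show ?thesis by simp
qed

lemma dvd_card_pos: "n dvd CARD('a :: {field, finite}) - 1 \<Longrightarrow> n > 0"
  using card_ge_2[where ?'a='a] by (auto intro!: Nat.gr0I)

lemma power_card_split:
  fixes y :: "'b :: monoid_mult"
  shows "y ^ CARD('a :: {field, finite}) = y ^ (CARD('a) - 1) * y"
  using card_ge_2[where ?'a='a] by (simp flip: power_Suc2)

lemma power_card:
  fixes x :: "'a :: {field, finite}"
  shows "x ^ CARD('a) = x"
proof (cases "x = 0")
  case False
  thus ?thesis by (simp only: power_card_split[where ?'a='a] power_card_minus_1[OF False] mult_1)
qed (use card_ge_2[where ?'a='a] in auto)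

text \<open>
  Induction over the prime factors of \<open>N = p * M\<close>, from a primitive \<open>M\<close>th root \<open>u\<close>. If
  \<open>p\<close> divides \<open>M\<close>, any \<open>p\<close>th root of \<open>u\<close> works. Otherwise \<open>r * u\<close> works, where \<open>r\<close> is a root of
  \<open>1 + X + ... + X\<^bsup>p-1\<^esup>\<close>; in characteristic zero such an \<open>r\<close> differs from \<open>1\<close>.
\<close>

lemma ex_primitive_root_of_unity:
  assumes "N > 0"
  shows "\<exists>w :: 'k :: {alg_closed_field, field_char_0}. \<forall>k. w ^ k = 1 \<longleftrightarrow> N dvd k"
  using assms
proof (induction N rule: less_induct)
  case (less N)
  show ?case
  proof (cases "N = 1")
    case True
    show ?thesis by (rule exI[of _ 1]) (simp add: True)
  next
    case False
    then obtain p where p: "prime p" "p dvd N" using prime_factor_nat by blast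
    then obtain M where M: "N = p * M" by (auto elim: dvdE)
    have "M > 0" using less.prems M by (cases M) auto
    moreover have "M < N" using M \<open>M > 0\<close> prime_gt_1_nat[OF p(1)] by simp
    ultimately obtain u :: 'k where u: "\<And>k. u ^ k = 1 \<longleftrightarrow> M dvd k" using less.IH by blast
    show ?thesis
    proof (cases "p dvd M")
      case True
      obtain w where w: "w ^ p = u" using nth_root_exists[of p u] prime_gt_0_nat[OF p(1)] by blast
      have pw: "w ^ (p * k) = 1 \<longleftrightarrow> M dvd k" for k by (simp add: power_mult w u)
      show ?thesis
      proof (intro exI[of _ w] allI iffI)
        fix k assume "N dvd k"
        then obtain j where "k = p * (M * j)" unfolding M by (metis dvdE mult.assoc)
        thus "w ^ k = 1" using pw by simp
      next
        fix k assume k: "w ^ k = 1"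
        have "w ^ (p * k) = (w ^ k) ^ p" by (simp add: mult.commute flip: power_mult)
        hence "w ^ (p * k) = 1" using k by simp
        then obtain j where j: "k = M * j" using pw by (auto elim: dvdE)
        show "N dvd k"
        proof (rule ccontr)
          assume "\<not> N dvd k"
          hence "\<not> p dvd j" by (auto simp: M j)
          hence "coprime p j" using p(1) by (simp add: prime_imp_coprime_nat)
          then obtain a b where ab: "j * a = p * b + 1" 
            using bezout_nat[of j p] p(1) \<open>\<not> p dvd j\<close> by (metis coprime_commute coprime_imp_gcd_eq_1 dvd_0_right)
          have "w ^ (M * (j * a)) = (w ^ k) ^ a" by (simp add: j power_mult)
          hence "w ^ (M * (j * a)) = 1" using k by simp
          hence "w ^ (M * p * b) * w ^ M = 1" by (simp add: ab distrib_left mult.assoc power_add mult.commute[of "w ^ M"])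
          moreover have "w ^ (M * p * b) = 1" using pw[of "M * b"] by (simp add: mult_ac)
          ultimately have wM: "w ^ M = 1" by simp
          from True obtain M' where M': "M = p * M'" by (auto elim: dvdE)
          have "M dvd M'" using wM pw[of M'] M' by simp
          thus False using M' \<open>M > 0\<close> prime_gt_1_nat[OF p(1)] by (auto dest: dvd_imp_le)
        qed
      qed
    next
      case False
      hence cop: "coprime p M" using p(1) by (simp add: prime_imp_coprime_nat)
      obtain r :: 'k where r: "(\<Sum>k\<le>p-1. 1 * r ^ k) = 0"
        using alg_closed[of "p-1" "\<lambda>_. 1"] prime_gt_1_nat[OF p(1)] by auto
      have r1: "r \<noteq> 1" using r prime_gt_1_nat[OF p(1)] by (auto simp: of_nat_diff)
      have "r ^ p - 1 = (r - 1) * (\<Sum>k<p. r ^ k)" by (rule power_diff_1_eq)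
      moreover have "{..<p} = {..p-1}" using prime_gt_1_nat[OF p(1)] by auto
      ultimately have rp: "r ^ p = 1" using r by simp
      have rk: "r ^ k = 1 \<longleftrightarrow> p dvd k" for k
      proof
        assume "p dvd k" thus "r ^ k = 1" using rp by (auto simp: power_mult)
      next
        assume k: "r ^ k = 1"
        show "p dvd k"
        proof (rule ccontr)
          assume n: "\<not> p dvd k"
          hence "coprime p k" using p(1) by (simp add: prime_imp_coprime_nat)
          then obtain a b where ab: "k * a = p * b + 1" 
            using bezout_nat[of k p] p(1) n by (metis coprime_commute coprime_imp_gcd_eq_1 dvd_0_right)
          have "r ^ (k * a) = 1" "r ^ (p * b) = 1" by (simp_all add: power_mult k rp)
          thus False using r1 by (simp add: ab)
        qed
      qed
      show ?thesis
      proof (intro exI[of _ "r * u"] allI iffI)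
        fix k assume "N dvd k" 
        hence "p dvd k" "M dvd k" by (auto simp: M dest: dvd_mult_left dvd_mult_right)
        hence "r ^ k = 1" "u ^ k = 1" using rk u by simp_all
        thus "(r * u) ^ k = 1" by (simp add: power_mult_distrib)
      next
        fix k assume "(r * u) ^ k = 1"
        hence k: "r ^ k * u ^ k = 1" by (simp add: power_mult_distrib)
        hence "(r ^ k * u ^ k) ^ M = 1" by simp
        hence "r ^ (k*M) * u ^ (k*M) = 1" by (simp add: power_mult_distrib power_mult)
        hence "r ^ (k * M) = 1" using u[of "k * M"] by simp
        hence "p dvd k" using rk cop by (metis coprime_dvd_mult_left_iff)
        moreover from this have "r ^ k = 1" using rk by simp
        hence "M dvd k" using k u by simp
        ultimately show "N dvd k" using cop by (simp add: M divides_mult)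
      qed
    qed
  qed
qed

lemma ex_generator:
  obtains g :: "'a :: {field, finite}" where "g \<noteq> 0" "\<And>x. x \<noteq> 0 \<Longrightarrow> \<exists>k. x = g ^ k"
proof -
  let ?R = "ring_of_type_algebra :: 'a ring"
  have f: "field ?R" by (rule field_from_type_algebra)
  interpret R: field ?R by (rule f)
  have [simp]: "carrier ?R = UNIV" "\<zero>\<^bsub>?R\<^esub> = 0" by (simp_all add: ring_of_type_algebra_def)
  have pow: "x [^]\<^bsub>?R\<^esub> (k :: nat) = x ^ k" for x k
    by (induction k) (simp_all add: ring_of_type_algebra_def nat_pow_def mult.commute)
  from R.finite_field_mult_group_has_gen obtain a where
    "a \<in> carrier (mult_of ?R)" "carrier (mult_of ?R) = {a[^]\<^bsub>?R\<^esub> i | i::nat . i \<in> UNIV}" by auto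
  hence "a \<noteq> 0" "UNIV - {0} = {a ^ i |i. True}" by (auto simp: pow)
  thus ?thesis using that[of a] by blast
qed

lemma generator_power_eq_1_iff:
  fixes g :: "'a :: {field, finite}"
  assumes g: "g \<noteq> 0" "\<And>x :: 'a. x \<noteq> 0 \<Longrightarrow> \<exists>k. x = g ^ k"
  shows "g ^ k = 1 \<longleftrightarrow> (CARD('a) - 1) dvd k"
proof
  assume "(CARD('a) - 1) dvd k" 
  thus "g ^ k = 1" using power_card_minus_1[OF g(1)] by (auto simp: power_mult)
next
  assume k: "g ^ k = 1"
  show "(CARD('a) - 1) dvd k"
  proof (rule ccontr)
    assume n: "\<not> (CARD('a) - 1) dvd k"
    define r where "r = k mod (CARD('a) - 1)"
    have r: "r > 0" "r < CARD('a) - 1" using n card_ge_2[where ?'a='a] by (auto simp: r_def mod_greater_zero_iff_not_dvd)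
    have "g ^ k = g ^ ((CARD('a) - 1) * (k div (CARD('a) - 1)) + r)" by (simp add: r_def)
    hence "g ^ r = 1" using k power_card_minus_1[OF g(1)] by (simp add: power_add power_mult)
    have gj: "g ^ j = g ^ (j mod r)" for j
    proof -
      have "g ^ j = g ^ (r * (j div r) + j mod r)" by simp
      also have "\<dots> = g ^ (j mod r)" unfolding power_add power_mult \<open>g ^ r = 1\<close> by simp
      finally show ?thesis .
    qed
    have "UNIV - {0} \<subseteq> (\<lambda>j. g ^ j) ` {..<r}"
    proof
      fix x :: 'a assume "x \<in> UNIV - {0}"
      then obtain j where "x = g ^ j" using g(2) by blast
      thus "x \<in> (\<lambda>j. g ^ j) ` {..<r}" using gj[of j] r by auto
    qed
    hence "card (UNIV - {0 :: 'a}) \<le> card ((\<lambda>j. g ^ j) ` {..<r})" by (intro card_mono) auto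
    also have "\<dots> \<le> r" using card_image_le[of "{..<r}"] by fastforce
    finally show False using r by (simp add: card_Diff_singleton)
  qed
qed

lemma mcharsD:
  assumes "\<eta> \<in> mchars"
  shows "\<eta> 0 = 0" "x \<noteq> 0 \<Longrightarrow> \<eta> x \<noteq> 0" "\<eta> (x * y) = \<eta> x * \<eta> y" "\<eta> 1 = 1" "\<eta> x = 0 \<longleftrightarrow> x = 0"
proof -
  show a: "\<eta> 0 = 0" and b: "\<And>x. x \<noteq> 0 \<Longrightarrow> \<eta> x \<noteq> 0" using assms by (auto simp: mchars_def)
  show c: "\<eta> (x * y) = \<eta> x * \<eta> y" for x y using assms a by (cases "x = 0 \<or> y = 0") (auto simp: mchars_def)
  have "\<eta> 1 * \<eta> 1 = \<eta> 1" using c[of 1 1] by simp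
  thus "\<eta> 1 = 1" using b[of 1] by simp
  show "\<eta> x = 0 \<longleftrightarrow> x = 0" using a b by auto
qed

lemma mchars_power: "\<eta> \<in> mchars \<Longrightarrow> \<eta> (x ^ k) = \<eta> x ^ k"
  by (induction k) (simp_all add: mcharsD)

lemma mchars_prod: "\<eta> \<in> mchars \<Longrightarrow> \<eta> (\<Prod>i\<in>A. f i) = (\<Prod>i\<in>A. \<eta> (f i))"
  by (induction A rule: infinite_finite_induct) (simp_all add: mcharsD)

lemma mchars_inverse: "\<eta> \<in> mchars \<Longrightarrow> \<eta> (inverse x) = inverse (\<eta> x)"
proof (cases "x = 0")
  case False
  assume "\<eta> \<in> mchars"
  hence "\<eta> x * \<eta> (inverse x) = 1" using False mcharsD(3)[of \<eta> x "inverse x"] by (simp add: mcharsD)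
  thus ?thesis by (simp add: inverse_unique)
qed (simp add: mcharsD)

lemma mchars_divide: "\<eta> \<in> mchars \<Longrightarrow> \<eta> (x / y) = \<eta> x / \<eta> y"
  by (simp add: divide_inverse mcharsD mchars_inverse)

lemma mchars_power_card: "\<eta> \<in> mchars \<Longrightarrow> x \<noteq> 0 \<Longrightarrow> \<eta> x ^ (CARD('a) - 1) = 1"
  for x :: "'a :: {field, finite}"
  by (simp add: power_card_minus_1 mcharsD del: One_nat_def flip: mchars_power)

lemma triv_char_mchars [simp]: "triv_char \<in> mchars"
  by (auto simp: mchars_def triv_char_def)

lemma char_mult_mchars [simp]: "\<alpha> \<in> mchars \<Longrightarrow> \<beta> \<in> mchars \<Longrightarrow> char_mult \<alpha> \<beta> \<in> mchars"
  by (auto simp: mchars_def char_mult_def)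

lemma char_pow_mchars [simp]: "\<alpha> \<in> mchars \<Longrightarrow> char_pow \<alpha> k \<in> mchars"
  by (auto simp: mchars_def char_pow_def power_mult_distrib)

lemma char_pow_0 [simp]: "char_pow \<alpha> 0 = triv_char"
  by (auto simp: char_pow_def triv_char_def)

lemma char_pow_triv [simp]: "char_pow triv_char k = triv_char"
  by (auto simp: char_pow_def triv_char_def)

lemma char_mult_triv [simp]: "\<alpha> \<in> mchars \<Longrightarrow> char_mult \<alpha> triv_char = \<alpha>" "\<alpha> \<in> mchars \<Longrightarrow> char_mult triv_char \<alpha> = \<alpha>"
  by (auto simp: char_mult_def triv_char_def mcharsD fun_eq_iff)

lemma char_mult_assoc: "char_mult (char_mult \<alpha> \<beta>) \<gamma> = char_mult \<alpha> (char_mult \<beta> \<gamma>)"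
  by (simp add: char_mult_def fun_eq_iff)

lemma char_mult_commute: "char_mult \<alpha> \<beta> = char_mult \<beta> \<alpha>"
  by (simp add: char_mult_def fun_eq_iff)

lemma char_pow_add: "char_mult (char_pow \<alpha> k) (char_pow \<alpha> l) = char_pow \<alpha> (k + l)"
  by (simp add: char_mult_def char_pow_def fun_eq_iff power_add)

lemma char_pow_mult: "char_pow (char_pow \<alpha> k) l = char_pow \<alpha> (k * l)"
  by (simp add: char_pow_def fun_eq_iff power_mult)

lemma char_pow_char_mult: "char_pow (char_mult \<alpha> \<beta>) k = char_mult (char_pow \<alpha> k) (char_pow \<beta> k)"
  by (simp add: char_mult_def char_pow_def fun_eq_iff power_mult_distrib)

lemma char_pow_card [simp]: "\<eta> \<in> mchars \<Longrightarrow> char_pow \<eta> (CARD('a) - 1) = (triv_char :: 'a :: {field, finite} \<Rightarrow> _)"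
  by (auto simp: char_pow_def triv_char_def mchars_power_card fun_eq_iff simp del: One_nat_def)

lemma char_pow_1 [simp]: "\<eta> \<in> mchars \<Longrightarrow> char_pow \<eta> (Suc 0) = \<eta>"
  by (auto simp: char_pow_def mcharsD fun_eq_iff)

lemma triv_char_nonzero [simp]: "x \<noteq> 0 \<Longrightarrow> triv_char x = 1"
  by (simp add: triv_char_def)

lemma sum_mchar:
  fixes \<eta> :: "'a :: {field, finite} \<Rightarrow> qbar"
  assumes "\<eta> \<in> mchars"
  shows "(\<Sum>x\<in>{x. x \<noteq> 0}. \<eta> x) = (if \<eta> = triv_char then of_nat (CARD('a) - 1) else 0)"
proof (cases "\<eta> = triv_char")
  case True
  have "{x :: 'a. x \<noteq> 0} = UNIV - {0}" by auto
  thus ?thesis using True by (simp add: card_Diff_singleton)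
next
  case False
  then obtain y where "\<eta> y \<noteq> triv_char y" by (auto simp: fun_eq_iff)
  hence y: "y \<noteq> 0" "\<eta> y \<noteq> 1" using assms by (auto simp: triv_char_def mcharsD split: if_splits)
  have "(\<Sum>x\<in>{x. x \<noteq> 0}. \<eta> x) = (\<Sum>x\<in>{x. x \<noteq> 0}. \<eta> (y * x))"
    by (rule sum.reindex_bij_witness[of _ "\<lambda>x. y * x" "\<lambda>x. x / y"]) (use y in auto)
  also have "\<dots> = \<eta> y * (\<Sum>x\<in>{x. x \<noteq> 0}. \<eta> x)" using assms by (simp add: mcharsD sum_distrib_left)
  finally show ?thesis using y False by (simp add: mult_cancel_right1)
qed

text \<open>
  A generator of the cyclic group \<open>F\<^sub>q\<^sup>\<times>\<close> is sent to a primitive root of unity of the same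
  order. Orthogonality over the characters and the injectivity of a generating character rest
  on this existence statement.
\<close>

lemma ex_faithful_mchar:
  obtains \<eta> :: "'a :: {field, finite} \<Rightarrow> qbar" where "\<eta> \<in> mchars" "\<And>x. x \<noteq> 0 \<Longrightarrow> \<eta> x = 1 \<Longrightarrow> x = 1"
proof -
  obtain g :: 'a where g: "g \<noteq> 0" "\<And>x. x \<noteq> 0 \<Longrightarrow> \<exists>k. x = g ^ k" by (rule ex_generator) blast
  have q: "CARD('a) - 1 > 0" using card_ge_2[where ?'a='a] by simp
  obtain w :: qbar where w: "\<And>k. w ^ k = 1 \<longleftrightarrow> (CARD('a) - 1) dvd k"
    using ex_primitive_root_of_unity[OF q] by blast
  have w0: "w \<noteq> 0" using w[of "CARD('a) - 1"] q by (metis dvd_refl neq0_conv power_0_left zero_neq_one)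
  have gw: "w ^ k = w ^ l" if "g ^ k = g ^ l" for k l
    using that
  proof (induction k l rule: linorder_wlog)
    case (le k l)
    hence "g ^ k * g ^ (l - k) = g ^ k * 1" by (metis le_add_diff_inverse mult.right_neutral power_add)
    hence "g ^ (l - k) = 1" using g by simp
    hence "w ^ (l - k) = 1" using generator_power_eq_1_iff[OF g] w by simp
    hence "w ^ k * w ^ (l - k) = w ^ k" by simp
    thus ?case using le(1) by (metis le_add_diff_inverse power_add)
  qed auto
  \<comment> \<open>a discrete logarithm; it is well defined only modulo the order of \<open>g\<close>, which \<open>gw\<close> takes care of\<close>
  define L where "L x = (SOME k. x = g ^ k)" for x
  have L: "g ^ L x = x" if "x \<noteq> 0" for x using someI_ex[OF g(2)[OF that]] by (simp add: L_def)
  define \<eta> where "\<eta> x = (if x = 0 then 0 else w ^ L x)" for x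
  have "\<eta> (x * y) = \<eta> x * \<eta> y" if "x \<noteq> 0" "y \<noteq> 0" for x y
    using that gw[of "L (x * y)" "L x + L y"] by (simp add: \<eta>_def L power_add)
  hence "\<eta> \<in> mchars" using w0 by (auto simp: mchars_def \<eta>_def)
  moreover have "x = 1" if "x \<noteq> 0" "\<eta> x = 1" for x
  proof -
    have "w ^ L x = 1" using that by (simp add: \<eta>_def)
    hence "g ^ L x = 1" using w generator_power_eq_1_iff[OF g] by simp
    thus ?thesis using L[OF that(1)] by simp
  qed
  ultimately show ?thesis using that by blast
qed

lemma generates_mcharsD: "generates_mchars \<phi> \<Longrightarrow> \<phi> \<in> mchars"
  by (simp add: generates_mchars_def)

text \<open>
  The faithful character is a power of \<open>\<phi>\<close>, hence \<open>\<phi>\<close> is faithful too.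
\<close>

lemma generator_eq_1_iff:
  fixes \<phi> :: "'a :: {field, finite} \<Rightarrow> qbar"
  assumes "generates_mchars \<phi>"
  shows "\<phi> x = 1 \<longleftrightarrow> x = 1"
proof
  assume x: "\<phi> x = 1"
  hence x0: "x \<noteq> 0" using assms by (auto simp: generates_mchars_def mcharsD)
  obtain \<eta> :: "'a \<Rightarrow> qbar" where \<eta>: "\<eta> \<in> mchars" "\<And>x. x \<noteq> 0 \<Longrightarrow> \<eta> x = 1 \<Longrightarrow> x = 1"
    by (rule ex_faithful_mchar) blast
  then obtain k where "\<eta> = char_pow \<phi> k" using assms by (auto simp: generates_mchars_def)
  hence "\<eta> x = 1" using x x0 by (simp add: char_pow_def)
  thus "x = 1" using \<eta> x0 by simp
qed (use assms in \<open>simp add: generates_mchars_def mcharsD\<close>)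

lemma char_pow_generator_triv_iff:
  fixes \<phi> :: "'a :: {field, finite} \<Rightarrow> qbar"
  assumes "generates_mchars \<phi>"
  shows "char_pow \<phi> k = triv_char \<longleftrightarrow> (CARD('a) - 1) dvd k"
proof -
  note m = generates_mcharsD[OF assms]
  obtain g :: 'a where g: "g \<noteq> 0" "\<And>x. x \<noteq> 0 \<Longrightarrow> \<exists>k. x = g ^ k" by (rule ex_generator) blast
  show ?thesis
  proof
    assume "char_pow \<phi> k = triv_char"
    hence "char_pow \<phi> k g = triv_char g" by simp
    hence "\<phi> (g ^ k) = 1" using g m by (simp add: char_pow_def mchars_power)
    thus "(CARD('a) - 1) dvd k" using generator_power_eq_1_iff[OF g] generator_eq_1_iff[OF assms] by simp
  next
    assume "(CARD('a) - 1) dvd k"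
    then obtain j where "k = (CARD('a) - 1) * j" by (rule dvdE)
    thus "char_pow \<phi> k = triv_char" using m by (simp del: One_nat_def flip: char_pow_mult)
  qed
qed

lemma char_pow_generator_eq_iff:
  fixes \<phi> :: "'a :: {field, finite} \<Rightarrow> qbar"
  assumes "generates_mchars \<phi>"
  shows "char_pow \<phi> k = char_pow \<phi> l \<longleftrightarrow> k mod (CARD('a) - 1) = l mod (CARD('a) - 1)"
proof (induction k l rule: linorder_wlog)
  case (sym a b) thus ?case by metis
next
  case (le k l)
  note m = generates_mcharsD[OF assms]
  have "char_pow \<phi> l = char_pow \<phi> k \<longleftrightarrow> char_mult (char_pow \<phi> k) (char_pow \<phi> (l - k)) = char_pow \<phi> k"
    using le by (simp add: char_pow_add)
  also have "\<dots> \<longleftrightarrow> char_pow \<phi> (l - k) = triv_char"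
    using m by (auto simp: char_mult_def fun_eq_iff char_pow_def triv_char_def mcharsD)
  also have "\<dots> \<longleftrightarrow> (CARD('a) - 1) dvd (l - k)" by (rule char_pow_generator_triv_iff[OF assms])
  also have "\<dots> \<longleftrightarrow> l mod (CARD('a) - 1) = k mod (CARD('a) - 1)" using le by (simp add: mod_eq_dvd_iff_nat)
  finally show ?case by metis
qed

lemma mchars_eq:
  fixes \<phi> :: "'a :: {field, finite} \<Rightarrow> qbar"
  assumes "generates_mchars \<phi>"
  shows "mchars = char_pow \<phi> ` {..<CARD('a) - 1}" "inj_on (char_pow \<phi>) {..<CARD('a) - 1}"
proof -
  note m = generates_mcharsD[OF assms]
  show "inj_on (char_pow \<phi>) {..<CARD('a) - 1}"
    by (auto simp: inj_on_def char_pow_generator_eq_iff[OF assms])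
  have "\<eta> \<in> char_pow \<phi> ` {..<CARD('a) - 1}" if \<eta>: "\<eta> \<in> mchars" for \<eta>
  proof -
    obtain k where "\<eta> = char_pow \<phi> k" using assms \<eta> by (auto simp: generates_mchars_def)
    also have "\<dots> = char_pow \<phi> (k mod (CARD('a) - 1))" by (simp add: char_pow_generator_eq_iff[OF assms])
    finally show ?thesis using card_ge_2[where ?'a='a] by auto
  qed
  thus "mchars = char_pow \<phi> ` {..<CARD('a) - 1}" using m by auto
qed

lemma finite_mchars:
  fixes \<phi> :: "'a :: {field, finite} \<Rightarrow> qbar"
  assumes "generates_mchars \<phi>"
  shows "finite (mchars :: ('a \<Rightarrow> qbar) set)"
  by (simp add: mchars_eq[OF assms])

lemma sum_over_mchars:
  fixes \<phi> :: "'a :: {field, finite} \<Rightarrow> qbar"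
  assumes "generates_mchars \<phi>" "x \<noteq> (0 :: 'a)"
  shows "(\<Sum>\<nu>\<in>mchars. \<nu> x) = (if x = 1 then of_nat (CARD('a) - 1) else 0)"
proof (cases "x = 1")
  case True
  have "(\<Sum>\<nu>\<in>mchars. \<nu> x) = (\<Sum>\<nu>\<in>(mchars :: ('a \<Rightarrow> qbar) set). 1)"
    by (rule sum.cong) (simp_all add: True mcharsD)
  also have "\<dots> = of_nat (CARD('a) - 1)"
    using card_image[OF mchars_eq(2)[OF assms(1)]] by (simp add: mchars_eq(1)[OF assms(1)])
  finally show ?thesis using True by simp
next
  case False
  have "(\<Sum>\<nu>\<in>mchars. \<nu> x) = (\<Sum>k<CARD('a) - 1. \<phi> x ^ k)"
    using assms by (simp add: mchars_eq(1)[OF assms(1)] sum.reindex[OF mchars_eq(2)[OF assms(1)]] char_pow_def del: One_nat_def)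
  moreover have "\<phi> x \<noteq> 1" using generator_eq_1_iff[OF assms(1)] False by simp
  moreover have "(\<phi> x - 1) * (\<Sum>k<CARD('a) - 1. \<phi> x ^ k) = 0"
    using mchars_power_card[of \<phi> x] assms by (simp add: generates_mcharsD flip: power_diff_1_eq)
  ultimately show ?thesis using False by simp
qed

section \<open>The Frobenius map on the algebraic closure\<close>

text \<open>
  The polynomial \<open>(X + 1)\<^bsup>q\<^esup> - X\<^bsup>q\<^esup> - 1\<close> has degree below \<open>q\<close> and vanishes on the whole field, so its
  coefficients vanish. This gives additivity of the Frobenius map without writing \<open>q\<close> as a power
  of the characteristic.
\<close>

lemma frobenius_binomial:
  assumes "0 < k" "k < CARD('a :: {field, finite})"
  shows "of_nat (CARD('a) choose k) = (0 :: 'a)"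
proof -
  define q where "q = CARD('a)"
  have q: "q \<ge> 2" using card_ge_2 by (simp add: q_def)
  define p :: "'a poly" where "p = [:1, 1:] ^ q - monom 1 q - 1"
  have co: "coeff ([:1, 1 :: 'a:] ^ q) i = of_nat (q choose i)" if "i \<le> q" for i
    using that by (simp add: coeff_linear_poly_power)
  have deg: "degree ([:1, 1 :: 'a:] ^ q) = q" by (simp add: degree_power_eq)
  have "degree p < q"
  proof (rule degree_lessI)
    show "p \<noteq> 0 \<or> 0 < q" using q by simp
    show "\<forall>i\<ge>q. coeff p i = 0"
    proof (intro allI impI)
      fix i assume "q \<le> i"
      thus "coeff p i = 0" using q deg co[of q] by (cases "i = q") (auto simp: p_def coeff_eq_0)
    qed
  qed
  moreover have "poly p x = 0" for x
    using power_card[of x] power_card[of "1 + x"] by (simp add: p_def q_def poly_monom)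
  hence "{x. poly p x = 0} = UNIV" by auto
  ultimately have "p = 0" using card_poly_roots_bound[of p] by (auto simp: q_def)
  hence "coeff p k = 0" by simp
  thus ?thesis using assms co[of k] by (auto simp: p_def q_def)
qed

lemma frobenius_add:
  fixes x y :: "'a :: {field, finite} alg_closure"
  shows "(x + y) ^ CARD('a) = x ^ CARD('a) + y ^ CARD('a)"
proof -
  define q where "q = CARD('a)"
  have q: "q \<ge> 2" using card_ge_2 by (simp add: q_def)
  have "(x + y) ^ q = (\<Sum>k\<le>q. of_nat (q choose k) * x ^ k * y ^ (q - k))"
    by (rule binomial_ring)
  also have "\<dots> = (\<Sum>k\<in>{0,q}. of_nat (q choose k) * x ^ k * y ^ (q - k))"
  proof (intro sum.mono_neutral_right ballI)
    fix k assume "k \<in> {..q} - {0, q}"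
    hence "to_ac (of_nat (q choose k) :: 'a) = to_ac 0" by (subst q_def, subst frobenius_binomial) (auto simp: q_def)
    hence "of_nat (q choose k) = (0 :: 'a alg_closure)" by simp
    thus "of_nat (q choose k) * x ^ k * y ^ (q - k) = 0" by simp
  qed auto
  also have "\<dots> = x ^ q + y ^ q" using q by simp
  finally show ?thesis by (simp add: q_def)
qed

lemma frobenius_minus:
  fixes x :: "'a :: {field, finite} alg_closure"
  shows "(- x) ^ CARD('a) = - (x ^ CARD('a))"
proof -
  have "(x + - x) ^ CARD('a) = 0" using card_ge_2[where ?'a='a] by simp
  hence "x ^ CARD('a) + (- x) ^ CARD('a) = 0" by (simp only: frobenius_add)
  thus ?thesis by (simp add: eq_neg_iff_add_eq_0 add.commute)
qed

lemma frobenius_diff: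
  fixes x y :: "'a :: {field, finite} alg_closure"
  shows "(x - y) ^ CARD('a) = x ^ CARD('a) - y ^ CARD('a)"
  using frobenius_add[of x "- y"] by (simp add: frobenius_minus)

lemma frobenius_inj:
  fixes x y :: "'a :: {field, finite} alg_closure"
  shows "x ^ CARD('a) = y ^ CARD('a) \<longleftrightarrow> x = y"
proof
  assume "x ^ CARD('a) = y ^ CARD('a)"
  hence "(x - y) ^ CARD('a) = 0" by (simp add: frobenius_diff)
  thus "x = y" by simp
qed simp

lemma frobenius_sum_mset:
  fixes D :: "'a :: {field, finite} alg_closure multiset"
  shows "sum_mset D ^ CARD('a) = sum_mset (image_mset (\<lambda>x. x ^ CARD('a)) D)"
  using card_ge_2[where ?'a='a] by (induction D) (auto simp: frobenius_add)

lemma frobenius_iterate_inj: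
  fixes x y :: "'a :: {field, finite} alg_closure"
  shows "x ^ (CARD('a) ^ r) = y ^ (CARD('a) ^ r) \<longleftrightarrow> x = y"
proof (induction r)
  case (Suc r)
  have "z ^ (CARD('a) ^ Suc r) = (z ^ (CARD('a) ^ r)) ^ CARD('a)" for z :: "'a alg_closure"
    by (simp add: power_mult [symmetric] mult.commute)
  thus ?case using Suc frobenius_inj by metis
qed simp

lemma finite_power_eq_self:
  fixes n :: nat
  assumes "n \<ge> 2"
  shows "finite {x :: 'k :: field. x ^ n = x}" "card {x :: 'k. x ^ n = x} \<le> n"
proof -
  define p :: "'k poly" where "p = monom 1 n - monom 1 1"
  have "coeff p n \<noteq> 0" using assms by (auto simp: p_def)
  hence p: "p \<noteq> 0" by auto
  have e: "{x :: 'k. x ^ n = x} = {x. poly p x = 0}" by (auto simp: p_def poly_monom)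
  show "finite {x :: 'k. x ^ n = x}" unfolding e by (rule poly_roots_finite[OF p])
  have "degree p \<le> n" unfolding p_def using assms by (intro degree_diff_le degree_monom_le) (auto intro: order_trans[OF degree_monom_le])
  thus "card {x :: 'k. x ^ n = x} \<le> n" unfolding e using card_poly_roots_bound[OF p] by simp
qed

text \<open>
  The \<open>q\<close> elements of the small field already exhaust the roots of \<open>X\<^bsup>q\<^esup> - X\<close>.
\<close>

lemma frobenius_fixed_iff:
  fixes x :: "'a :: {field, finite} alg_closure"
  shows "x ^ CARD('a) = x \<longleftrightarrow> x \<in> range to_ac"
proof -
  have "range to_ac \<subseteq> {x :: 'a alg_closure. x ^ CARD('a) = x}"
    by (auto simp: power_card simp flip: to_ac_power)
  moreover have "card (range (to_ac :: 'a \<Rightarrow> _)) = CARD('a)" by (rule card_image) (rule inj_to_ac)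
  ultimately have "range to_ac = {x :: 'a alg_closure. x ^ CARD('a) = x}"
    using finite_power_eq_self[OF card_ge_2[where ?'a='a], where ?'k = "'a alg_closure"]
    by (intro card_seteq) auto
  thus ?thesis by auto
qed

lemma of_ac_add: "x \<in> range to_ac \<Longrightarrow> y \<in> range to_ac \<Longrightarrow> of_ac (x + y) = of_ac x + of_ac y"
  by (metis of_ac_to_ac rangeE to_ac_add)

lemma of_ac_mult: "x \<in> range to_ac \<Longrightarrow> y \<in> range to_ac \<Longrightarrow> of_ac (x * y) = of_ac x * of_ac y"
  by (metis of_ac_to_ac rangeE to_ac_mult)


section \<open>Newton's identities\<close>

definition root_fps :: "'k :: idom multiset \<Rightarrow> 'k fps" where
  "root_fps D = (\<Prod>x\<in>#D. 1 - fps_const x * fps_X)"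

definition power_sum :: "nat \<Rightarrow> 'k :: idom multiset \<Rightarrow> 'k" where
  "power_sum j D = (\<Sum>x\<in>#D. x ^ j)"

text \<open>
  Newton's identities are the logarithmic derivative of \<open>\<Prod>x. 1 - x * X\<close>, with
  denominators cleared; the proof adds one linear factor at a time, using that the logarithmic
  derivative of \<open>1 - x * X\<close> is a geometric series.
\<close>

lemma newton_fps:
  fixes D :: "'k :: idom multiset"
  defines "P \<equiv> (\<lambda>D. Abs_fps (\<lambda>k. if k = 0 then 0 else power_sum k D))"
  shows "fps_X * fps_deriv (root_fps D) + root_fps D * P D = 0"
proof (induction D)
  case empty
  show ?case by (auto simp: root_fps_def P_def power_sum_def fps_eq_iff fps_mult_nth)
next
  case (add x D)
  define G where "G = Abs_fps (\<lambda>k. if k = 0 then 0 else x ^ k)"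
  have 1: "P (add_mset x D) = P D + G"
    by (auto simp: P_def G_def power_sum_def fps_eq_iff)
  have 2: "(1 - fps_const x * fps_X) * G = fps_const x * fps_X"
  proof (rule fps_ext)
    fix k
    have "((1 - fps_const x * fps_X) * G) $ k = G $ k - x * (fps_X * G) $ k"
      by (simp only: left_diff_distrib mult.assoc fps_sub_nth fps_mult_left_const_nth mult_1_left)
    also have "\<dots> = (fps_const x * fps_X) $ k"
    proof (cases k)
      case (Suc m) thus ?thesis by (cases m) (simp_all add: G_def)
    qed (simp add: G_def)
    finally show "((1 - fps_const x * fps_X) * G) $ k = (fps_const x * fps_X) $ k" .
  qed
  have 3: "root_fps (add_mset x D) = (1 - fps_const x * fps_X) * root_fps D"
    by (simp add: root_fps_def)
  have "fps_X * fps_deriv (root_fps (add_mset x D)) + root_fps (add_mset x D) * P (add_mset x D) =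
     (1 - fps_const x * fps_X) * (fps_X * fps_deriv (root_fps D) + root_fps D * P D)
       + root_fps D * ((1 - fps_const x * fps_X) * G - fps_const x * fps_X)"
    unfolding 1 3 by (simp add: algebra_simps)
  thus ?case using add.IH 2 by simp
qed

lemma newton:
  fixes D :: "'k :: idom multiset"
  shows "of_nat k * root_fps D $ k = - (\<Sum>j=1..k. power_sum j D * root_fps D $ (k - j))"
proof -
  define P where "P = Abs_fps (\<lambda>k. if k = 0 then 0 else power_sum k D)"
  have "(fps_X * fps_deriv (root_fps D) + root_fps D * P) $ k = 0"
    using newton_fps[of D] by (simp add: P_def)
  moreover have "(fps_X * fps_deriv (root_fps D)) $ k = of_nat k * root_fps D $ k"
    by (cases k) simp_all
  moreover have "(root_fps D * P) $ k = (\<Sum>j=1..k. power_sum j D * root_fps D $ (k - j))"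
  proof -
    have "(root_fps D * P) $ k = (\<Sum>j=0..k. P $ j * root_fps D $ (k - j))"
      by (subst mult.commute) (rule fps_mult_nth)
    also have "\<dots> = (\<Sum>j=1..k. P $ j * root_fps D $ (k - j))"
      by (rule sum.mono_neutral_right) (auto simp: P_def not_less_eq_eq Suc_le_eq)
    finally show ?thesis by (simp add: P_def)
  qed
  ultimately show ?thesis by (simp add: eq_neg_iff_add_eq_0)
qed

definition root_poly :: "'k :: idom multiset \<Rightarrow> 'k poly" where
  "root_poly D = (\<Prod>x\<in>#D. [:- x, 1:])"

lemma root_poly_add_mset [simp]: "root_poly (add_mset x D) = [:- x, 1:] * root_poly D"
  and root_poly_empty [simp]: "root_poly {#} = 1"
  by (simp_all add: root_poly_def)

lemma root_poly_nonzero [simp]: "root_poly D \<noteq> 0"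
  by (auto simp: root_poly_def)

lemma monic_root_poly: "lead_coeff (root_poly D) = 1"
  by (induction D) (simp_all add: lead_coeff_mult del: mult_pCons_left)

lemma degree_root_poly [simp]: "degree (root_poly D) = size D"
  by (induction D) (simp_all add: degree_mult_eq del: mult_pCons_left)

lemma coeff_0_root_poly: "coeff (root_poly D) 0 = (- 1) ^ size D * prod_mset D"
  by (induction D) (simp_all add: coeff_mult_0 del: mult_pCons_left)

lemma proots_root_poly [simp]: "proots (root_poly D) = D"
  by (induction D) (simp_all add: proots_mult del: mult_pCons_left)

lemma root_fps_eq: "root_fps D = fps_of_poly (reflect_poly (root_poly D))"
proof (induction D)
  case (add x D)
  have "reflect_poly [:- x, 1:] = [:1, - x:]"
    by (cases "x = 0") (simp_all add: reflect_poly_def)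
  hence "fps_of_poly (reflect_poly [:- x, 1:]) = 1 - fps_const x * fps_X"
    by (simp add: fps_of_poly_pCons)
  thus ?case using add by (simp add: root_fps_def reflect_poly_mult fps_of_poly_mult del: mult_pCons_left)
qed (simp add: root_fps_def)

lemma root_fps_nth: "k \<le> size D \<Longrightarrow> root_fps D $ k = coeff (root_poly D) (size D - k)"
  by (simp add: root_fps_eq coeff_reflect_poly)

text \<open>
  In the last Newton identity the constant coefficient occurs only in the term with factor \<open>n\<close>:
  the lower power sums are determined by the higher coefficients. So \<open>p\<^sub>n\<close> is an affine function of
  the constant coefficient once the others are fixed.
\<close>

lemma power_sum_cong:
  fixes D D' :: "'k :: idom multiset"
  assumes "size D = n" "size D' = n"
    and "\<And>i. i > 0 \<Longrightarrow> coeff (root_poly D) i = coeff (root_poly D') i"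
  shows "power_sum n D + of_nat n * coeff (root_poly D) 0 = power_sum n D' + of_nat n * coeff (root_poly D') 0"
proof -
  have e: "root_fps D $ k = root_fps D' $ k" if "k < n" for k
    using that assms by (simp add: root_fps_nth)
  have p: "power_sum k D = - of_nat k * root_fps D $ k - (\<Sum>j=1..<k. power_sum j D * root_fps D $ (k - j))" 
    if "k > 0" for k and D :: "'k multiset"
  proof -
    have "{1..k} = insert k {1..<k}" using that by auto
    hence "of_nat k * root_fps D $ k = - (power_sum k D * root_fps D $ 0 + (\<Sum>j=1..<k. power_sum j D * root_fps D $ (k - j)))"
      using newton[of k D] by simp
    moreover have "root_fps D $ 0 = 1" 
      using monic_root_poly[of D] by (simp add: root_fps_nth)
    ultimately have "of_nat k * root_fps D $ k = - (power_sum k D + (\<Sum>j=1..<k. power_sum j D * root_fps D $ (k - j)))"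
      by simp
    thus ?thesis by simp
  qed
  have l: "power_sum k D = power_sum k D'" if "k < n" "k > 0" for k
    using that
  proof (induction k rule: less_induct)
    case (less k)
    have "(\<Sum>j=1..<k. power_sum j D * root_fps D $ (k - j)) = (\<Sum>j=1..<k. power_sum j D' * root_fps D' $ (k - j))"
      by (rule sum.cong) (use less e in auto)
    thus ?case using less.prems p[of k D] p[of k D'] e by simp
  qed
  show ?thesis
  proof (cases "n = 0")
    case False
    have "(\<Sum>j=1..<n. power_sum j D * root_fps D $ (n - j)) = (\<Sum>j=1..<n. power_sum j D' * root_fps D' $ (n - j))"
      by (rule sum.cong) (use l e in auto)
    thus ?thesis using p[of n D] p[of n D'] False assms by (simp add: root_fps_nth)
  qed (use assms in auto)
qed

section \<open>Frobenius-invariant divisors\<close>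

text \<open>
  These are the effective divisors of the multiplicative group defined over the finite field, each
  given by its geometric points.
\<close>

definition invariant_divisors :: "'a :: {field, finite} alg_closure multiset set" where
  "invariant_divisors = {D. 0 \<notin># D \<and> image_mset (\<lambda>x. x ^ CARD('a)) D = D}"

definition divisors_of_size :: "nat \<Rightarrow> 'a :: {field, finite} alg_closure multiset set" where
  "divisors_of_size N = {D \<in> invariant_divisors. size D = N}"

text \<open>
  The nonzero elements of the extension of degree \<open>r\<close>, for \<open>r > 0\<close>.
\<close>

definition unit_points :: "nat \<Rightarrow> 'a :: {field, finite} alg_closure set" where
  "unit_points r = {b. b \<noteq> 0 \<and> b ^ (CARD('a) ^ r) = b}"

text \<open>
  The conjugates over the small field of an element \<open>b\<close> of the extension of degree \<open>r\<close>, each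
  counted \<open>r / s\<close> times if \<open>b\<close> has degree \<open>s\<close>. Its product and its sum are the norm and the
  trace of \<open>b\<close>.
\<close>

definition frob_orbit :: "nat \<Rightarrow> 'a :: {field, finite} alg_closure \<Rightarrow> 'a alg_closure multiset" where
  "frob_orbit r b = mset (map (\<lambda>i. b ^ (CARD('a) ^ i)) [0..<r])"

lemma size_frob_orbit [simp]: "size (frob_orbit r b) = r"
  by (simp add: frob_orbit_def)

lemma frob_orbit_invariant:
  fixes b :: "'a :: {field, finite} alg_closure"
  assumes "b \<in> unit_points r"
  shows "frob_orbit r b \<in> invariant_divisors"
proof -
  define f where "f i = b ^ (CARD('a) ^ i)" for i
  have "image_mset (\<lambda>x. x ^ CARD('a)) (frob_orbit r b) = mset (map (\<lambda>i. f (Suc i)) [0..<r])"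
    by (simp add: frob_orbit_def f_def multiset.map_comp comp_def mult.commute flip: mset_map power_mult)
  also have "\<dots> = mset (map f [Suc 0..<Suc r])" by (simp only: map_Suc_upt [symmetric] map_map comp_def)
  also have "\<dots> = mset (map f [0..<r])"
  proof (cases r)
    case (Suc m)
    have "f (Suc m) = f 0" using assms Suc by (simp add: f_def unit_points_def)
    moreover have "[0..<Suc m] = 0 # [Suc 0..<Suc m]" by (simp add: upt_conv_Cons del: upt_Suc)
    moreover have "[Suc 0..<Suc (Suc m)] = [Suc 0..<Suc m] @ [Suc m]" by simp
    ultimately show ?thesis unfolding Suc by (simp del: upt_Suc)
  qed simp
  also have "\<dots> = frob_orbit r b" by (simp only: frob_orbit_def f_def[abs_def])
  finally show ?thesis using assms by (auto simp: invariant_divisors_def frob_orbit_def unit_points_def)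
qed

lemma count_invariant:
  fixes b :: "'a :: {field, finite} alg_closure"
  assumes "D \<in> invariant_divisors"
  shows "count D (b ^ (CARD('a) ^ i)) = count D b"
proof (induction i)
  case (Suc i)
  have "count (image_mset (\<lambda>x. x ^ CARD('a)) E) (x ^ CARD('a)) = count E x" for x and E :: "'a alg_closure multiset"
    by (induction E) (auto simp: frobenius_inj)
  from this[of D] have "count D (x ^ CARD('a)) = count D x" for x
    using assms by (simp add: invariant_divisors_def)
  from this[of "b ^ (CARD('a) ^ i)"] Suc show ?case by (simp add: mult.commute flip: power_mult)
qed simp

text \<open>
  The iterates of Frobenius on \<open>b\<close> stay in the finite support of \<open>D\<close>, so two of them agree, and
  Frobenius is injective.
\<close>

lemma ex_period:
  fixes b :: "'a :: {field, finite} alg_closure"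
  assumes "D \<in> invariant_divisors" "b \<in># D"
  shows "\<exists>s>0. b ^ (CARD('a) ^ s) = b"
proof -
  define f where "f i = b ^ (CARD('a) ^ i)" for i
  have "f i \<in># D" for i using count_invariant[OF assms(1), of b i] assms(2) by (auto simp: f_def simp flip: count_greater_zero_iff)
  hence "f ` UNIV \<subseteq> set_mset D" by auto
  hence "finite (f ` UNIV)" by (rule finite_subset) simp
  hence "\<not> inj f" using finite_imageD infinite_UNIV_nat by blast
  then obtain i j where "i \<noteq> j" "f i = f j" by (auto simp: inj_def)
  then obtain i j where ij: "i < j" "f i = f j" by (metis linorder_neqE_nat)
  have "f j = (b ^ (CARD('a) ^ (j - i))) ^ (CARD('a) ^ i)"
    using ij(1) by (simp add: f_def flip: power_mult power_add)
  hence "(b ^ (CARD('a) ^ (j - i))) ^ (CARD('a) ^ i) = b ^ (CARD('a) ^ i)" using ij(2) by (simp only: f_def)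
  hence "b ^ (CARD('a) ^ (j - i)) = b" by (simp only: frobenius_iterate_inj)
  thus ?thesis using ij(1) by (intro exI[of _ "j - i"]) simp
qed

lemma frob_orbit_period:
  fixes b :: "'a :: {field, finite} alg_closure"
  assumes "\<exists>s>0. b ^ (CARD('a) ^ s) = b"
  obtains s where "s > 0" "\<And>r. b ^ (CARD('a) ^ r) = b \<longleftrightarrow> s dvd r"
    "\<And>e. frob_orbit (s * e) b = repeat_mset e (frob_orbit s b)" "count (frob_orbit s b) b = 1"
    "\<And>y. count (frob_orbit s b) y \<le> 1"
proof -
  define s where "s = (LEAST s. s > 0 \<and> b ^ (CARD('a) ^ s) = b)"
  have s: "s > 0" "b ^ (CARD('a) ^ s) = b" using LeastI_ex[OF assms] by (auto simp: s_def)
  have m: "s \<le> t" if "t > 0" "b ^ (CARD('a) ^ t) = b" for t unfolding s_def by (rule Least_le) (use that in auto)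
  have se: "b ^ (CARD('a) ^ (s * e)) = b" for e
  proof (induction e)
    case (Suc e)
    have "b ^ (CARD('a) ^ (s * Suc e)) = (b ^ (CARD('a) ^ s)) ^ (CARD('a) ^ (s * e))"
      by (simp add: power_add power_mult)
    thus ?case using s Suc by simp
  qed simp
  have per: "b ^ (CARD('a) ^ (s * e + i)) = b ^ (CARD('a) ^ i)" for e i
    using se[of e] by (simp add: power_add power_mult)
  have dvd: "b ^ (CARD('a) ^ r) = b \<longleftrightarrow> s dvd r" for r
  proof
    assume "s dvd r" thus "b ^ (CARD('a) ^ r) = b" using se by (auto elim: dvdE)
  next
    assume "b ^ (CARD('a) ^ r) = b"
    hence "b ^ (CARD('a) ^ (r mod s)) = b" using per[of "r div s" "r mod s"] by simp
    hence "r mod s = 0" using m[of "r mod s"] s by (metis mod_less_divisor not_le neq0_conv)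
    thus "s dvd r" by auto
  qed
  have rep: "frob_orbit (s * e) b = repeat_mset e (frob_orbit s b)" for e
  proof (induction e)
    case (Suc e)
    have "[0..<s * Suc e] = [0..<s * e] @ [s * e..<s * e + s]"
      by (subst upt_add_eq_append [symmetric]) (simp_all add: add.commute)
    also have "[s * e..<s * e + s] = map (\<lambda>i. i + s * e) [0..<s]" by (subst map_add_upt) (simp add: add.commute)
    finally have "frob_orbit (s * Suc e) b = frob_orbit (s * e) b + mset (map (\<lambda>i. b ^ (CARD('a) ^ (s * e + i))) [0..<s])"
      by (simp add: frob_orbit_def comp_def add.commute)
    thus ?case using Suc unfolding per by (simp add: frob_orbit_def)
  qed (simp add: frob_orbit_def)
  have "distinct (map (\<lambda>i. b ^ (CARD('a) ^ i)) [0..<s])"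
  proof -
    have False if "i < j" "j < s" "b ^ (CARD('a) ^ i) = b ^ (CARD('a) ^ j)" for i j
    proof -
      have "b ^ (CARD('a) ^ j) = (b ^ (CARD('a) ^ (j - i))) ^ (CARD('a) ^ i)"
        using that by (simp flip: power_mult power_add)
      hence "b ^ (CARD('a) ^ (j - i)) = b" using that frobenius_iterate_inj by metis
      thus False using m[of "j - i"] that by simp
    qed
    hence "inj_on (\<lambda>i. b ^ (CARD('a) ^ i)) {0..<s}" by (intro linorder_inj_onI) force+
    thus ?thesis by (simp add: distinct_map)
  qed
  hence "\<And>y. count (frob_orbit s b) y = (if y \<in> set (map (\<lambda>i. b ^ (CARD('a) ^ i)) [0..<s]) then 1 else 0)"
    unfolding frob_orbit_def by (simp add: distinct_count_atmost_1)
  moreover have "b \<in> set (map (\<lambda>i. b ^ (CARD('a) ^ i)) [0..<s])" using s by (auto intro!: image_eqI[of _ _ 0])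
  ultimately show ?thesis using that[OF s(1) dvd rep] by auto
qed

text \<open>
  If \<open>b\<close> has degree \<open>s\<close>, the relevant \<open>r\<close> are \<open>s * e\<close>, and the orbit for \<open>s * e\<close> is \<open>e\<close> times
  the set of conjugates of \<open>b\<close>. All conjugates have the multiplicity of \<open>b\<close> in \<open>D\<close>, so the orbit
  fits into \<open>D\<close> exactly when \<open>e\<close> is at most this multiplicity.
\<close>

lemma card_orbits_in_divisor:
  fixes b :: "'a :: {field, finite} alg_closure"
  assumes D: "D \<in> invariant_divisors" and b: "b \<in># D"
  shows "card {r \<in> {1..size D}. b ^ (CARD('a) ^ r) = b \<and> frob_orbit r b \<subseteq># D} = count D b"
proof -
  obtain s where s: "s > 0" "\<And>r. b ^ (CARD('a) ^ r) = b \<longleftrightarrow> s dvd r"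
    "\<And>e. frob_orbit (s * e) b = repeat_mset e (frob_orbit s b)" "count (frob_orbit s b) b = 1"
    "\<And>y. count (frob_orbit s b) y \<le> 1"
    by (rule frob_orbit_period[OF ex_period[OF D b]]) blast
  have sub: "frob_orbit (s * e) b \<subseteq># D \<longleftrightarrow> e \<le> count D b" for e
  proof
    assume "frob_orbit (s * e) b \<subseteq># D"
    thus "e \<le> count D b" using mset_subset_eq_count[of "frob_orbit (s * e) b" D b] s by simp
  next
    assume e: "e \<le> count D b"
    show "frob_orbit (s * e) b \<subseteq># D"
    proof (rule mset_subset_eqI)
      fix y
      show "count (frob_orbit (s * e) b) y \<le> count D y"
      proof (cases "y \<in># frob_orbit s b")
        case True
        then obtain i where "y = b ^ (CARD('a) ^ i)" by (auto simp: frob_orbit_def)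
        hence "count D y = count D b" using count_invariant[OF D] by simp
        moreover have "count (frob_orbit s b) y = 1" using s(5)[of y] True by (metis One_nat_def Suc_le_eq count_greater_zero_iff le_antisym)
        ultimately show ?thesis using e s(3) by simp
      next
        case False
        thus ?thesis using s(3) by (simp add: not_in_iff)
      qed
    qed
  qed
  have "{r \<in> {1..size D}. b ^ (CARD('a) ^ r) = b \<and> frob_orbit r b \<subseteq># D} = (\<lambda>e. s * e) ` {1..count D b}"
  proof (intro equalityI subsetI)
    fix r assume "r \<in> {r \<in> {1..size D}. b ^ (CARD('a) ^ r) = b \<and> frob_orbit r b \<subseteq># D}"
    hence r: "r \<ge> 1" "s dvd r" "frob_orbit r b \<subseteq># D" using s(2) by auto
    from r(2) obtain e where e: "r = s * e" by (rule dvdE)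
    moreover have "e \<noteq> 0" using r(1) unfolding e by (rule contrapos_pn) simp
    hence "1 \<le> e" by simp
    moreover have "e \<le> count D b" using r(3) unfolding e sub .
    ultimately show "r \<in> (\<lambda>e. s * e) ` {1..count D b}" by (intro image_eqI[of _ _ e]) auto
  next
    fix r assume "r \<in> (\<lambda>e. s * e) ` {1..count D b}"
    then obtain e where "r = s * e" "e \<in> {1..count D b}" by (rule imageE)
    hence e: "r = s * e" "1 \<le> e" "e \<le> count D b" by simp_all
    hence "frob_orbit r b \<subseteq># D" using sub by simp
    moreover from size_mset_mono[OF this] have "r \<le> size D" by simp
    ultimately show "r \<in> {r \<in> {1..size D}. b ^ (CARD('a) ^ r) = b \<and> frob_orbit r b \<subseteq># D}"
      using e s by simp
  qed
  also have "card \<dots> = count D b" using s(1) by (subst card_image) (auto simp: inj_on_def)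
  finally show ?thesis .
qed

lemma finite_unit_points:
  assumes "r > 0" shows "finite (unit_points r :: 'a :: {field, finite} alg_closure set)"
proof -
  have "2 \<le> CARD('a) ^ 1" using card_ge_2 by simp
  also have "\<dots> \<le> CARD('a) ^ r" using assms card_ge_2[where ?'a='a] by (intro power_increasing) auto
  finally show ?thesis using finite_power_eq_self(1) by (rule_tac finite_subset[of _ "{b. b ^ (CARD('a) ^ r) = b}"]) (auto simp: unit_points_def)
qed

lemma divisors_containing_orbit:
  fixes b :: "'a :: {field, finite} alg_closure"
  assumes b: "b \<in> unit_points r" and r: "r \<le> N"
  shows "bij_betw (\<lambda>E. frob_orbit r b + E) (divisors_of_size (N - r)) {D \<in> divisors_of_size N. frob_orbit r b \<subseteq># D}"
proof (rule bij_betw_byWitness[where f' = "\<lambda>D. D - frob_orbit r b"])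
  note o = frob_orbit_invariant[OF b]
  show "(+) (frob_orbit r b) ` divisors_of_size (N - r) \<subseteq> {D \<in> divisors_of_size N. frob_orbit r b \<subseteq># D}"
    using o r by (auto simp: divisors_of_size_def invariant_divisors_def)
  show "(\<lambda>D. D - frob_orbit r b) ` {D \<in> divisors_of_size N. frob_orbit r b \<subseteq># D} \<subseteq> divisors_of_size (N - r)"
    using o r by (auto simp: divisors_of_size_def invariant_divisors_def image_mset_Diff size_Diff_submset dest: in_diffD)
qed auto

text \<open>
  This is the recurrence \<open>X * L' = L * (\<Sum>r. S\<^sub>r * X\<^bsup>r\<^esup>)\<close> between the L-series
  \<open>L = \<Sum>D. \<Psi> D * X\<^bsup>size D\<^esup>\<close> of a multiplicative function and its sums \<open>S\<^sub>r\<close> over the points of the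
  extension of degree \<open>r\<close>. It needs no Euler product: on the right, \<open>\<Psi> D\<close> occurs once
  for each pair \<open>(r, b)\<close> whose orbit fits into \<open>D\<close>, and there are \<open>size D\<close> such pairs.
\<close>

lemma log_derivative:
  fixes \<Psi> :: "'a :: {field, finite} alg_closure multiset \<Rightarrow> 'k :: comm_ring_1"
  assumes mult: "\<And>D E. D \<in> invariant_divisors \<Longrightarrow> E \<in> invariant_divisors \<Longrightarrow> \<Psi> (D + E) = \<Psi> D * \<Psi> E"
    and fin: "finite (divisors_of_size N :: 'a alg_closure multiset set)"
  shows "of_nat N * (\<Sum>D\<in>divisors_of_size N. \<Psi> D) =
    (\<Sum>r=1..N. (\<Sum>b\<in>unit_points r. \<Psi> (frob_orbit r b)) * (\<Sum>D\<in>divisors_of_size (N - r). \<Psi> D))"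
proof -
  let ?Div = "divisors_of_size :: nat \<Rightarrow> 'a alg_closure multiset set"
  have "(\<Sum>r=1..N. (\<Sum>b\<in>unit_points r. \<Psi> (frob_orbit r b)) * (\<Sum>D\<in>?Div (N - r). \<Psi> D))
      = (\<Sum>r=1..N. \<Sum>b\<in>unit_points r. \<Sum>E\<in>?Div (N - r). \<Psi> (frob_orbit r b + E))"
    by (simp add: sum_product mult frob_orbit_invariant divisors_of_size_def)
  also have "\<dots> = (\<Sum>r=1..N. \<Sum>b\<in>unit_points r. \<Sum>D\<in>{D \<in> ?Div N. frob_orbit r b \<subseteq># D}. \<Psi> D)"
    by (intro sum.cong refl sum.reindex_bij_betw divisors_containing_orbit) auto
  also have "\<dots> = (\<Sum>r=1..N. \<Sum>b\<in>unit_points r. \<Sum>D\<in>?Div N. if frob_orbit r b \<subseteq># D then \<Psi> D else 0)"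
    by (simp add: sum.inter_filter fin)
  also have "\<dots> = (\<Sum>r=1..N. \<Sum>D\<in>?Div N. \<Sum>b\<in>unit_points r. if frob_orbit r b \<subseteq># D then \<Psi> D else 0)"
    by (intro sum.cong refl sum.swap)
  also have "\<dots> = (\<Sum>D\<in>?Div N. \<Sum>r=1..N. \<Sum>b\<in>unit_points r. if frob_orbit r b \<subseteq># D then \<Psi> D else 0)"
    by (rule sum.swap)
  also have "\<dots> = (\<Sum>D\<in>?Div N. of_nat N * \<Psi> D)"
  proof (rule sum.cong[OF refl])
    fix D assume D: "D \<in> ?Div N"
    hence D': "D \<in> invariant_divisors" "size D = N" by (auto simp: divisors_of_size_def)
    have "(\<Sum>r=1..N. \<Sum>b\<in>unit_points r. if frob_orbit r b \<subseteq># D then \<Psi> D else 0) =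
          (\<Sum>r=1..N. \<Sum>b\<in>set_mset D. if b ^ (CARD('a) ^ r) = b \<and> frob_orbit r b \<subseteq># D then \<Psi> D else 0)"
    proof (rule sum.cong[OF refl])
      fix r assume r: "r \<in> {1..N}"
      have bD: "b \<in># D" if "frob_orbit r b \<subseteq># D" for b
      proof -
        have "b \<in># frob_orbit r b" using r by (auto simp: frob_orbit_def intro!: image_eqI[of _ _ 0])
        thus ?thesis using that by (rule mset_subset_eqD[rotated])
      qed
      have "(\<Sum>b\<in>unit_points r. if frob_orbit r b \<subseteq># D then \<Psi> D else 0) = (\<Sum>b\<in>{b \<in> unit_points r. frob_orbit r b \<subseteq># D}. \<Psi> D)"
        using r by (subst sum.inter_filter) (auto simp: finite_unit_points)
      also have "{b \<in> unit_points r. frob_orbit r b \<subseteq># D} = {b \<in> set_mset D. b ^ (CARD('a) ^ r) = b \<and> frob_orbit r b \<subseteq># D}"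
        using D' bD by (auto simp: unit_points_def invariant_divisors_def)
      also have "(\<Sum>b\<in>\<dots>. \<Psi> D) = (\<Sum>b\<in>set_mset D. if b ^ (CARD('a) ^ r) = b \<and> frob_orbit r b \<subseteq># D then \<Psi> D else 0)"
        by (subst sum.inter_filter) auto
      finally show "(\<Sum>b\<in>unit_points r. if frob_orbit r b \<subseteq># D then \<Psi> D else 0) = \<dots>" .
    qed
    also have "\<dots> = (\<Sum>b\<in>set_mset D. \<Sum>r=1..N. if b ^ (CARD('a) ^ r) = b \<and> frob_orbit r b \<subseteq># D then \<Psi> D else 0)"
      by (rule sum.swap)
    also have "\<dots> = (\<Sum>b\<in>set_mset D. of_nat (count D b) * \<Psi> D)"
      using card_orbits_in_divisor[OF D'(1)] D'(2) by (intro sum.cong refl, subst sum.inter_filter [symmetric]) auto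
    also have "\<dots> = of_nat (size D) * \<Psi> D"
      by (simp add: size_multiset_overloaded_eq sum_distrib_right)
    finally show "(\<Sum>r=1..N. \<Sum>b\<in>unit_points r. if frob_orbit r b \<subseteq># D then \<Psi> D else 0) = of_nat N * \<Psi> D"
      using D' by simp
  qed
  finally show ?thesis by (simp add: sum_distrib_left)
qed

definition monic_polys :: "nat \<Rightarrow> 'a :: field poly set" where
  "monic_polys N = {p. degree p = N \<and> lead_coeff p = 1 \<and> coeff p 0 \<noteq> 0}"

definition root_divisor :: "'a :: field poly \<Rightarrow> 'a alg_closure multiset" where
  "root_divisor p = proots (map_poly to_ac p)"

lemma finite_monic_polys: "finite (monic_polys N :: 'a :: {field, finite} poly set)"
proof -
  have "p \<in> Poly ` {xs. set xs \<subseteq> UNIV \<and> length xs = Suc N}" if "p \<in> monic_polys N" for p :: "'a poly"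
  proof -
    have "p \<noteq> 0" using that by (auto simp: monic_polys_def)
    hence "length (coeffs p) = Suc N" using that by (simp add: monic_polys_def length_coeffs_degree)
    moreover have "p = Poly (coeffs p)" by simp
    ultimately show ?thesis by blast
  qed
  hence "monic_polys N \<subseteq> Poly ` {xs :: 'a list. set xs \<subseteq> UNIV \<and> length xs = Suc N}" by blast
  thus ?thesis by (rule finite_subset) (intro finite_imageI finite_lists_length_eq, simp)
qed

lemma coeff_root_poly_frobenius:
  fixes D :: "'a :: {field, finite} alg_closure multiset"
  shows "coeff (root_poly (image_mset (\<lambda>x. x ^ CARD('a)) D)) i = coeff (root_poly D) i ^ CARD('a)"
proof (induction D arbitrary: i)
  case empty
  show ?case using card_ge_2[where ?'a='a] by (auto simp: coeff_1)
next
  case (add x D)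
  show ?case using add card_ge_2[where ?'a='a]
    by (cases i) (simp_all add: power_mult_distrib frobenius_minus frobenius_add frobenius_diff)
qed

lemma root_divisor_root_poly:
  assumes "p \<in> monic_polys N"
  shows "root_poly (root_divisor p) = map_poly to_ac p" "size (root_divisor p) = N"
proof -
  have d: "degree (map_poly to_ac p) = N" "lead_coeff (map_poly to_ac p) = 1"
    using assms by (auto simp: monic_polys_def coeff_map_poly degree_map_poly)
  hence "map_poly to_ac p \<noteq> 0" by auto
  from alg_closed_imp_factorization[OF this] d obtain A where "size A = N" "map_poly to_ac p = root_poly A"
    by (auto simp: root_poly_def)
  thus "root_poly (root_divisor p) = map_poly to_ac p" "size (root_divisor p) = N" by (auto simp: root_divisor_def)
qed

text \<open>
  Divisors of size \<open>N\<close> correspond to monic polynomials of degree \<open>N\<close> over the finite field with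
  nonzero constant coefficient: a product of linear factors has coefficients in the finite field
  if and only if its multiset of roots is invariant.
\<close>

lemma bij_root_divisor:
  "bij_betw root_divisor (monic_polys N) (divisors_of_size N :: 'a :: {field, finite} alg_closure multiset set)"
proof (rule bij_betw_byWitness[where f' = "\<lambda>D. map_poly of_ac (root_poly D)"])
  show "\<forall>p\<in>monic_polys N. map_poly of_ac (root_poly (root_divisor p)) = (p :: 'a poly)"
    by (auto simp: root_divisor_root_poly poly_eq_iff coeff_map_poly)
  have *: "coeff (root_poly D) i \<in> range to_ac" if "D \<in> divisors_of_size N" for D :: "'a alg_closure multiset" and i
    using coeff_root_poly_frobenius[of D i] that frobenius_fixed_iff[of "coeff (root_poly D) i"]
    by (auto simp: divisors_of_size_def invariant_divisors_def)
  have m: "map_poly to_ac (map_poly of_ac (root_poly D)) = root_poly D" if "D \<in> divisors_of_size N" for D :: "'a alg_closure multiset"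
    using *[OF that] by (simp add: poly_eq_iff coeff_map_poly to_ac_of_ac)
  thus "\<forall>D\<in>divisors_of_size N. root_divisor (map_poly of_ac (root_poly D)) = (D :: 'a alg_closure multiset)"
    by (simp add: root_divisor_def)
  show "root_divisor ` monic_polys N \<subseteq> (divisors_of_size N :: 'a alg_closure multiset set)"
  proof (rule image_subsetI)
    fix p :: "'a poly" assume p: "p \<in> monic_polys N"
    let ?D = "root_divisor p"
    note r = root_divisor_root_poly[OF p]
    have "root_poly (image_mset (\<lambda>x. x ^ CARD('a)) ?D) = root_poly ?D"
      by (simp add: poly_eq_iff coeff_root_poly_frobenius r coeff_map_poly power_card flip: to_ac_power)
    hence "image_mset (\<lambda>x. x ^ CARD('a)) ?D = ?D" by (metis proots_root_poly)
    moreover have "coeff (root_poly ?D) 0 \<noteq> 0" using p by (simp add: r coeff_map_poly monic_polys_def)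
    hence "0 \<notin># ?D" by (simp add: coeff_0_root_poly prod_mset_zero_iff)
    ultimately show "?D \<in> divisors_of_size N" using r by (simp add: divisors_of_size_def invariant_divisors_def)
  qed
  show "(\<lambda>D. map_poly of_ac (root_poly D)) ` (divisors_of_size N :: 'a alg_closure multiset set) \<subseteq> monic_polys N"
  proof (rule image_subsetI)
    fix D :: "'a alg_closure multiset" assume D: "D \<in> divisors_of_size N"
    define p where "p = map_poly of_ac (root_poly D)"
    have e: "map_poly to_ac p = root_poly D" using m[OF D] by (simp add: p_def)
    have d: "degree p = N" using D degree_root_poly[of D] degree_map_poly[of to_ac p] unfolding e
      by (simp add: divisors_of_size_def e)
    moreover have "to_ac (coeff p N) = to_ac 1"
      using monic_root_poly[of D] D unfolding e [symmetric] by (simp add: coeff_map_poly divisors_of_size_def degree_map_poly d)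
    moreover have "to_ac (coeff p 0) = (-1) ^ size D * prod_mset D"
      using coeff_0_root_poly[of D] unfolding e [symmetric] by (simp add: coeff_map_poly)
    hence "to_ac (coeff p 0) \<noteq> 0" using D by (auto simp: prod_mset_zero_iff divisors_of_size_def invariant_divisors_def)
    ultimately show "p \<in> monic_polys N" by (simp add: monic_polys_def del: to_ac_1)
  qed
qed

lemma finite_divisors: "finite (divisors_of_size N :: 'a :: {field, finite} alg_closure multiset set)"
  using bij_betw_finite[OF bij_root_divisor[of N, where ?'a='a]] finite_monic_polys by blast

section \<open>The product formula of Davenport and Hasse\<close>

lemma additive_char:
  assumes "nontrivial_additive_char \<psi>"
  shows "\<psi> x \<noteq> 0" "\<psi> (x + y) = \<psi> x * \<psi> y" "\<psi> 0 = 1" "\<exists>x. \<psi> x \<noteq> 1"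
proof -
  have 1: "\<psi> x \<noteq> 0" for x using assms by (simp add: nontrivial_additive_char_def)
  have 2: "\<psi> (x + y) = \<psi> x * \<psi> y" for x y using assms by (simp add: nontrivial_additive_char_def)
  show "\<psi> x \<noteq> 0" "\<psi> (x + y) = \<psi> x * \<psi> y" by (fact 1, fact 2)
  show "\<exists>x. \<psi> x \<noteq> 1" using assms by (simp add: nontrivial_additive_char_def)
  from 2[of 0 0] 1[of 0] show "\<psi> 0 = 1" by simp
qed

lemma additive_char_sum:
  assumes "nontrivial_additive_char \<psi>"
  shows "(\<Sum>x\<in>UNIV. \<psi> x) = 0"
proof -
  obtain y where y: "\<psi> y \<noteq> 1" using additive_char(4)[OF assms] by blast
  have "(\<Sum>x\<in>UNIV. \<psi> x) = (\<Sum>x\<in>UNIV. \<psi> (y + x))"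
    by (rule sum.reindex_bij_witness[of _ "\<lambda>x. y + x" "\<lambda>x. x - y"]) auto
  also have "\<dots> = \<psi> y * (\<Sum>x\<in>UNIV. \<psi> x)" by (simp add: additive_char[OF assms] sum_distrib_left)
  finally show ?thesis using y by (simp add: mult_cancel_right1)
qed

lemma gauss_triv [simp]:
  fixes \<psi> :: "'a :: {field, finite} \<Rightarrow> qbar"
  assumes "nontrivial_additive_char \<psi>"
  shows "gauss \<psi> triv_char = 1"
proof -
  have "UNIV - {0} = {x :: 'a. x \<noteq> 0}" by auto
  hence "(\<Sum>x\<in>UNIV. \<psi> x) = \<psi> 0 + (\<Sum>x\<in>{x. x \<noteq> 0}. \<psi> x)" using sum.remove[of UNIV 0 \<psi>] by simp
  hence "(\<Sum>x\<in>{x. x \<noteq> 0}. \<psi> x) = - 1" using additive_char_sum[OF assms] additive_char(3)[OF assms]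
    by (simp add: eq_neg_iff_add_eq_0 add.commute)
  moreover have "gauss \<psi> triv_char = - (\<Sum>x\<in>{x. x \<noteq> 0}. \<psi> x)"
    unfolding gauss_def by (intro arg_cong[where f = uminus] sum.cong) auto
  ultimately show ?thesis by simp
qed

text \<open>
  The multiplicative function on divisors whose value on a polynomial is \<open>\<chi>\<close> of the product and
  \<open>\<psi>\<close> of the sum of the roots. For \<open>frob_orbit\<close> this is \<open>\<chi>\<close> of the norm times \<open>\<psi>\<close> of the trace.
\<close>

definition div_char :: "('a :: {field, finite} \<Rightarrow> qbar) \<Rightarrow> ('a \<Rightarrow> qbar) \<Rightarrow> 'a alg_closure multiset \<Rightarrow> qbar" where
  "div_char \<psi> \<chi> D = \<chi> (of_ac (prod_mset D)) * \<psi> (of_ac (sum_mset D))"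

lemma invariant_in_range:
  fixes D :: "'a :: {field, finite} alg_closure multiset"
  assumes "D \<in> invariant_divisors"
  shows "prod_mset D \<in> range to_ac" "sum_mset D \<in> range to_ac"
proof -
  have i: "image_mset (\<lambda>x. x ^ CARD('a)) D = D" using assms by (simp add: invariant_divisors_def)
  have "prod_mset (image_mset (\<lambda>x. x ^ CARD('a)) E) = prod_mset E ^ CARD('a)" for E :: "'a alg_closure multiset"
    by (induction E) (simp_all add: power_mult_distrib)
  thus "prod_mset D \<in> range to_ac" using i by (metis frobenius_fixed_iff)
  show "sum_mset D \<in> range to_ac" using i frobenius_sum_mset[of D] by (metis frobenius_fixed_iff)
qed

lemma invariant_prod_nonzero:
  assumes "D \<in> invariant_divisors"
  shows "of_ac (prod_mset D) \<noteq> 0"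
proof
  assume "of_ac (prod_mset D) = 0"
  hence "prod_mset D = 0" using invariant_in_range(1)[OF assms] to_ac_of_ac by fastforce
  thus False using assms by (simp add: invariant_divisors_def)
qed

lemma power_invariant:
  fixes D :: "'a :: {field, finite} alg_closure multiset"
  assumes "D \<in> invariant_divisors" shows "image_mset (\<lambda>x. x ^ n) D \<in> invariant_divisors"
proof -
  have "image_mset (\<lambda>x. x ^ CARD('a)) (image_mset (\<lambda>x. x ^ n) D) = image_mset (\<lambda>x. x ^ n) (image_mset (\<lambda>x. x ^ CARD('a)) D)"
    by (simp add: multiset.map_comp comp_def mult.commute flip: power_mult)
  thus ?thesis using assms by (auto simp: invariant_divisors_def)
qed

lemma div_char_mult:
  assumes "nontrivial_additive_char \<psi>" "\<chi> \<in> mchars" "D \<in> invariant_divisors" "E \<in> invariant_divisors"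
  shows "div_char \<psi> \<chi> (D + E) = div_char \<psi> \<chi> D * div_char \<psi> \<chi> E"
  using assms by (simp add: div_char_def of_ac_mult of_ac_add invariant_in_range additive_char mcharsD)

lemma prod_mset_power: "prod_mset (image_mset (\<lambda>x. x ^ n) D) = prod_mset D ^ n" for D :: "'k :: comm_monoid_mult multiset"
  by (induction D) (simp_all add: power_mult_distrib)

lemma power_frob_orbit: "image_mset (\<lambda>x. x ^ n) (frob_orbit r b) = frob_orbit r (b ^ n)"
  by (simp add: frob_orbit_def multiset.map_comp comp_def mult.commute flip: power_mult mset_map)

text \<open>
  The norm of \<open>b\<close> is \<open>b\<close> to the power \<open>(q\<^bsup>r\<^esup> - 1) / (q - 1)\<close>.
\<close>

lemma prod_frob_orbit:
  fixes b :: "'a :: {field, finite} alg_closure"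
  shows "prod_mset (frob_orbit r b) ^ (CARD('a) - 1) * b = b ^ (CARD('a) ^ r)"
proof (induction r)
  case (Suc r)
  have "(b ^ CARD('a) ^ r) ^ CARD('a) = (b ^ CARD('a) ^ r) ^ (CARD('a) - 1) * b ^ (CARD('a) ^ r)"
    by (rule power_card_split)
  hence "b ^ (CARD('a) ^ Suc r) = (b ^ CARD('a) ^ r) ^ (CARD('a) - 1) * b ^ (CARD('a) ^ r)"
    by (simp only: power_mult power_Suc2)
  moreover have "prod_mset (frob_orbit (Suc r) b) = prod_mset (frob_orbit r b) * b ^ (CARD('a) ^ r)"
    by (simp add: frob_orbit_def mult.commute)
  ultimately show ?case using Suc by (simp add: power_mult_distrib mult_ac)
qed (simp add: frob_orbit_def)

lemma card_roots_of_unity: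
  assumes "n dvd CARD('a :: {field, finite}) - 1"
  shows "card {x :: 'a. x ^ n = 1} = n"
proof -
  obtain g :: 'a where g: "g \<noteq> 0" "\<And>x. x \<noteq> 0 \<Longrightarrow> \<exists>k. x = g ^ k" by (rule ex_generator) blast
  note ord = generator_power_eq_1_iff[OF g]
  obtain m where m: "CARD('a) - 1 = n * m" using assms by (rule dvdE)
  have pos: "n > 0" "m > 0" using m card_ge_2[where ?'a='a] by (auto intro!: Nat.gr0I)
  have "{x :: 'a. x ^ n = 1} = (\<lambda>j. g ^ (m * j)) ` {..<n}"
  proof (intro equalityI subsetI)
    fix x :: 'a assume "x \<in> {x. x ^ n = 1}"
    hence x: "x ^ n = 1" by simp
    hence "x \<noteq> 0" using pos by (auto simp: power_0_left)
    then obtain k where k: "x = g ^ k" using g by blast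
    hence "n * m dvd k * n" using x ord by (simp flip: power_mult m del: One_nat_def)
    hence "m dvd k" using pos by (simp add: mult.commute)
    then obtain j where j: "k = m * j" by (rule dvdE)
    have "g ^ (m * j) = g ^ (m * (n * (j div n) + j mod n))" by simp
    also have "\<dots> = (g ^ (n * m)) ^ (j div n) * g ^ (m * (j mod n))"
      by (simp only: distrib_left power_add power_mult [symmetric] mult_ac)
    also have "g ^ (n * m) = 1" using power_card_minus_1[OF g(1)] by (simp only: m)
    finally show "x \<in> (\<lambda>j. g ^ (m * j)) ` {..<n}" using k j pos by auto
  next
    fix x assume "x \<in> (\<lambda>j. g ^ (m * j)) ` {..<n}"
    then obtain j where "x = g ^ (m * j)" by auto
    hence "x ^ n = (g ^ (n * m)) ^ j" by (simp add: mult_ac flip: power_mult)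
    thus "x \<in> {x. x ^ n = 1}" using ord[of "n * m"] by (simp add: m del: One_nat_def)
  qed
  moreover have "inj_on (\<lambda>j. g ^ (m * j)) {..<n}"
  proof (rule linorder_inj_onI)
    fix i j assume ij: "i < j" "i \<in> {..<n}" "j \<in> {..<n}"
    show "g ^ (m * i) \<noteq> g ^ (m * j)"
    proof
      assume "g ^ (m * i) = g ^ (m * j)"
      moreover have "m * j = m * i + m * (j - i)" using ij by (simp flip: distrib_left)
      ultimately have "g ^ (m * i) * g ^ (m * (j - i)) = g ^ (m * i)" by (metis power_add)
      hence "g ^ (m * (j - i)) = 1" using g by simp
      hence "n dvd j - i" using pos by (simp add: ord m mult.commute del: One_nat_def)
      thus False using ij by (auto dest: dvd_imp_le)
    qed
  qed auto
  ultimately show ?thesis by (simp add: card_image)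
qed

lemma root_of_unity_in_range:
  fixes z :: "'a :: {field, finite} alg_closure"
  assumes n: "n dvd CARD('a) - 1" and z: "z ^ n = 1"
  obtains \<zeta> where "z = to_ac \<zeta>" "\<zeta> ^ n = 1"
proof -
  obtain m where m: "CARD('a) - 1 = n * m" using n by (rule dvdE)
  have "z ^ (CARD('a) - 1) = 1" unfolding m by (simp add: power_mult z)
  hence "z ^ CARD('a) = z" by (simp only: power_card_split[where ?'a='a] mult_1)
  then obtain \<zeta> where \<zeta>: "z = to_ac \<zeta>" using frobenius_fixed_iff by blast
  have "to_ac (\<zeta> ^ n) = 1" using z \<zeta> by simp
  hence "\<zeta> ^ n = 1" by (simp only: to_ac_eq_1_iff)
  thus ?thesis using \<zeta> that by blast
qed

lemma card_nth_roots_closure: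
  fixes c :: "'a :: {field, finite} alg_closure"
  assumes n: "n dvd CARD('a) - 1" and c: "c \<noteq> 0"
  shows "card {y. y ^ n = c} = n"
proof -
  have n0: "n > 0" using n by (rule dvd_card_pos)
  obtain y0 where y0: "y0 ^ n = c" using nth_root_exists[OF n0] by blast
  have y00: "y0 \<noteq> 0" using y0 c n0 by (auto simp: power_0_left)
  have "{y. y ^ n = c} = (\<lambda>\<zeta>. y0 * to_ac \<zeta>) ` {\<zeta>. \<zeta> ^ n = 1}"
  proof (intro equalityI subsetI)
    fix y assume "y \<in> {y. y ^ n = c}"
    hence "(y / y0) ^ n = 1" using c by (simp add: power_divide y0)
    then obtain \<zeta> where z: "y / y0 = to_ac \<zeta>" "\<zeta> ^ n = 1" by (rule root_of_unity_in_range[OF n])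
    have "y = y0 * to_ac \<zeta>" using y00 by (simp flip: z(1))
    thus "y \<in> (\<lambda>\<zeta>. y0 * to_ac \<zeta>) ` {\<zeta>. \<zeta> ^ n = 1}" using z(2) by blast
  next
    fix y assume "y \<in> (\<lambda>\<zeta>. y0 * to_ac \<zeta>) ` {\<zeta>. \<zeta> ^ n = 1}"
    then obtain \<zeta> where z: "y = y0 * to_ac \<zeta>" "\<zeta> ^ n = 1" by blast
    have "y ^ n = c * to_ac (\<zeta> ^ n)" by (simp add: z(1) power_mult_distrib y0)
    thus "y \<in> {y. y ^ n = c}" by (simp only: z(2) to_ac_1 mult_1_right mem_Collect_eq)
  qed
  moreover have "inj_on (\<lambda>\<zeta>. y0 * to_ac \<zeta>) {\<zeta>. \<zeta> ^ n = 1}" using y00 by (auto simp: inj_on_def)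
  ultimately show ?thesis using card_roots_of_unity[OF n] by (simp add: card_image)
qed

lemma root_char_mchars [simp]: "\<phi> \<in> mchars \<Longrightarrow> root_char \<phi> n \<in> mchars"
  by (simp add: root_char_def)

lemma root_char_power:
  assumes "\<phi> \<in> mchars" "(x :: 'a :: {field, finite}) \<noteq> 0"
  shows "root_char \<phi> n x = \<phi> (x ^ ((CARD('a) - 1) div n))"
  using assms by (simp add: root_char_def char_pow_def mchars_power)

lemma root_char_order:
  assumes "\<phi> \<in> mchars" "n dvd CARD('a :: {field, finite}) - 1" "(x :: 'a) \<noteq> 0"
  shows "root_char \<phi> n x ^ n = 1"
proof -
  have "root_char \<phi> n x ^ n = \<phi> x ^ ((CARD('a) - 1) div n * n)"
    using assms(3) by (simp add: root_char_def char_pow_def power_mult)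
  thus ?thesis using assms by (simp add: mchars_power_card del: One_nat_def)
qed

text \<open>
  Since \<open>n\<close> divides \<open>q - 1\<close>, either all \<open>n\<close>th roots of \<open>a\<close> lie in the extension of degree \<open>r\<close> or
  none does, and the first case is detected by the \<open>n\<close>th power residue character of the norm of \<open>a\<close>.
  The sum over \<open>k\<close> is \<open>n\<close> or \<open>0\<close> accordingly.
\<close>

lemma card_nth_roots:
  fixes \<phi> :: "'a :: {field, finite} \<Rightarrow> qbar" and a :: "'a alg_closure"
  assumes gen: "generates_mchars \<phi>" and n: "n dvd CARD('a) - 1" and r: "r > 0" and a: "a \<in> unit_points r"
  shows "of_nat (card {b \<in> unit_points r. b ^ n = a}) =
     (\<Sum>k<n. char_pow (root_char \<phi> n) k (of_ac (prod_mset (frob_orbit r a))))"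
proof -
  note ph = generates_mcharsD[OF gen]
  define y where "y = of_ac (prod_mset (frob_orbit r a))"
  have y0: "y \<noteq> 0" using invariant_prod_nonzero[OF frob_orbit_invariant[OF a]] by (simp add: y_def)
  have ty: "to_ac y = prod_mset (frob_orbit r a)"
    using invariant_in_range(1)[OF frob_orbit_invariant[OF a]] by (simp add: y_def to_ac_of_ac)
  obtain m where m: "CARD('a) - 1 = n * m" using n by (rule dvdE)
  have pos: "n > 0" "m > 0" using m card_ge_2[where ?'a='a] by (auto intro!: Nat.gr0I)
  define z where "z = root_char \<phi> n y"
  have zn: "z ^ n = 1" unfolding z_def by (rule root_char_order[OF ph n y0])
  have "z = \<phi> (y ^ m)" using root_char_power[OF ph y0, of n] pos by (simp add: z_def m del: One_nat_def)
  hence z1: "z = 1 \<longleftrightarrow> y ^ m = 1" using generator_eq_1_iff[OF gen] by simp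
  have mem: "b \<in> unit_points r \<longleftrightarrow> z = 1" if b: "b ^ n = a" for b
  proof -
    have b0: "b \<noteq> 0" using b a pos by (auto simp: unit_points_def power_0_left)
    have "to_ac y = prod_mset (frob_orbit r b) ^ n"
      unfolding ty b [symmetric] power_frob_orbit [symmetric] prod_mset_power ..
    hence "to_ac (y ^ m) * b = prod_mset (frob_orbit r b) ^ (CARD('a) - 1) * b"
      by (simp only: m power_mult to_ac_power)
    also have "\<dots> = b ^ (CARD('a) ^ r)" by (rule prod_frob_orbit)
    finally have "b ^ (CARD('a) ^ r) = b \<longleftrightarrow> to_ac (y ^ m) = 1"
      using b0 by (metis mult_cancel_right1)
    thus ?thesis using b0 z1 by (simp only: unit_points_def to_ac_eq_1_iff mem_Collect_eq simp_thms)
  qed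
  have "(\<Sum>k<n. char_pow (root_char \<phi> n) k y) = (\<Sum>k<n. z ^ k)" using y0 by (simp add: char_pow_def z_def)
  also have "\<dots> = of_nat (card {b \<in> unit_points r. b ^ n = a})"
  proof (cases "z = 1")
    case False
    hence e: "{b \<in> unit_points r. b ^ n = a} = {}" using mem by blast
    have "(\<Sum>k<n. z ^ k) = 0" using zn False power_diff_1_eq[of z n] by simp
    thus ?thesis unfolding e by simp
  next
    case True
    hence e: "{b \<in> unit_points r. b ^ n = a} = {b. b ^ n = a}" using mem by blast
    have "a \<noteq> 0" using a by (simp add: unit_points_def)
    thus ?thesis unfolding e card_nth_roots_closure[OF n \<open>a \<noteq> 0\<close>] using True by simp
  qed
  finally show ?thesis by (simp add: y_def)
qed

text \<open>
  The coefficient of \<open>X\<^bsup>N\<^esup>\<close> in the L-series of the character \<open>div_char \<psi> \<chi>\<close> pulled back along the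
  covering \<open>x \<mapsto> x\<^bsup>n\<^esup>\<close> of the multiplicative group.
\<close>

definition divisor_sum :: "('a :: {field, finite} \<Rightarrow> qbar) \<Rightarrow> nat \<Rightarrow> ('a \<Rightarrow> qbar) \<Rightarrow> nat \<Rightarrow> qbar" where
  "divisor_sum \<psi> n \<chi> N = (\<Sum>D\<in>divisors_of_size N. div_char \<psi> \<chi> (image_mset (\<lambda>x. x ^ n) D))"

definition point_sum :: "('a :: {field, finite} \<Rightarrow> qbar) \<Rightarrow> nat \<Rightarrow> ('a \<Rightarrow> qbar) \<Rightarrow> nat \<Rightarrow> qbar" where
  "point_sum \<psi> n \<chi> r = (\<Sum>b\<in>unit_points r. div_char \<psi> \<chi> (frob_orbit r (b ^ n)))"

lemma divisor_sum_recurrence: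
  assumes "nontrivial_additive_char \<psi>" "\<chi> \<in> mchars"
  shows "of_nat N * divisor_sum \<psi> n \<chi> N = (\<Sum>r=1..N. point_sum \<psi> n \<chi> r * divisor_sum \<psi> n \<chi> (N - r))"
proof -
  have "div_char \<psi> \<chi> (image_mset (\<lambda>x. x ^ n) (D + E)) =
        div_char \<psi> \<chi> (image_mset (\<lambda>x. x ^ n) D) * div_char \<psi> \<chi> (image_mset (\<lambda>x. x ^ n) E)"
    if "D \<in> invariant_divisors" "E \<in> invariant_divisors" for D E
    using that assms by (simp add: div_char_mult power_invariant)
  from log_derivative[of "\<lambda>D. div_char \<psi> \<chi> (image_mset (\<lambda>x. x ^ n) D)", OF this finite_divisors[of N]]
  show ?thesis by (simp add: divisor_sum_def point_sum_def power_frob_orbit)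
qed

text \<open>
  Grouping the points by their \<open>n\<close>th powers: pulling back along \<open>x \<mapsto> x\<^bsup>n\<^esup>\<close> amounts to
  summing over the twists by the characters of order dividing \<open>n\<close>.
\<close>

lemma point_sum_power:
  fixes \<phi> :: "'a :: {field, finite} \<Rightarrow> qbar"
  assumes gen: "generates_mchars \<phi>" and n: "n dvd CARD('a) - 1" and r: "r > 0"
  shows "point_sum \<psi> n \<chi> r = (\<Sum>k<n. point_sum \<psi> 1 (char_mult \<chi> (char_pow (root_char \<phi> n) k)) r)"
proof -
  have im: "(\<lambda>b. b ^ n) ` unit_points r \<subseteq> (unit_points r :: 'a alg_closure set)"
  proof
    fix a assume "a \<in> (\<lambda>b. b ^ n) ` (unit_points r :: 'a alg_closure set)"
    then obtain b where "a = b ^ n" "b \<noteq> 0" "b ^ (CARD('a) ^ r) = b" by (auto simp: unit_points_def)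
    moreover have "(b ^ n) ^ (CARD('a) ^ r) = (b ^ (CARD('a) ^ r)) ^ n"
      unfolding power_mult [symmetric] by (simp only: mult.commute)
    ultimately show "a \<in> unit_points r" by (simp add: unit_points_def)
  qed
  have "point_sum \<psi> n \<chi> r = (\<Sum>a\<in>unit_points r. \<Sum>b\<in>{b\<in>unit_points r. b ^ n = a}. div_char \<psi> \<chi> (frob_orbit r (b ^ n)))"
    unfolding point_sum_def by (rule sum.group [symmetric, OF finite_unit_points[OF r] finite_unit_points[OF r] im])
  also have "\<dots> = (\<Sum>a\<in>unit_points r. of_nat (card {b\<in>unit_points r. b ^ n = a}) * div_char \<psi> \<chi> (frob_orbit r a))"
    by (intro sum.cong refl) simp
  also have "\<dots> = (\<Sum>a\<in>unit_points r. \<Sum>k<n. div_char \<psi> (char_mult \<chi> (char_pow (root_char \<phi> n) k)) (frob_orbit r a))"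
    by (intro sum.cong refl) (simp add: card_nth_roots[OF gen n r] sum_distrib_left sum_distrib_right div_char_def char_mult_def mult_ac)
  also have "\<dots> = (\<Sum>k<n. point_sum \<psi> 1 (char_mult \<chi> (char_pow (root_char \<phi> n) k)) r)"
    by (simp add: point_sum_def sum.swap[of _ "unit_points r"])
  finally show ?thesis .
qed

lemma divisor_sum_eq_monic_polys:
  "divisor_sum \<psi> n \<chi> N = (\<Sum>p\<in>monic_polys N. div_char \<psi> \<chi> (image_mset (\<lambda>x. x ^ n) (root_divisor p)))"
  unfolding divisor_sum_def by (rule sum.reindex_bij_betw [symmetric, OF bij_root_divisor])

lemma divisor_sum_0:
  fixes \<psi> \<chi> :: "'a :: {field, finite} \<Rightarrow> qbar"
  assumes "nontrivial_additive_char \<psi>" "\<chi> \<in> mchars"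
  shows "divisor_sum \<psi> n \<chi> 0 = 1"
proof -
  have "divisors_of_size 0 = {{#} :: 'a alg_closure multiset}" by (auto simp: divisors_of_size_def invariant_divisors_def)
  thus ?thesis using assms by (simp add: divisor_sum_def div_char_def additive_char mcharsD)
qed

lemma divisor_sum_1:
  fixes \<psi> \<chi> :: "'a :: {field, finite} \<Rightarrow> qbar"
  assumes "nontrivial_additive_char \<psi>" "\<chi> \<in> mchars"
  shows "divisor_sum \<psi> 1 \<chi> 1 = - gauss \<psi> \<chi>"
proof -
  have e: "divisors_of_size 1 = (\<lambda>x :: 'a. {#to_ac x#}) ` {x. x \<noteq> 0}"
  proof (intro equalityI subsetI)
    fix D :: "'a alg_closure multiset" assume D: "D \<in> divisors_of_size 1"
    hence "size D = 1" by (simp add: divisors_of_size_def)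
    then obtain y where y: "D = {#y#}" using size_1_singleton_mset by blast
    hence "y \<noteq> 0" "y \<in> range to_ac" using D by (auto simp: divisors_of_size_def invariant_divisors_def frobenius_fixed_iff)
    thus "D \<in> (\<lambda>x :: 'a. {#to_ac x#}) ` {x. x \<noteq> 0}" using y by auto
  next
    fix D :: "'a alg_closure multiset" assume "D \<in> (\<lambda>x :: 'a. {#to_ac x#}) ` {x. x \<noteq> 0}"
    thus "D \<in> divisors_of_size 1" by (auto simp: divisors_of_size_def invariant_divisors_def power_card simp flip: to_ac_power)
  qed
  have "divisor_sum \<psi> 1 \<chi> 1 = (\<Sum>x\<in>{x :: 'a. x \<noteq> 0}. div_char \<psi> \<chi> {#to_ac x#})"
    unfolding divisor_sum_def e by (subst sum.reindex) (auto simp: inj_on_def)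
  thus ?thesis by (simp add: gauss_def div_char_def)
qed

lemma root_divisor_prod:
  assumes "p \<in> monic_polys N"
  shows "prod_mset (root_divisor p) = to_ac ((- 1) ^ N * coeff p 0)"
proof -
  have "to_ac (coeff p 0) = (- 1) ^ N * prod_mset (root_divisor p)"
    using coeff_0_root_poly[of "root_divisor p"] by (simp add: root_divisor_root_poly[OF assms] coeff_map_poly)
  thus ?thesis by (simp add: mult.assoc [symmetric] power_mult_distrib [symmetric] flip: power_add)
qed

lemma root_divisor_sum:
  assumes "p \<in> monic_polys N" "N > 0"
  shows "sum_mset (root_divisor p) = to_ac (- coeff p (N - 1))"
proof -
  note r = root_divisor_root_poly[OF assms(1)]
  have "root_fps (root_divisor p) $ 1 = - (power_sum 1 (root_divisor p) * root_fps (root_divisor p) $ 0)"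
    using newton[of 1 "root_divisor p"] by simp
  moreover have "root_fps (root_divisor p) $ 1 = to_ac (coeff p (N - 1))" "root_fps (root_divisor p) $ 0 = 1"
    using assms r by (auto simp: root_fps_nth coeff_map_poly monic_polys_def)
  ultimately have "- sum_mset (root_divisor p) = to_ac (coeff p (N - 1))" by (simp add: power_sum_def)
  thus ?thesis by (metis minus_minus to_ac_minus)
qed

text \<open>
  The constant and the subleading coefficient of a monic polynomial of degree at least \<open>2\<close> vary
  independently, and \<open>\<psi>\<close> sums to zero over the latter; the proof shifts the subleading coefficient.
\<close>

lemma divisor_sum_ge_2:
  fixes \<psi> \<chi> :: "'a :: {field, finite} \<Rightarrow> qbar"
  assumes ps: "nontrivial_additive_char \<psi>" and "\<chi> \<in> mchars" "N \<ge> 2"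
  shows "divisor_sum \<psi> 1 \<chi> N = 0"
proof -
  obtain t' where "\<psi> t' \<noteq> 1" using additive_char(4)[OF ps] by blast
  define t where "t = - t'"
  define f where "f p = \<chi> ((- 1) ^ N * coeff p 0) * \<psi> (- coeff p (N - 1))" for p
  have S: "divisor_sum \<psi> 1 \<chi> N = (\<Sum>p\<in>monic_polys N. f p)"
    unfolding divisor_sum_eq_monic_polys using assms
    by (intro sum.cong refl)
       (simp add: div_char_def f_def root_divisor_prod root_divisor_sum del: to_ac_mult to_ac_minus One_nat_def)
  have mon: "p + monom c (N - 1) \<in> monic_polys N" if "p \<in> monic_polys N" for p :: "'a poly" and c
  proof -
    have "degree (monom c (N - 1)) < degree p" using that assms(3) degree_monom_le[of c "N - 1"]
      by (auto simp: monic_polys_def)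
    moreover from this have "degree (p + monom c (N - 1)) = degree p" by (rule degree_add_eq_left)
    ultimately show ?thesis using that assms(3) by (auto simp: monic_polys_def)
  qed
  have "(\<Sum>p\<in>monic_polys N. f p) = (\<Sum>p\<in>monic_polys N. f (p + monom t (N - 1)))"
    by (rule sum.reindex_bij_witness[of _ "\<lambda>p. p + monom t (N - 1)" "\<lambda>p. p + monom (- t) (N - 1)"])
       (use mon in \<open>auto simp: add.assoc add_monom\<close>)
  also have "\<dots> = (\<Sum>p\<in>monic_polys N. \<psi> (- t) * f p)"
  proof (rule sum.cong[OF refl])
    fix p :: "'a poly"
    have "\<psi> (- (coeff p (N - 1) + t)) = \<psi> (- t) * \<psi> (- coeff p (N - 1))"
      using additive_char(2)[OF ps, of "- t" "- coeff p (N - 1)"] by (simp add: algebra_simps)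
    thus "f (p + monom t (N - 1)) = \<psi> (- t) * f p" using assms(3) by (simp add: f_def)
  qed
  finally have "(\<Sum>p\<in>monic_polys N. f p) = \<psi> (- t) * (\<Sum>p\<in>monic_polys N. f p)" by (simp only: sum_distrib_left [symmetric])
  thus ?thesis using \<open>\<psi> t' \<noteq> 1\<close> unfolding S by (simp add: t_def mult_cancel_right1)
qed

text \<open>
  The L-series is \<open>1 - g(\<chi>) * X\<close>, and the sums over points are the coefficients of its logarithmic
  derivative.
\<close>

lemma point_sum_1:
  fixes \<psi> \<chi> :: "'a :: {field, finite} \<Rightarrow> qbar"
  assumes ps: "nontrivial_additive_char \<psi>" and ch: "\<chi> \<in> mchars"
  shows "point_sum \<psi> 1 \<chi> (Suc r) = - (gauss \<psi> \<chi> ^ Suc r)"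
proof (induction r)
  case 0
  show ?case using divisor_sum_recurrence[OF ps ch, of 1 1] divisor_sum_1[OF ps ch] divisor_sum_0[OF ps ch] by simp
next
  case (Suc r)
  define f where "f j = point_sum \<psi> 1 \<chi> j * divisor_sum \<psi> 1 \<chi> (Suc (Suc r) - j)" for j
  have "0 = (\<Sum>j=1..Suc (Suc r). f j)"
    using divisor_sum_recurrence[OF ps ch, of "Suc (Suc r)" 1] divisor_sum_ge_2[OF ps ch, of "Suc (Suc r)"] by (simp add: f_def)
  also have "\<dots> = (\<Sum>j\<in>{Suc r, Suc (Suc r)}. f j)"
    by (rule sum.mono_neutral_right) (auto simp: f_def intro!: divisor_sum_ge_2[OF ps ch, unfolded One_nat_def])
  also have "\<dots> = f (Suc r) + f (Suc (Suc r))" by simp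
  also have "\<dots> = - point_sum \<psi> 1 \<chi> (Suc r) * gauss \<psi> \<chi> + point_sum \<psi> 1 \<chi> (Suc (Suc r))"
    using divisor_sum_1[OF ps ch] divisor_sum_0[OF ps ch] by (simp add: f_def)
  finally have "point_sum \<psi> 1 \<chi> (Suc (Suc r)) = point_sum \<psi> 1 \<chi> (Suc r) * gauss \<psi> \<chi>" by simp
  thus ?case unfolding Suc by (simp add: mult_ac)
qed

text \<open>
  By \<open>point_sum_1\<close> and \<open>point_sum_power\<close> the sums over points of the pulled back character are, up
  to sign, the power sums of the \<open>n\<close> Gauss sums \<open>g(\<chi> \<phi>\<^sub>n\<^bsup>k\<^esup>)\<close>. The recurrences \<open>newton\<close> and
  \<open>divisor_sum_recurrence\<close> then coincide, so the L-series is \<open>\<Prod>k. 1 - g(\<chi> \<phi>\<^sub>n\<^bsup>k\<^esup>) * X\<close>.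
\<close>

lemma prod_gauss_eq_divisor_sum:
  fixes \<psi> \<chi> \<phi> :: "'a :: {field, finite} \<Rightarrow> qbar"
  assumes ps: "nontrivial_additive_char \<psi>" and gen: "generates_mchars \<phi>" and ch: "\<chi> \<in> mchars"
    and n: "n dvd CARD('a) - 1"
  shows "(\<Prod>k<n. gauss \<psi> (char_mult \<chi> (char_pow (root_char \<phi> n) k))) = (- 1) ^ n * divisor_sum \<psi> n \<chi> n"
proof -
  define M where "M = image_mset (\<lambda>k. gauss \<psi> (char_mult \<chi> (char_pow (root_char \<phi> n) k))) (mset_set {..<n})"
  have p: "point_sum \<psi> n \<chi> r = - power_sum r M" if "r > 0" for r
  proof -
    obtain r' where r': "r = Suc r'" using \<open>r > 0\<close> by (cases r) auto
    have "point_sum \<psi> n \<chi> r = (\<Sum>k<n. - (gauss \<psi> (char_mult \<chi> (char_pow (root_char \<phi> n) k)) ^ r))"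
      unfolding point_sum_power[OF gen n that]
      by (intro sum.cong refl, unfold r', rule point_sum_1[OF ps]) (simp add: ch generates_mcharsD[OF gen])
    thus ?thesis by (simp add: M_def power_sum_def sum_negf sum_unfold_sum_mset multiset.map_comp comp_def)
  qed
  have "divisor_sum \<psi> n \<chi> N = root_fps M $ N" for N
  proof (induction N rule: less_induct)
    case (less N)
    show ?case
    proof (cases "N = 0")
      case True
      thus ?thesis using divisor_sum_0[OF ps ch] root_fps_nth[of 0 M] monic_root_poly[of M] by simp
    next
      case False
      have "of_nat N * divisor_sum \<psi> n \<chi> N = (\<Sum>r=1..N. - power_sum r M * root_fps M $ (N - r))"
        unfolding divisor_sum_recurrence[OF ps ch] using less False by (intro sum.cong refl) (simp add: p)
      also have "\<dots> = of_nat N * root_fps M $ N" by (simp add: newton sum_negf)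
      finally show ?thesis using False by simp
    qed
  qed
  hence "divisor_sum \<psi> n \<chi> n = (- 1) ^ n * prod_mset M"
    using coeff_0_root_poly[of M] by (simp add: root_fps_nth M_def)
  hence "(- 1) ^ n * divisor_sum \<psi> n \<chi> n = prod_mset M"
    by (simp add: mult.assoc [symmetric] flip: power_add)
  thus ?thesis by (simp add: M_def prod_unfold_prod_mset)
qed

lemma of_nat_nonzero:
  assumes "n dvd CARD('a :: {field, finite}) - 1"
  shows "of_nat n \<noteq> (0 :: 'a)"
proof
  assume "of_nat n = (0 :: 'a)"
  hence "of_nat (CARD('a) - 1) = (0 :: 'a)" using assms by (auto elim!: dvdE simp del: One_nat_def)
  moreover have "of_nat (CARD('a)) = of_nat (CARD('a) - 1) + (1 :: 'a)"
    using card_ge_2[where ?'a='a] by (metis Suc_diff_1 of_nat_Suc add.commute zero_less_card_finite)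
  moreover have "(\<Sum>x\<in>UNIV. x) = (\<Sum>x\<in>UNIV. x + 1 :: 'a)"
    by (rule sum.reindex_bij_witness[of _ "\<lambda>x. x + 1" "\<lambda>x. x - 1"]) auto
  hence "of_nat (CARD('a)) = (0 :: 'a)" by (simp add: sum.distrib)
  ultimately show False by (metis add_0 zero_neq_one)
qed

text \<open>
  The coefficient of \<open>X\<^bsup>n\<^esup>\<close> computed the other way, as a sum over monic polynomials of degree \<open>n\<close>:
  \<open>\<chi>\<close> sees only the constant coefficient \<open>a\<close>, and by \<open>power_sum_cong\<close> the argument of \<open>\<psi>\<close> is
  \<open>- n * a\<close> plus a function of the other coefficients. The sum over \<open>a\<close> is a Gauss sum for \<open>\<chi>\<^bsup>n\<^esup>\<close>, and
  the sum over the other coefficients is a constant that does not depend on \<open>\<chi>\<close>.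
\<close>

lemma divisor_sum_const:
  fixes \<psi> :: "'a :: {field, finite} \<Rightarrow> qbar"
  assumes ps: "nontrivial_additive_char \<psi>" and n: "n dvd CARD('a) - 1"
  shows "\<exists>C. \<forall>\<chi>\<in>mchars. (- 1) ^ n * divisor_sum \<psi> n \<chi> n = C * (gauss \<psi> (char_pow \<chi> n) / \<chi> (of_nat n) ^ n)"
proof -
  have n0: "n > 0" using n by (rule dvd_card_pos)
  note nn = of_nat_nonzero[OF n]
  define R where "R = {p :: 'a poly. degree p = n \<and> lead_coeff p = 1 \<and> coeff p 0 = 0}"
  define f where "f p = of_ac (power_sum n (root_divisor p))" for p :: "'a poly"
  \<comment> \<open>the part of the power sum that does not depend on the constant coefficient, read off at the value \<open>1\<close>\<close>
  define \<kappa> where "\<kappa> p = f (p + [:1:]) + of_nat n" for p :: "'a poly"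
  have shift: "p + [:a:] \<in> monic_polys n" if "p \<in> R" "a \<noteq> 0" for p a
  proof -
    have "degree (p + [:a:]) = degree p" using that n0 by (intro degree_add_eq_left) (auto simp: R_def)
    thus ?thesis using that n0 by (auto simp: R_def monic_polys_def coeff_pCons split: nat.splits)
  qed
  have fr: "to_ac (f p) = power_sum n (root_divisor p)" if "p \<in> monic_polys n" for p
  proof -
    have "root_divisor p \<in> divisors_of_size n" using bij_root_divisor that by (auto simp: bij_betw_def)
    hence "image_mset (\<lambda>x. x ^ n) (root_divisor p) \<in> invariant_divisors"
      by (intro power_invariant) (simp add: divisors_of_size_def)
    thus ?thesis using invariant_in_range(2) unfolding f_def power_sum_def by (metis to_ac_of_ac)
  qed
  have f\<kappa>: "f (p + [:a:]) = \<kappa> p + - (of_nat n * a)" if "p \<in> R" "a \<noteq> 0" for p a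
  proof -
    note s1 = shift[OF that] and s2 = shift[OF that(1) one_neq_zero]
    note r1 = root_divisor_root_poly[OF s1] and r2 = root_divisor_root_poly[OF s2]
    have "power_sum n (root_divisor (p + [:a:])) + of_nat n * coeff (root_poly (root_divisor (p + [:a:]))) 0 =
          power_sum n (root_divisor (p + [:1:])) + of_nat n * coeff (root_poly (root_divisor (p + [:1:]))) 0"
      by (rule power_sum_cong) (auto simp: r1 r2 coeff_map_poly coeff_pCons split: nat.splits)
    hence "to_ac (f (p + [:a:]) + of_nat n * a) = to_ac (f (p + [:1:]) + of_nat n)"
      using that by (simp add: r1 r2 coeff_map_poly fr s1 s2 R_def)
    hence "f (p + [:a:]) + of_nat n * a = \<kappa> p" unfolding \<kappa>_def to_ac_eq_iff .
    thus ?thesis by (simp add: algebra_simps)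
  qed
  define C where "C = (- 1) ^ Suc n * (\<Sum>p\<in>R. \<psi> (\<kappa> p))"
  have "(- 1) ^ n * divisor_sum \<psi> n \<chi> n = C * (gauss \<psi> (char_pow \<chi> n) / \<chi> (of_nat n) ^ n)" if ch: "\<chi> \<in> mchars" for \<chi>
  proof -
    have "divisor_sum \<psi> n \<chi> n = (\<Sum>p\<in>monic_polys n. \<chi> (((- 1) ^ n * coeff p 0) ^ n) * \<psi> (f p))"
      unfolding divisor_sum_eq_monic_polys
    proof (rule sum.cong[OF refl])
      fix p :: "'a poly" assume p: "p \<in> monic_polys n"
      have "prod_mset (image_mset (\<lambda>x. x ^ n) (root_divisor p)) = to_ac (((- 1) ^ n * coeff p 0) ^ n)"
        by (simp add: root_divisor_prod[OF p] prod_mset_power)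
      thus "div_char \<psi> \<chi> (image_mset (\<lambda>x. x ^ n) (root_divisor p)) = \<chi> (((- 1) ^ n * coeff p 0) ^ n) * \<psi> (f p)"
        by (simp only: div_char_def f_def power_sum_def of_ac_to_ac)
    qed
    also have "\<dots> = (\<Sum>(p, a)\<in>R \<times> {a. a \<noteq> 0}. \<psi> (\<kappa> p) * (\<chi> (((- 1) ^ n * a) ^ n) * \<psi> (- (of_nat n * a))))"
    proof (rule sum.reindex_bij_witness[of _ "\<lambda>(p, a). p + [:a:]" "\<lambda>p. (p - [:coeff p 0:], coeff p 0)"])
      fix p :: "'a poly" assume p: "p \<in> monic_polys n"
      have "degree (p - [:coeff p 0:]) = degree p"
        unfolding diff_conv_add_uminus using p n0 by (intro degree_add_eq_left) (auto simp: monic_polys_def)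
      hence pR: "p - [:coeff p 0:] \<in> R" using p n0 by (auto simp: monic_polys_def R_def coeff_pCons split: nat.splits)
      thus "(p - [:coeff p 0:], coeff p 0) \<in> R \<times> {a. a \<noteq> 0}" using p by (simp add: monic_polys_def)
      have "f p = \<kappa> (p - [:coeff p 0:]) + - (of_nat n * coeff p 0)"
        using f\<kappa>[OF pR, of "coeff p 0"] p by (simp add: monic_polys_def)
      thus "(case (p - [:coeff p 0:], coeff p 0) of (p, a) \<Rightarrow> \<psi> (\<kappa> p) * (\<chi> (((- 1) ^ n * a) ^ n) * \<psi> (- (of_nat n * a)))) =
          \<chi> (((- 1) ^ n * coeff p 0) ^ n) * \<psi> (f p)"
        by (simp only: prod.case additive_char(2)[OF ps] mult_ac)
    qed (auto simp: shift, auto simp: R_def)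
    also have "\<dots> = (\<Sum>p\<in>R. \<psi> (\<kappa> p)) * (\<Sum>a\<in>{a. a \<noteq> 0}. \<chi> (((- 1) ^ n * a) ^ n) * \<psi> (- (of_nat n * a)))"
      by (simp add: sum.cartesian_product [symmetric] sum_product)
    also have "(\<Sum>a\<in>{a. a \<noteq> 0}. \<chi> (((- 1) ^ n * a) ^ n) * \<psi> (- (of_nat n * a))) =
               (\<Sum>b\<in>{b. b \<noteq> 0}. \<chi> b ^ n / \<chi> (of_nat n) ^ n * \<psi> b)"
    proof (rule sum.reindex_bij_witness[of _ "\<lambda>b. - b / of_nat n" "\<lambda>a. - (of_nat n * a)"])
      fix a :: 'a assume "a \<in> {a. a \<noteq> 0}"
      have "((- 1) ^ n * a) ^ n * of_nat n ^ n = ((- 1) ^ n) ^ n * (a * of_nat n) ^ n"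
        by (simp add: power_mult_distrib)
      \<comment> \<open>\<open>n * n\<close> and \<open>n\<close> have the same parity\<close>
      also have "((- 1) ^ n) ^ n = ((- 1) :: 'a) ^ n" by (cases "even n") simp_all
      also have "\<dots> * (a * of_nat n) ^ n = (- (of_nat n * a)) ^ n"
        by (simp add: mult.commute flip: power_mult_distrib)
      finally have "\<chi> (((- 1) ^ n * a) ^ n * of_nat n ^ n) = \<chi> ((- (of_nat n * a)) ^ n)" by simp
      hence "\<chi> (((- 1) ^ n * a) ^ n) * \<chi> (of_nat n) ^ n = \<chi> (- (of_nat n * a)) ^ n"
        by (simp only: mcharsD(3)[OF ch] mchars_power[OF ch])
      moreover have "\<chi> (of_nat n) ^ n \<noteq> 0" using nn mcharsD(2)[OF ch] by simp
      ultimately show "\<chi> (- (of_nat n * a)) ^ n / \<chi> (of_nat n) ^ n * \<psi> (- (of_nat n * a)) =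
         \<chi> (((- 1) ^ n * a) ^ n) * \<psi> (- (of_nat n * a))" by (simp add: field_simps)
    qed (use nn in auto)
    also have "\<dots> = (\<Sum>b\<in>{b. b \<noteq> 0}. char_pow \<chi> n b * \<psi> b) / \<chi> (of_nat n) ^ n"
      unfolding sum_divide_distrib by (intro sum.cong refl) (simp add: char_pow_def)
    also have "\<dots> = - (gauss \<psi> (char_pow \<chi> n) / \<chi> (of_nat n) ^ n)" by (simp add: gauss_def)
    finally show ?thesis by (simp add: C_def)
  qed
  thus ?thesis by blast
qed

text \<open>
  The constant of \<open>divisor_sum_const\<close> is found by taking \<open>\<chi>\<close> trivial.
\<close>

theorem davenport_hasse_product:
  fixes \<psi> \<chi> \<phi> :: "'a :: {field, finite} \<Rightarrow> qbar"
  assumes ps: "nontrivial_additive_char \<psi>" and gen: "generates_mchars \<phi>" and ch: "\<chi> \<in> mchars"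
    and n: "n dvd CARD('a) - 1"
  shows "(\<Prod>k<n. gauss \<psi> (char_mult \<chi> (char_pow (root_char \<phi> n) k))) =
     (\<Prod>k<n. gauss \<psi> (char_pow (root_char \<phi> n) k)) * (gauss \<psi> (char_pow \<chi> n) / \<chi> (of_nat n) ^ n)"
proof -
  obtain C where C: "\<And>\<chi>. \<chi> \<in> mchars \<Longrightarrow>
      (\<Prod>k<n. gauss \<psi> (char_mult \<chi> (char_pow (root_char \<phi> n) k))) = C * (gauss \<psi> (char_pow \<chi> n) / \<chi> (of_nat n) ^ n)"
    using divisor_sum_const[OF ps n] prod_gauss_eq_divisor_sum[OF ps gen _ n] by metis
  have "triv_char (of_nat n :: 'a) ^ n = 1" using of_nat_nonzero[OF n] by simp
  hence "C = (\<Prod>k<n. gauss \<psi> (char_pow (root_char \<phi> n) k))"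
    using C[of triv_char] generates_mcharsD[OF gen] ps by simp
  thus ?thesis using C[OF ch] by simp
qed

section \<open>Gauss and Jacobi sums\<close>

lemma sum_split_0: "(\<Sum>x\<in>UNIV. f x) = f 0 + (\<Sum>x\<in>{x. x \<noteq> 0}. f x)" for f :: "'a :: {zero, finite} \<Rightarrow> 'b :: comm_monoid_add"
proof -
  have "UNIV - {0} = {x :: 'a. x \<noteq> 0}" by auto
  thus ?thesis using sum.remove[of UNIV 0 f] by simp
qed

lemma additive_char_sum_mult:
  fixes \<psi> :: "'a :: {field, finite} \<Rightarrow> qbar"
  assumes "nontrivial_additive_char \<psi>"
  shows "(\<Sum>y\<in>UNIV. \<psi> (c * y)) = (if c = 0 then of_nat CARD('a) else 0)"
proof (cases "c = 0")
  case False
  have "(\<Sum>y\<in>UNIV. \<psi> (c * y)) = (\<Sum>y\<in>UNIV. \<psi> y)"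
    by (rule sum.reindex_bij_witness[of _ "\<lambda>y. y / c" "\<lambda>y. c * y"]) (use False in auto)
  thus ?thesis using False additive_char_sum[OF assms] by simp
qed (simp add: additive_char[OF assms])

text \<open>
  If \<open>g(\<chi>)\<close> vanished, so would \<open>\<Sum>x. \<chi>(x) \<psi>(x y)\<close> for every \<open>y\<close>, that is, the Fourier transform of
  \<open>\<chi>\<close>; but Fourier inversion at \<open>1\<close> gives \<open>q \<chi>(1) = q\<close>.
\<close>

lemma gauss_nonzero:
  fixes \<psi> \<chi> :: "'a :: {field, finite} \<Rightarrow> qbar"
  assumes ps: "nontrivial_additive_char \<psi>" and ch: "\<chi> \<in> mchars"
  shows "gauss \<psi> \<chi> \<noteq> 0"
proof (cases "\<chi> = triv_char")
  case False
  show ?thesis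
  proof
    assume "gauss \<psi> \<chi> = 0"
    hence g0: "(\<Sum>x\<in>{x. x \<noteq> 0}. \<chi> x * \<psi> x) = 0" by (simp add: gauss_def)
    have S: "(\<Sum>x\<in>{x. x \<noteq> 0}. \<chi> x * \<psi> (x * y)) = 0" for y
    proof (cases "y = 0")
      case True
      thus ?thesis using sum_mchar[OF ch] False by (simp add: additive_char[OF ps])
    next
      case y: False
      have "(\<Sum>x\<in>{x. x \<noteq> 0}. \<chi> x * \<psi> (x * y)) = (\<Sum>x\<in>{x. x \<noteq> 0}. \<chi> (x / y) * \<psi> x)"
        by (rule sum.reindex_bij_witness[of _ "\<lambda>x. x / y" "\<lambda>x. x * y"]) (use y in auto)
      also have "\<dots> = (\<Sum>x\<in>{x. x \<noteq> 0}. \<chi> x * \<psi> x) / \<chi> y"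
        unfolding sum_divide_distrib by (intro sum.cong refl) (simp add: mchars_divide[OF ch])
      finally show ?thesis by (simp add: g0)
    qed
    have "0 = (\<Sum>y\<in>UNIV. (\<Sum>x\<in>{x. x \<noteq> 0}. \<chi> x * \<psi> (x * y)) * \<psi> (- y))" by (simp add: S)
    also have "\<dots> = (\<Sum>y\<in>UNIV. \<Sum>x\<in>{x. x \<noteq> 0}. \<chi> x * \<psi> ((x - 1) * y))"
      by (simp add: sum_distrib_right mult.assoc left_diff_distrib flip: additive_char(2)[OF ps])
    also have "\<dots> = (\<Sum>x\<in>{x. x \<noteq> 0}. \<chi> x * (\<Sum>y\<in>UNIV. \<psi> ((x - 1) * y)))"
      by (subst sum.swap) (simp add: sum_distrib_left)
    also have "\<dots> = (\<Sum>x\<in>{x :: 'a. x \<noteq> 0}. if x = 1 then of_nat CARD('a) else 0)"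
      unfolding additive_char_sum_mult[OF ps] by (intro sum.cong refl) (simp add: mcharsD[OF ch])
    also have "\<dots> = of_nat CARD('a)" by simp
    finally show False by simp
  qed
qed (simp add: ps)

lemma prod_sum_fun:
  fixes f :: "'n :: finite \<Rightarrow> 'b \<Rightarrow> 'c :: comm_semiring_1"
  assumes "\<And>i. finite (B i)"
  shows "(\<Prod>i\<in>UNIV. \<Sum>x\<in>B i. f i x) = (\<Sum>x\<in>{x. \<forall>i. x i \<in> B i}. \<Prod>i\<in>UNIV. f i (x i))"
proof -
  have "PiE UNIV B = {x. \<forall>i. x i \<in> B i}" by (auto simp: PiE_def Pi_def)
  thus ?thesis using prod_sum_PiE[of UNIV B f] assms by simp
qed

definition char_prod :: "('n :: finite \<Rightarrow> 'a :: {field, finite} \<Rightarrow> qbar) \<Rightarrow> 'a \<Rightarrow> qbar" where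
  "char_prod \<eta> x = (\<Prod>i\<in>UNIV. \<eta> i x)"

text \<open>
  The Jacobi sum with right-hand side \<open>c\<close> and without the sign.
\<close>

definition level_sum :: "('n :: finite \<Rightarrow> 'a :: {field, finite} \<Rightarrow> qbar) \<Rightarrow> 'a \<Rightarrow> qbar" where
  "level_sum \<eta> c = (\<Sum>x\<in>{x :: 'n \<Rightarrow> 'a. (\<forall>i. x i \<noteq> 0) \<and> (\<Sum>i\<in>UNIV. x i) = c}. \<Prod>i\<in>UNIV. \<eta> i (x i))"

lemma char_prod_mchars [simp]: "(\<And>i. \<eta> i \<in> mchars) \<Longrightarrow> char_prod \<eta> \<in> mchars"
  by (auto simp: mchars_def char_prod_def prod.distrib)

lemma level_sum_scale:
  fixes \<eta> :: "'n :: finite \<Rightarrow> 'a :: {field, finite} \<Rightarrow> qbar"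
  assumes "\<And>i. \<eta> i \<in> mchars" "c \<noteq> 0"
  shows "level_sum \<eta> c = char_prod \<eta> c * level_sum \<eta> 1"
proof -
  have "level_sum \<eta> c = (\<Sum>x\<in>{x :: 'n \<Rightarrow> 'a. (\<forall>i. x i \<noteq> 0) \<and> (\<Sum>i\<in>UNIV. x i) = 1}. \<Prod>i\<in>UNIV. \<eta> i (c * x i))"
    unfolding level_sum_def
    by (rule sum.reindex_bij_witness[of _ "\<lambda>x i. c * x i" "\<lambda>x i. x i / c"])
       (use assms(2) in \<open>auto simp: sum_distrib_left [symmetric] sum_divide_distrib [symmetric]\<close>)
  also have "\<dots> = char_prod \<eta> c * level_sum \<eta> 1"
    unfolding level_sum_def sum_distrib_left char_prod_def
    by (intro sum.cong refl) (simp add: mcharsD[OF assms(1)] prod.distrib)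
  finally show ?thesis .
qed

lemma sum_level_sum:
  fixes \<eta> :: "'n :: finite \<Rightarrow> 'a :: {field, finite} \<Rightarrow> qbar"
  shows "(\<Sum>c\<in>UNIV. f c * level_sum \<eta> c) =
         (\<Sum>x\<in>{x :: 'n \<Rightarrow> 'a. \<forall>i. x i \<noteq> 0}. f (\<Sum>i\<in>UNIV. x i) * (\<Prod>i\<in>UNIV. \<eta> i (x i)))"
proof -
  have "(\<Sum>x\<in>{x :: 'n \<Rightarrow> 'a. \<forall>i. x i \<noteq> 0}. f (\<Sum>i\<in>UNIV. x i) * (\<Prod>i\<in>UNIV. \<eta> i (x i))) =
    (\<Sum>c\<in>UNIV. \<Sum>x\<in>{x \<in> {x. \<forall>i. x i \<noteq> 0}. (\<Sum>i\<in>UNIV. x i) = c}. f (\<Sum>i\<in>UNIV. x i) * (\<Prod>i\<in>UNIV. \<eta> i (x i)))"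
    by (rule sum.group [symmetric]) auto
  also have "\<dots> = (\<Sum>c\<in>UNIV. f c * level_sum \<eta> c)"
    by (intro sum.cong refl) (simp add: level_sum_def sum_distrib_left)
  finally show ?thesis ..
qed

text \<open>
  The sum over all right-hand sides factors into sums over the coordinates.
\<close>

lemma level_sum_total:
  fixes \<eta> :: "'n :: finite \<Rightarrow> 'a :: {field, finite} \<Rightarrow> qbar"
  assumes m: "\<And>i. \<eta> i \<in> mchars"
  shows "level_sum \<eta> 0 + (if char_prod \<eta> = triv_char then of_nat (CARD('a) - 1) else 0) * level_sum \<eta> 1
     = (if \<forall>i. \<eta> i = triv_char then of_nat (CARD('a) - 1) ^ CARD('n) else 0)"
proof -
  have "(\<Sum>c\<in>UNIV. level_sum \<eta> c) = level_sum \<eta> 0 + (\<Sum>c\<in>{c. c \<noteq> 0}. level_sum \<eta> c)" by (rule sum_split_0)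
  also have "(\<Sum>c\<in>{c. c \<noteq> 0}. level_sum \<eta> c) = (\<Sum>c\<in>{c. c \<noteq> 0}. char_prod \<eta> c) * level_sum \<eta> 1"
    unfolding sum_distrib_right by (intro sum.cong refl level_sum_scale m) simp
  also have "(\<Sum>c\<in>{c. c \<noteq> 0}. char_prod \<eta> c) = (if char_prod \<eta> = triv_char then of_nat (CARD('a) - 1) else 0)"
    by (rule sum_mchar) (simp add: m)
  finally have "level_sum \<eta> 0 + (if char_prod \<eta> = triv_char then of_nat (CARD('a) - 1) else 0) * level_sum \<eta> 1 = (\<Sum>c\<in>UNIV. level_sum \<eta> c)" ..
  also have "\<dots> = (\<Sum>x\<in>{x :: 'n \<Rightarrow> 'a. \<forall>i. x i \<noteq> 0}. \<Prod>i\<in>UNIV. \<eta> i (x i))"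
    using sum_level_sum[of "\<lambda>_. 1" \<eta>] by simp
  also have "\<dots> = (\<Prod>i\<in>UNIV. \<Sum>x\<in>{x. x \<noteq> 0}. \<eta> i x)"
    by (subst prod_sum_fun) auto
  also have "\<dots> = (\<Prod>i\<in>UNIV. if \<eta> i = triv_char then of_nat (CARD('a) - 1) else 0)"
    by (intro prod.cong refl sum_mchar m)
  also have "\<dots> = (if \<forall>i. \<eta> i = triv_char then of_nat (CARD('a) - 1) ^ CARD('n) else 0)" by auto
  finally show ?thesis .
qed

text \<open>
  Expanding the product of Gauss sums and grouping the terms by the sum of the variables. Together
  with \<open>level_sum_total\<close> this gives two linear equations for \<open>level_sum \<eta> 0\<close> and \<open>level_sum \<eta> 1\<close>.
\<close>

lemma prod_gauss_level_sum:
  fixes \<eta> :: "'n :: finite \<Rightarrow> 'a :: {field, finite} \<Rightarrow> qbar"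
  assumes ps: "nontrivial_additive_char \<psi>" and m: "\<And>i. \<eta> i \<in> mchars"
  shows "(- 1) ^ CARD('n) * (\<Prod>i\<in>UNIV. gauss \<psi> (\<eta> i)) = level_sum \<eta> 0 - gauss \<psi> (char_prod \<eta>) * level_sum \<eta> 1"
proof -
  have "(- 1) ^ CARD('n) * (\<Prod>i\<in>UNIV. gauss \<psi> (\<eta> i)) = (\<Prod>i\<in>UNIV. - gauss \<psi> (\<eta> i))"
    by (simp add: prod_uminus)
  also have "\<dots> = (\<Prod>i\<in>UNIV. \<Sum>x\<in>{x. x \<noteq> 0}. \<eta> i x * \<psi> x)" by (simp add: gauss_def)
  also have "\<dots> = (\<Sum>x\<in>{x :: 'n \<Rightarrow> 'a. \<forall>i. x i \<noteq> 0}. \<Prod>i\<in>UNIV. \<eta> i (x i) * \<psi> (x i))"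
    by (subst prod_sum_fun) auto
  also have "\<dots> = (\<Sum>x\<in>{x :: 'n \<Rightarrow> 'a. \<forall>i. x i \<noteq> 0}. \<psi> (\<Sum>i\<in>UNIV. x i) * (\<Prod>i\<in>UNIV. \<eta> i (x i)))"
  proof -
    have "\<psi> (\<Sum>i\<in>A. x i) = (\<Prod>i\<in>A. \<psi> (x i))" for x :: "'n \<Rightarrow> 'a" and A
      by (induction A rule: infinite_finite_induct) (simp_all add: additive_char[OF ps])
    thus ?thesis by (simp add: prod.distrib mult.commute)
  qed
  also have "\<dots> = (\<Sum>c\<in>UNIV. \<psi> c * level_sum \<eta> c)" by (rule sum_level_sum [symmetric])
  also have "\<dots> = level_sum \<eta> 0 + (\<Sum>c\<in>{c. c \<noteq> 0}. \<psi> c * level_sum \<eta> c)"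
    by (subst sum_split_0) (simp add: additive_char[OF ps])
  also have "(\<Sum>c\<in>{c. c \<noteq> 0}. \<psi> c * level_sum \<eta> c) = (\<Sum>c\<in>{c. c \<noteq> 0}. char_prod \<eta> c * \<psi> c) * level_sum \<eta> 1"
    unfolding sum_distrib_right by (intro sum.cong refl, subst level_sum_scale[OF m]) (simp_all add: mult_ac)
  finally show ?thesis by (simp add: gauss_def)
qed

lemma jacobi_level_sum: "jacobi \<eta> = (- 1) ^ (CARD('n) - 1) * level_sum \<eta> 1"
  for \<eta> :: "'n :: finite \<Rightarrow> 'a :: {field, finite} \<Rightarrow> qbar"
  by (simp add: jacobi_def level_sum_def)

lemma minus_one_power_CARD: "(- 1) ^ CARD('n :: finite) = - ((- 1) ^ (CARD('n) - 1) :: 'b :: ring_1)"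
proof -
  have "CARD('n) = Suc (CARD('n) - 1)" using zero_less_card_finite[where ?'a='n] by simp
  thus ?thesis by (metis power_Suc mult_minus1)
qed

lemma of_nat_card_minus_1: "of_nat (CARD('a :: {field, finite}) - 1) = (of_nat CARD('a) - 1 :: 'b :: ring_1)"
  using card_ge_2[where ?'a='a] by (simp add: of_nat_diff)

lemma char_prod_triv: "(\<And>i. \<eta> i = triv_char) \<Longrightarrow> char_prod \<eta> = triv_char"
  by (auto simp: char_prod_def triv_char_def fun_eq_iff)

text \<open>
  The factor \<open>q\<close> in \<open>gauss_circ\<close> accounts for the case of trivial product; the correction term
  is present only if all characters are trivial.
\<close>

lemma jacobi_gauss:
  fixes \<eta> :: "'n :: finite \<Rightarrow> 'a :: {field, finite} \<Rightarrow> qbar"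
  assumes ps: "nontrivial_additive_char \<psi>" and m: "\<And>i. \<eta> i \<in> mchars"
  shows "jacobi \<eta> = (\<Prod>i\<in>UNIV. gauss \<psi> (\<eta> i)) / gauss_circ \<psi> (char_prod \<eta>)
      - (if \<forall>i. \<eta> i = triv_char then (1 - of_nat CARD('a)) ^ CARD('n) / of_nat CARD('a) else 0)"
proof -
  define n where "n = CARD('n)"
  define s :: qbar where "s = (- 1) ^ n"
  define q :: qbar where "q = of_nat CARD('a)"
  define G where "G = (\<Prod>i\<in>UNIV. gauss \<psi> (\<eta> i))"
  have s: "s * s = 1" by (simp add: s_def flip: power_add)
  have q0: "q \<noteq> 0" by (simp add: q_def)
  have j: "jacobi \<eta> = - s * level_sum \<eta> 1" 
    unfolding jacobi_level_sum s_def n_def minus_one_power_CARD by simp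
  have A: "s * G = level_sum \<eta> 0 - gauss \<psi> (char_prod \<eta>) * level_sum \<eta> 1"
    unfolding s_def n_def G_def by (rule prod_gauss_level_sum[OF ps m])
  have B: "level_sum \<eta> 0 + (if char_prod \<eta> = triv_char then q - 1 else 0) * level_sum \<eta> 1
     = (if \<forall>i. \<eta> i = triv_char then (q - 1) ^ n else 0)"
    using level_sum_total[OF m] by (simp only: of_nat_card_minus_1 q_def n_def)
  have sG: "G = s * (s * G)" using s by (simp flip: mult.assoc)
  consider "char_prod \<eta> \<noteq> triv_char" | "char_prod \<eta> = triv_char" "\<not> (\<forall>i. \<eta> i = triv_char)" | "\<forall>i. \<eta> i = triv_char"
    by blast
  thus ?thesis
  proof cases
    case 1
    have n: "\<not> (\<forall>i. \<eta> i = triv_char)" using 1 char_prod_triv by blast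
    have g0: "gauss \<psi> (char_prod \<eta>) \<noteq> 0" by (rule gauss_nonzero[OF ps]) (simp add: m)
    have "level_sum \<eta> 0 = 0" using B n 1 by simp
    hence "G = - s * level_sum \<eta> 1 * gauss \<psi> (char_prod \<eta>)" by (subst sG) (simp add: A)
    hence "G / gauss \<psi> (char_prod \<eta>) = - s * level_sum \<eta> 1" using g0 by simp
    thus ?thesis using 1 unfolding if_not_P[OF n] by (simp add: j gauss_circ_def G_def)
  next
    case 2
    have l: "level_sum \<eta> 0 = (1 - q) * level_sum \<eta> 1" using B 2 by (simp add: algebra_simps eq_neg_iff_add_eq_0)
    have "s * G = - level_sum \<eta> 1 * q" unfolding A l 2(1) using ps by (simp add: algebra_simps)
    hence "G = - s * level_sum \<eta> 1 * q" by (subst sG) simp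
    hence "G / q = - s * level_sum \<eta> 1" using q0 by simp
    thus ?thesis using 2(1) ps unfolding if_not_P[OF 2(2)] by (simp add: j gauss_circ_def G_def q_def)
  next
    case 3
    have t: "char_prod \<eta> = triv_char" using 3 char_prod_triv by blast
    have G: "G = 1" using 3 ps by (simp add: G_def)
    have l: "level_sum \<eta> 0 = (q - 1) ^ n - (q - 1) * level_sum \<eta> 1" using B 3 t by (simp add: algebra_simps)
    have "s * (level_sum \<eta> 1 * q) = s * (q - 1) ^ n - s * (s * G)"
      unfolding A l using t ps by (simp add: algebra_simps)
    also have "s * (s * G) = 1" using s G by simp
    also have "s * (q - 1) ^ n = (1 - q) ^ n" by (simp add: s_def flip: power_mult_distrib)
    finally have "- s * level_sum \<eta> 1 = (1 - (1 - q) ^ n) / q" using q0 by (simp add: field_simps)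
    thus ?thesis using 3 t ps G by (simp add: j gauss_circ_def G_def q_def n_def diff_divide_distrib)
  qed
qed

lemma level_sum_0:
  fixes \<eta> :: "'n :: finite \<Rightarrow> 'a :: {field, finite} \<Rightarrow> qbar"
  assumes m: "\<And>i. \<eta> i \<in> mchars" and t: "char_prod \<eta> = triv_char" and nt: "\<not> (\<forall>i. \<eta> i = triv_char)"
  shows "level_sum \<eta> 0 = - ((of_nat CARD('a) - 1) * (- 1) ^ (CARD('n) - 1) * jacobi \<eta>)"
proof -
  define u :: qbar where "u = (- 1) ^ (CARD('n) - 1)"
  have u: "u * u = 1" by (simp add: u_def flip: power_add)
  have j: "level_sum \<eta> 1 = u * jacobi \<eta>" using u by (simp add: jacobi_level_sum u_def flip: mult.assoc)
  have "level_sum \<eta> 0 + (of_nat CARD('a) - 1) * level_sum \<eta> 1 = 0"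
    using level_sum_total[of \<eta>, OF m] unfolding if_P[OF t] if_not_P[OF nt] of_nat_card_minus_1 .
  thus ?thesis unfolding j u_def by (simp add: eq_neg_iff_add_eq_0 mult.assoc)
qed

lemma level_sum_0_triv:
  fixes \<eta> :: "'n :: finite \<Rightarrow> 'a :: {field, finite} \<Rightarrow> qbar"
  assumes ps: "nontrivial_additive_char (\<psi> :: 'a \<Rightarrow> qbar)" and tt: "\<forall>i. \<eta> i = triv_char"
  shows "level_sum \<eta> 0 = ((of_nat CARD('a) - 1) ^ CARD('n) + (- 1) ^ CARD('n) * (of_nat CARD('a) - 1)) / of_nat CARD('a)"
proof -
  define q :: qbar where "q = of_nat CARD('a)"
  define s :: qbar where "s = (- 1) ^ CARD('n)"
  have q0: "q \<noteq> 0" by (simp add: q_def)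
  have m: "\<eta> i \<in> mchars" for i using tt by simp
  have t: "char_prod \<eta> = triv_char" using tt char_prod_triv by blast
  have "s * (\<Prod>i\<in>UNIV. gauss \<psi> (\<eta> i)) = level_sum \<eta> 0 - gauss \<psi> (char_prod \<eta>) * level_sum \<eta> 1"
    unfolding s_def by (rule prod_gauss_level_sum[OF ps m])
  hence A: "level_sum \<eta> 1 = level_sum \<eta> 0 - s" using tt t ps by (simp add: algebra_simps)
  have "level_sum \<eta> 0 + (q - 1) * level_sum \<eta> 1 = (q - 1) ^ CARD('n)"
    using level_sum_total[of \<eta>, OF m] unfolding if_P[OF t] if_P[OF tt] of_nat_card_minus_1 q_def .
  hence "q * level_sum \<eta> 0 = (q - 1) ^ CARD('n) + s * (q - 1)" unfolding A by (simp add: algebra_simps)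
  thus ?thesis using q0 unfolding q_def [symmetric] s_def [symmetric] by (simp add: field_simps)
qed

section \<open>The hypergeometric value as a sum of Gauss sums\<close>

text \<open>
  As \<open>d\<close> is the sum of the \<open>h i\<close>, the gcd condition says that the \<open>h i\<close> alone have no common factor.
\<close>

lemma dvd_of_dvd_all_mult:
  fixes h :: "'n :: finite \<Rightarrow> nat"
  assumes g: "Gcd (insert d (range h)) = 1" and d: "(\<Sum>i\<in>UNIV. h i) = d" and a: "\<And>i. N dvd k * h i"
  shows "N dvd k"
proof -
  have "N dvd (\<Sum>i\<in>UNIV. k * h i)" by (intro dvd_sum a)
  hence "N dvd k * d" by (simp add: d flip: sum_distrib_left)
  hence "N dvd Gcd ((*) k ` insert d (range h))" using a by (intro Gcd_greatest) auto
  also have "Gcd ((*) k ` insert d (range h)) = k" by (subst Gcd_mult) (simp only: g, simp)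
  finally show ?thesis .
qed

lemma root_char_pow_eq_iff:
  fixes \<phi> :: "'a :: {field, finite} \<Rightarrow> qbar"
  assumes gen: "generates_mchars \<phi>" and n: "n dvd CARD('a) - 1"
  shows "char_pow (root_char \<phi> n) k = char_pow (root_char \<phi> n) l \<longleftrightarrow> k mod n = l mod n"
proof -
  obtain e where e: "CARD('a) - 1 = n * e" using n by (rule dvdE)
  have pos: "n > 0" "e > 0" using e card_ge_2[where ?'a='a] by (auto intro!: Nat.gr0I)
  have "char_pow (root_char \<phi> n) k = char_pow \<phi> (e * k)" for k
    using pos by (simp only: root_char_def char_pow_mult e) simp
  thus ?thesis using pos by (simp only: char_pow_generator_eq_iff[OF gen] e mult.commute[of n e] mult_mod_right [symmetric]) simp
qed

lemma root_char_pow_triv_iff: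
  fixes \<phi> :: "'a :: {field, finite} \<Rightarrow> qbar"
  assumes gen: "generates_mchars \<phi>" and n: "n dvd CARD('a) - 1"
  shows "char_pow (root_char \<phi> n) k = triv_char \<longleftrightarrow> n dvd k"
  using root_char_pow_eq_iff[OF gen n, of k 0] by auto

text \<open>
  The powers of \<open>\<phi>\<^sub>n\<close> are exactly the characters killed by the \<open>n\<close>th power map, each occurring for
  one \<open>k < n\<close>.
\<close>

lemma count_inverse_root_chars:
  fixes \<phi> :: "'a :: {field, finite} \<Rightarrow> qbar"
  assumes gen: "generates_mchars \<phi>" and n: "n dvd CARD('a) - 1" and nu: "\<nu> \<in> mchars"
  shows "(\<Sum>k<n. of_bool (char_mult (char_pow (root_char \<phi> n) k) \<nu> = triv_char)) = (of_bool (char_pow \<nu> n = triv_char) :: nat)"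
proof (cases "char_pow \<nu> n = triv_char")
  case False
  have "char_mult (char_pow (root_char \<phi> n) k) \<nu> \<noteq> triv_char" for k
  proof
    assume "char_mult (char_pow (root_char \<phi> n) k) \<nu> = triv_char"
    hence "char_pow (char_mult (char_pow (root_char \<phi> n) k) \<nu>) n = triv_char" by simp
    moreover have "char_pow (char_pow (root_char \<phi> n) k) n = triv_char"
      using root_char_pow_triv_iff[OF gen n, of "k * n"] by (simp add: char_pow_mult)
    ultimately show False using False nu by (simp add: char_pow_char_mult)
  qed
  thus ?thesis using False by simp
next
  case True
  note ph = generates_mcharsD[OF gen]
  obtain e where e: "CARD('a) - 1 = n * e" using n by (rule dvdE)
  have pos: "n > 0" "e > 0" using e card_ge_2[where ?'a='a] by (auto intro!: Nat.gr0I)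
  obtain j where j: "\<nu> = char_pow \<phi> j" using gen nu by (auto simp: generates_mchars_def)
  have "char_pow \<phi> (j * n) = triv_char" using True by (simp add: j char_pow_mult)
  hence "n * e dvd j * n" by (simp only: char_pow_generator_triv_iff[OF gen] e)
  hence "e dvd j" using pos by (simp add: mult.commute)
  then obtain i where i: "j = e * i" by (rule dvdE)
  have r: "root_char \<phi> n = char_pow \<phi> e" unfolding root_char_def e using pos by simp
  have nu': "\<nu> = char_pow (root_char \<phi> n) i" by (simp add: j i r char_pow_mult)
  have eq: "char_mult (char_pow (root_char \<phi> n) k) \<nu> = triv_char \<longleftrightarrow> n dvd k + i" for k
    unfolding nu' char_pow_add by (rule root_char_pow_triv_iff[OF gen n])
  \<comment> \<open>the exponent of the inverse of \<open>\<nu>\<close>; the outer reduction is for \<open>\<nu>\<close> trivial\<close>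
  define k0 where "k0 = (n - i mod n) mod n"
  have "n dvd k + i \<longleftrightarrow> k = k0" if "k < n" for k
  proof -
    have "n dvd k + i \<longleftrightarrow> (k + i mod n) mod n = 0" by (simp add: dvd_eq_mod_eq_0 mod_add_right_eq)
    also have "\<dots> \<longleftrightarrow> k = k0"
    proof (cases "i mod n = 0")
      case True thus ?thesis using that by (simp add: k0_def)
    next
      case False
      have im: "i mod n < n" using pos by simp
      have k0: "k0 = n - i mod n" using False im by (simp add: k0_def)
      show ?thesis
      proof
        assume "(k + i mod n) mod n = 0"
        hence "n dvd k + i mod n" by auto
        then obtain t where t: "k + i mod n = n * t" by (rule dvdE)
        have "n * t < n * 2" using t that im by linarith
        hence "t < 2" by simp
        moreover have "t \<noteq> 0" using t False by (intro notI) simp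
        ultimately have "t = 1" by simp
        thus "k = k0" using t k0 by simp
      qed (use k0 im in simp)
    qed
    finally show ?thesis .
  qed
  hence "(\<Sum>k<n. of_bool (char_mult (char_pow (root_char \<phi> n) k) \<nu> = triv_char)) = (\<Sum>k<n. of_bool (k = k0) :: nat)"
    by (intro sum.cong refl) (simp add: eq)
  also have "\<dots> = 1" using pos by (simp add: k0_def of_bool_def)
  finally show ?thesis using True by simp
qed

lemma image_mset_shift_mod:
  assumes "h > 0"
  shows "image_mset (\<lambda>k. f ((k + c) mod h)) (mset_set {..<h}) = image_mset f (mset_set {..<h :: nat})"
proof -
  have inj: "inj_on (\<lambda>k. (k + c) mod h) {..<h}"
  proof (rule linorder_inj_onI)
    fix a b assume ab: "a < b" "a \<in> {..<h}" "b \<in> {..<h}"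
    show "(a + c) mod h \<noteq> (b + c) mod h"
    proof
      assume "(a + c) mod h = (b + c) mod h"
      hence "h dvd (b + c) - (a + c)" using ab by (subst (asm) eq_commute, subst (asm) mod_eq_dvd_iff_nat) auto
      thus False using ab by (auto dest: dvd_imp_le)
    qed
  qed auto
  have "(\<lambda>k. (k + c) mod h) ` {..<h} = {..<h}"
    using assms by (intro card_subset_eq) (auto simp: card_image[OF inj])
  hence "mset_set {..<h} = image_mset (\<lambda>k. (k + c) mod h) (mset_set {..<h})"
    using image_mset_mset_set[OF inj] by simp
  thus ?thesis by (metis (no_types, lifting) image_mset.compositionality multiset.map_cong0 comp_def)
qed

text \<open>
  As \<open>\<phi>\<^bsub>d h\<^esub>\<close> to the power \<open>h\<close> is \<open>\<phi>\<^sub>d\<close> and to the power \<open>d\<close> is \<open>\<phi>\<^sub>h\<close>, the upper parameters belonging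
  to \<open>i\<close> are \<open>\<phi>\<^sub>d\<^bsup>m\<^esup>\<close> times the characters of order dividing \<open>h i\<close>. The reduction of \<open>m * h i\<close> modulo
  \<open>d\<close> only permutes them cyclically.
\<close>

lemma upper_params_eq:
  fixes \<phi> :: "'a :: {field, finite} \<Rightarrow> qbar" and h w :: "'n :: finite \<Rightarrow> nat"
  assumes gen: "generates_mchars \<phi>" and dh: "\<And>i. d * h i dvd CARD('a) - 1" and w: "\<And>i. w i = m * h i mod d"
  shows "upper_params \<phi> d h w =
     (\<Sum>i\<in>UNIV. image_mset (\<lambda>k. char_mult (char_pow (root_char \<phi> d) m) (char_pow (root_char \<phi> (h i)) k)) (mset_set {..<h i}))"
  unfolding upper_params_def
proof (rule sum.cong[OF refl])
  fix i
  obtain e where e: "CARD('a) - 1 = d * h i * e" using dh[of i] by (rule dvdE)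
  have pos: "d > 0" "h i > 0" "e > 0" using e card_ge_2[where ?'a='a] by (auto intro!: Nat.gr0I)
  \<comment> \<open>the cyclic shift caused by replacing \<open>m * h i\<close> by its remainder modulo \<open>d\<close>\<close>
  define c where "c = m * h i div d"
  define f where "f k = char_mult (char_pow (root_char \<phi> d) m) (char_pow (root_char \<phi> (h i)) k)" for k
  define g where "g k = char_pow (root_char \<phi> (d * h i)) (w i + d * k)" for k
  have rd: "root_char \<phi> d = char_pow \<phi> (h i * e)" unfolding root_char_def e using pos by (simp add: mult.assoc)
  have rh: "root_char \<phi> (h i) = char_pow \<phi> (d * e)" unfolding root_char_def e using pos by (simp add: mult_ac)
  have rdh: "root_char \<phi> (d * h i) = char_pow \<phi> e" unfolding root_char_def e using pos by simp
  have wc: "w i + d * c = m * h i" by (simp add: w c_def)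
  have gf: "g (k + c) = f k" for k
  proof -
    have "e * (w i + d * (k + c)) = h i * e * m + d * e * k"
      using arg_cong[OF wc, of "\<lambda>x. e * x"] by (simp add: algebra_simps)
    thus ?thesis unfolding g_def f_def rd rh rdh char_pow_mult char_pow_add by simp
  qed
  have fmod: "f k = f (k mod h i)" for k
  proof -
    have "h i dvd CARD('a) - 1" using dh[of i] by (rule dvd_mult_right)
    hence "char_pow (root_char \<phi> (h i)) k = char_pow (root_char \<phi> (h i)) (k mod h i)"
      by (subst root_char_pow_eq_iff[OF gen]) auto
    thus ?thesis by (simp add: f_def)
  qed
  have gmod: "g k = g (k mod h i)" for k
  proof -
    have "(w i + d * k) mod (d * h i) = (w i + d * (k mod h i)) mod (d * h i)"
      by (metis mod_add_right_eq mod_mult_mult1 mod_mod_trivial mult_mod_right)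
    thus ?thesis unfolding g_def by (simp only: root_char_pow_eq_iff[OF gen dh])
  qed
  have "image_mset g (mset_set {..<h i}) = image_mset (\<lambda>k. g ((k + c) mod h i)) (mset_set {..<h i})"
    by (rule image_mset_shift_mod [symmetric]) (rule pos)
  also have "\<dots> = image_mset f (mset_set {..<h i})" by (simp only: gmod [symmetric] gf)
  finally show "image_mset (\<lambda>k. char_pow (root_char \<phi> (d * h i)) (w i + d * k)) (mset_set {..<h i}) =
    image_mset (\<lambda>k. char_mult (char_pow (root_char \<phi> d) m) (char_pow (root_char \<phi> (h i)) k)) (mset_set {..<h i})"
    by (simp only: g_def[abs_def] f_def[abs_def])
qed


lemma prod_poch_upper:
  fixes \<psi> \<phi> :: "'a :: {field, finite} \<Rightarrow> qbar"
  assumes ps: "nontrivial_additive_char \<psi>" and gen: "generates_mchars \<phi>" and n: "n dvd CARD('a) - 1"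
    and al: "\<alpha> \<in> mchars" and nu: "\<nu> \<in> mchars"
  shows "(\<Prod>k<n. poch \<psi> (char_mult \<alpha> (char_pow (root_char \<phi> n) k)) \<nu>) =
     gauss \<psi> (char_pow (char_mult \<alpha> \<nu>) n) / gauss \<psi> (char_pow \<alpha> n) / \<nu> (of_nat n) ^ n"
proof -
  note ph = generates_mcharsD[OF gen]
  define K where "K = (\<Prod>k<n. gauss \<psi> (char_pow (root_char \<phi> n) k))"
  have K: "K \<noteq> 0" using ph by (simp add: K_def gauss_nonzero[OF ps])
  have nn: "\<eta> (of_nat n) \<noteq> 0" if "\<eta> \<in> mchars" for \<eta> :: "'a \<Rightarrow> qbar"
    using of_nat_nonzero[OF n] that by (simp add: mcharsD)
  have "char_mult (char_mult \<alpha> \<beta>) \<nu> = char_mult (char_mult \<alpha> \<nu>) \<beta>" for \<beta>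
    by (simp add: char_mult_def fun_eq_iff)
  hence "(\<Prod>k<n. poch \<psi> (char_mult \<alpha> (char_pow (root_char \<phi> n) k)) \<nu>) =
    (\<Prod>k<n. gauss \<psi> (char_mult (char_mult \<alpha> \<nu>) (char_pow (root_char \<phi> n) k))) /
    (\<Prod>k<n. gauss \<psi> (char_mult \<alpha> (char_pow (root_char \<phi> n) k)))"
    by (simp add: poch_def prod_dividef)
  also have "\<dots> = (K * (gauss \<psi> (char_pow (char_mult \<alpha> \<nu>) n) / char_mult \<alpha> \<nu> (of_nat n) ^ n)) /
      (K * (gauss \<psi> (char_pow \<alpha> n) / \<alpha> (of_nat n) ^ n))"
    unfolding K_def by (subst (1 2) davenport_hasse_product[OF ps gen _ n]) (simp_all add: al nu)
  also have "\<dots> = gauss \<psi> (char_pow (char_mult \<alpha> \<nu>) n) / gauss \<psi> (char_pow \<alpha> n) / \<nu> (of_nat n) ^ n"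
    using K nn[OF al] nn[OF nu] gauss_nonzero[OF ps, of "char_pow \<alpha> n"] al
    by (simp add: char_mult_def power_mult_distrib field_simps)
  finally show ?thesis .
qed

text \<open>
  The factors \<open>q\<close> in the Gauss sums with a circle multiply up to the factor in \<open>g\<^sup>\<circ>(\<nu>\<^bsup>n\<^esup>)\<close> by
  \<open>count_inverse_root_chars\<close>; in the denominator, where \<open>\<nu>\<close> is replaced by the trivial character,
  they give the single factor \<open>q\<close>.
\<close>

lemma prod_poch_circ_lower:
  fixes \<psi> \<phi> :: "'a :: {field, finite} \<Rightarrow> qbar"
  assumes ps: "nontrivial_additive_char \<psi>" and gen: "generates_mchars \<phi>" and n: "n dvd CARD('a) - 1"
    and nu: "\<nu> \<in> mchars"
  shows "(\<Prod>\<beta>\<in>#lower_params \<phi> n. poch_circ \<psi> \<beta> \<nu>) =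
     gauss_circ \<psi> (char_pow \<nu> n) / \<nu> (of_nat n) ^ n / of_nat CARD('a)"
proof -
  note ph = generates_mcharsD[OF gen]
  define q :: qbar where "q = of_nat CARD('a)"
  have q0: "q \<noteq> 0" by (simp add: q_def)
  have n0: "n > 0" using n by (rule dvd_card_pos)
  define K where "K = (\<Prod>k<n. gauss \<psi> (char_pow (root_char \<phi> n) k))"
  have K: "K \<noteq> 0" using ph by (simp add: K_def gauss_nonzero[OF ps])
  have circ: "(\<Prod>k<n. gauss_circ \<psi> (char_mult (char_pow (root_char \<phi> n) k) \<mu>)) =
      K * (gauss_circ \<psi> (char_pow \<mu> n) / \<mu> (of_nat n) ^ n)" if mu: "\<mu> \<in> mchars" for \<mu>
  proof -
    have "(\<Prod>k<n. gauss_circ \<psi> (char_mult (char_pow (root_char \<phi> n) k) \<mu>)) =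
      q ^ (\<Sum>k<n. of_bool (char_mult (char_pow (root_char \<phi> n) k) \<mu> = triv_char)) *
      (\<Prod>k<n. gauss \<psi> (char_mult (char_pow (root_char \<phi> n) k) \<mu>))"
      by (simp only: gauss_circ_def prod.distrib power_sum q_def)
    also have "(\<Prod>k<n. gauss \<psi> (char_mult (char_pow (root_char \<phi> n) k) \<mu>)) =
       K * (gauss \<psi> (char_pow \<mu> n) / \<mu> (of_nat n) ^ n)"
      using davenport_hasse_product[OF ps gen mu n] by (simp only: char_mult_commute[of _ \<mu>] K_def)
    also have "(\<Sum>k<n. of_bool (char_mult (char_pow (root_char \<phi> n) k) \<mu> = triv_char)) = (of_bool (char_pow \<mu> n = triv_char) :: nat)"
      by (rule count_inverse_root_chars[OF gen n mu])
    finally show ?thesis by (simp add: gauss_circ_def q_def)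
  qed
  have d: "(\<Prod>k<n. gauss_circ \<psi> (char_pow (root_char \<phi> n) k)) = K * q"
    using circ[of triv_char] ph ps of_nat_nonzero[OF n] by (simp add: gauss_circ_def q_def)
  have "(\<Prod>\<beta>\<in>#lower_params \<phi> n. poch_circ \<psi> \<beta> \<nu>) = (\<Prod>k<n. poch_circ \<psi> (char_pow (root_char \<phi> n) k) \<nu>)"
    by (simp add: lower_params_def multiset.map_comp comp_def prod_unfold_prod_mset)
  also have "\<dots> = (K * (gauss_circ \<psi> (char_pow \<nu> n) / \<nu> (of_nat n) ^ n)) / (K * q)"
    by (simp add: poch_circ_def prod_dividef circ nu d)
  also have "\<dots> = gauss_circ \<psi> (char_pow \<nu> n) / \<nu> (of_nat n) ^ n / q"
    using K q0 by (simp add: field_simps)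
  finally show ?thesis by (simp add: q_def)
qed

lemma gauss_circ_nonzero:
  assumes "nontrivial_additive_char \<psi>" "\<chi> \<in> mchars" shows "gauss_circ \<psi> \<chi> \<noteq> 0"
  using gauss_nonzero[OF assms] by (simp add: gauss_circ_def)

text \<open>
  At \<open>y = d * l\<close> and up to the factor \<open>q / (1 - q)\<close>, this is the hypergeometric function for
  \<open>m = 0\<close> before any cancellation. Both the point count and the reduced function are expressed by it.
\<close>

definition gauss_ratio_sum ::
  "('a :: {field, finite} \<Rightarrow> qbar) \<Rightarrow> nat \<Rightarrow> ('n :: finite \<Rightarrow> nat) \<Rightarrow> 'a \<Rightarrow> qbar" where
  "gauss_ratio_sum \<psi> d h y =
     (\<Sum>\<mu>\<in>mchars. (\<Prod>i\<in>UNIV. gauss \<psi> (char_pow \<mu> (h i))) / gauss_circ \<psi> (char_pow \<mu> d) * char_pow \<mu> d y)"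

text \<open>
  The product formula turns the upper parameters of index \<open>i\<close> into \<open>g((\<alpha>\<nu>)\<^bsup>h i\<^esup>)\<close> and the lower ones into
  \<open>g\<^sup>\<circ>(\<nu>\<^bsup>d\<^esup>)\<close>, up to factors that the argument absorbs. Removing \<open>\<alpha>\<close> on both sides multiplies the
  term of \<open>\<nu>\<close> by \<open>q\<close> if \<open>\<alpha>\<nu>\<close> is trivial, up to a common factor, and substituting
  \<open>\<mu> = \<alpha>\<nu>\<close> changes neither \<open>\<nu>\<^bsup>d\<^esup>\<close> nor the argument. The extra weight \<open>q\<close> of the trivial \<open>\<mu>\<close>
  produces the summand \<open>- 1 / q\<close>.
\<close>

lemma F_remove_eq:
  fixes \<psi> \<phi> :: "'a :: {field, finite} \<Rightarrow> qbar" and h w :: "'n :: finite \<Rightarrow> nat"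
  assumes ps: "nontrivial_additive_char \<psi>" and gen: "generates_mchars \<phi>"
    and d: "d \<ge> 1" "m < d" and h: "\<And>i. h i \<ge> 1" and dh: "\<And>i. d * h i dvd CARD('a) - 1"
    and w: "\<And>i. w i = m * h i mod d" and l: "l \<noteq> 0"
  defines "\<alpha> \<equiv> char_pow (root_char \<phi> d) m"
  shows "F_remove \<psi> \<phi> d h w \<alpha> l =
    of_nat CARD('a) ^ (1 - of_bool (m = 0)) / (\<Prod>i\<in>UNIV. gauss \<psi> (char_pow \<alpha> (h i))) *
    (gauss_ratio_sum \<psi> d h (of_nat d * l) / (1 - of_nat CARD('a)) - 1 / of_nat CARD('a))"
proof -
  note ph = generates_mcharsD[OF gen]
  define q :: qbar where "q = of_nat CARD('a)"
  have q0: "q \<noteq> 0" by (simp add: q_def)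
  have "q \<noteq> of_nat 1" unfolding q_def of_nat_eq_iff using card_ge_2[where ?'a='a] by simp
  hence q1: "1 - q \<noteq> 0" by simp
  have dq: "d dvd CARD('a) - 1" using dh by (rule dvd_mult_left)
  have hq: "h i dvd CARD('a) - 1" for i using dh[of i] by (rule dvd_mult_right)
  have al: "\<alpha> \<in> mchars" using ph by (simp add: \<alpha>_def)
  have al1: "\<alpha> = triv_char \<longleftrightarrow> m = 0"
    unfolding \<alpha>_def root_char_pow_triv_iff[OF gen dq] using d by (auto dest: dvd_imp_le)
  have ald: "char_pow \<alpha> d = triv_char"
    unfolding \<alpha>_def char_pow_mult root_char_pow_triv_iff[OF gen dq] by simp
  define A where "A = upper_params \<phi> d h w"
  define B where "B = lower_params \<phi> d"
  note Aeq = upper_params_eq[where h = h and w = w, OF gen dh w, folded A_def \<alpha>_def]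
  have "\<alpha> \<in># image_mset (\<lambda>k. char_mult \<alpha> (char_pow (root_char \<phi> (h i)) k)) (mset_set {..<h i})" for i
    using h[of i] al by (auto intro!: image_eqI[of _ _ 0])
  hence "\<alpha> \<in># A" unfolding Aeq by (subst set_mset_sum) auto
  hence Asplit: "A = add_mset \<alpha> (A - {#\<alpha>#})" by simp
  have "\<alpha> \<in># B" unfolding B_def lower_params_def \<alpha>_def using d by auto
  hence Bsplit: "B = add_mset \<alpha> (B - {#\<alpha>#})" by simp
  define G where "G \<mu> = (\<Prod>i\<in>UNIV. gauss \<psi> (char_pow \<mu> (h i))) / gauss_circ \<psi> (char_pow \<mu> d) * char_pow \<mu> d (of_nat d * l)" for \<mu>
  define g where "g = (\<Prod>i\<in>UNIV. gauss \<psi> (char_pow \<alpha> (h i)))"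
  have g0: "g \<noteq> 0" using al by (simp add: g_def gauss_nonzero[OF ps])
  define \<delta> where "\<delta> \<mu> = q ^ of_bool (\<mu> = triv_char)" for \<mu> :: "'a \<Rightarrow> qbar"
  have \<delta>0: "\<delta> \<mu> \<noteq> 0" for \<mu> using q0 by (simp add: \<delta>_def)
  have summand: "(\<Prod>\<beta>\<in>#A - {#\<alpha>#}. poch \<psi> \<beta> \<nu>) / (\<Prod>\<beta>\<in>#B - {#\<alpha>#}. poch_circ \<psi> \<beta> \<nu>) * \<nu> (F_arg d h l) =
      q / (\<delta> \<alpha> * g) * (\<delta> (char_mult \<alpha> \<nu>) * G (char_mult \<alpha> \<nu>))" if nu: "\<nu> \<in> mchars" for \<nu>
  proof -
    define \<mu> where "\<mu> = char_mult \<alpha> \<nu>"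
    have mu: "\<mu> \<in> mchars" by (simp add: \<mu>_def al nu)
    have mud: "char_pow \<mu> d = char_pow \<nu> d" using nu by (simp add: \<mu>_def char_pow_char_mult ald)
    have cancel: "b = c / a" if "a * b = c" "a \<noteq> 0" for a b c :: qbar using that by auto
    have p0: "poch \<psi> \<alpha> \<nu> \<noteq> 0" using gauss_nonzero[OF ps] al nu by (simp add: poch_def)
    have c0: "poch_circ \<psi> \<alpha> \<nu> \<noteq> 0" using gauss_circ_nonzero[OF ps] al nu by (simp add: poch_circ_def)
    have cp: "poch_circ \<psi> \<alpha> \<nu> = \<delta> \<mu> / \<delta> \<alpha> * poch \<psi> \<alpha> \<nu>"
      by (simp add: poch_circ_def poch_def gauss_circ_def \<delta>_def \<mu>_def q_def)
    have hn: "\<nu> (of_nat (h i)) \<noteq> 0" for i using of_nat_nonzero[OF hq] nu by (simp add: mcharsD)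
    have dn: "\<nu> (of_nat d) \<noteq> 0" using of_nat_nonzero[OF dq] nu by (simp add: mcharsD)
    have gc: "gauss_circ \<psi> (char_pow \<nu> d) \<noteq> 0" using gauss_circ_nonzero[OF ps] nu by simp
    have "(\<Prod>\<beta>\<in>#A. poch \<psi> \<beta> \<nu>) = (\<Prod>i\<in>UNIV. \<Prod>k<h i. poch \<psi> (char_mult \<alpha> (char_pow (root_char \<phi> (h i)) k)) \<nu>)"
    proof -
      have "(\<Prod>\<beta>\<in>#(\<Sum>i\<in>I. M i). poch \<psi> \<beta> \<nu>) = (\<Prod>i\<in>I. \<Prod>\<beta>\<in>#M i. poch \<psi> \<beta> \<nu>)" for I :: "'n set" and M
        by (induction I rule: infinite_finite_induct) simp_all
      thus ?thesis unfolding Aeq by (simp add: multiset.map_comp comp_def prod_unfold_prod_mset)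
    qed
    also have "\<dots> = (\<Prod>i\<in>UNIV. gauss \<psi> (char_pow \<mu> (h i)) / gauss \<psi> (char_pow \<alpha> (h i)) / \<nu> (of_nat (h i)) ^ h i)"
      unfolding \<mu>_def by (intro prod.cong refl prod_poch_upper[OF ps gen hq al nu])
    also have "\<dots> = (\<Prod>i\<in>UNIV. gauss \<psi> (char_pow \<mu> (h i))) / g / (\<Prod>i\<in>UNIV. \<nu> (of_nat (h i)) ^ h i)"
      by (simp add: prod_dividef prod.distrib g_def)
    finally have PA': "(\<Prod>\<beta>\<in>#A. poch \<psi> \<beta> \<nu>) =
       (\<Prod>i\<in>UNIV. gauss \<psi> (char_pow \<mu> (h i))) / g / (\<Prod>i\<in>UNIV. \<nu> (of_nat (h i)) ^ h i)" .
    have "(\<Prod>\<beta>\<in>#A. poch \<psi> \<beta> \<nu>) = poch \<psi> \<alpha> \<nu> * (\<Prod>\<beta>\<in>#A - {#\<alpha>#}. poch \<psi> \<beta> \<nu>)"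
      by (subst (1) Asplit) simp
    from cancel[OF trans[OF this [symmetric] PA'] p0] have PA: "(\<Prod>\<beta>\<in>#A - {#\<alpha>#}. poch \<psi> \<beta> \<nu>) =
       (\<Prod>i\<in>UNIV. gauss \<psi> (char_pow \<mu> (h i))) / g / (\<Prod>i\<in>UNIV. \<nu> (of_nat (h i)) ^ h i) / poch \<psi> \<alpha> \<nu>" .
    have "(\<Prod>\<beta>\<in>#B. poch_circ \<psi> \<beta> \<nu>) = poch_circ \<psi> \<alpha> \<nu> * (\<Prod>\<beta>\<in>#B - {#\<alpha>#}. poch_circ \<psi> \<beta> \<nu>)"
      by (subst (1) Bsplit) simp
    note trans[OF this [symmetric] prod_poch_circ_lower[OF ps gen dq nu, folded B_def q_def]]
    from cancel[OF this c0] have PB: "(\<Prod>\<beta>\<in>#B - {#\<alpha>#}. poch_circ \<psi> \<beta> \<nu>) =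
       gauss_circ \<psi> (char_pow \<nu> d) / \<nu> (of_nat d) ^ d / q / poch_circ \<psi> \<alpha> \<nu>" .
    have arg: "\<nu> (F_arg d h l) = (\<Prod>i\<in>UNIV. \<nu> (of_nat (h i)) ^ h i) * \<nu> l ^ d"
      using nu by (simp add: F_arg_def mcharsD mchars_prod mchars_power)
    have cpd: "char_pow \<nu> d (of_nat d * l) = \<nu> (of_nat d) ^ d * \<nu> l ^ d"
      using l of_nat_nonzero[OF dq] nu by (simp add: char_pow_def mcharsD power_mult_distrib)
    have hp: "(\<Prod>i\<in>UNIV. \<nu> (of_nat (h i)) ^ h i) \<noteq> 0" using hn by simp
    have field_identity: "a / e / u / p / (b / c ^ d / k / (x / y * p)) * (u * v) = k / (y * e) * (x * (a / b * (c ^ d * v)))"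
      if "p \<noteq> 0" "b \<noteq> 0" "c \<noteq> 0" "u \<noteq> 0" "x \<noteq> 0" "y \<noteq> 0" "k \<noteq> 0" "e \<noteq> 0"
      for a e u p b c k x y v :: qbar
      using that by (simp add: field_simps)
    show ?thesis
      unfolding PA PB arg cp G_def \<mu>_def [symmetric] mud cpd
      by (rule field_identity[OF p0 gc dn hp \<delta>0 \<delta>0 q0 g0])
  qed
  have bij: "bij_betw (char_mult \<alpha>) mchars mchars"
  proof (rule bij_betw_byWitness[where f' = "char_mult (char_pow \<alpha> (d - 1))"])
    have a: "char_mult (char_pow \<alpha> (d - 1)) \<alpha> = triv_char"
      using char_pow_add[of \<alpha> "d - 1" 1] d al ald by simp
    show "\<forall>\<nu>\<in>mchars. char_mult (char_pow \<alpha> (d - 1)) (char_mult \<alpha> \<nu>) = \<nu>"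
      by (simp add: char_mult_assoc [symmetric] a del: One_nat_def)
    show "\<forall>\<nu>\<in>mchars. char_mult \<alpha> (char_mult (char_pow \<alpha> (d - 1)) \<nu>) = \<nu>"
      by (simp add: char_mult_assoc [symmetric] char_mult_commute[of \<alpha>] a del: One_nat_def)
  qed (auto simp: al)
  have Gt: "G triv_char = 1 / q"
    using ps l of_nat_nonzero[OF dq] by (simp add: G_def gauss_circ_def q_def)
  have "(\<Sum>\<mu>\<in>mchars. \<delta> \<mu> * G \<mu>) = \<delta> triv_char * G triv_char + (\<Sum>\<mu>\<in>mchars - {triv_char}. \<delta> \<mu> * G \<mu>)"
    by (rule sum.remove) (simp_all add: finite_mchars[OF gen])
  also have "(\<Sum>\<mu>\<in>mchars - {triv_char}. \<delta> \<mu> * G \<mu>) = (\<Sum>\<mu>\<in>mchars - {triv_char}. G \<mu>)"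
    by (intro sum.cong refl) (simp add: \<delta>_def)
  also have "\<dots> = (\<Sum>\<mu>\<in>mchars. G \<mu>) - G triv_char"
    by (subst sum.remove[of mchars triv_char]) (simp_all add: finite_mchars[OF gen])
  finally have S: "(\<Sum>\<mu>\<in>mchars. \<delta> \<mu> * G \<mu>) = (\<Sum>\<mu>\<in>mchars. G \<mu>) + (1 - 1 / q)"
    using q0 by (simp add: Gt \<delta>_def)
  have "F_remove \<psi> \<phi> d h w \<alpha> l = 1 / (1 - q) * (\<Sum>\<nu>\<in>mchars. q / (\<delta> \<alpha> * g) * (\<delta> (char_mult \<alpha> \<nu>) * G (char_mult \<alpha> \<nu>)))"
    unfolding F_remove_def hyp_F_def A_def [symmetric] B_def [symmetric] q_def [symmetric]
    by (intro arg_cong[where f = "\<lambda>x. 1 / (1 - q) * x"] sum.cong refl summand)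
  also have "\<dots> = q / (\<delta> \<alpha> * g) * ((\<Sum>\<nu>\<in>mchars. \<delta> (char_mult \<alpha> \<nu>) * G (char_mult \<alpha> \<nu>)) / (1 - q))"
    unfolding sum_distrib_left [symmetric] by simp
  also have "(\<Sum>\<nu>\<in>mchars. \<delta> (char_mult \<alpha> \<nu>) * G (char_mult \<alpha> \<nu>)) = (\<Sum>\<mu>\<in>mchars. \<delta> \<mu> * G \<mu>)"
    by (rule sum.reindex_bij_betw[OF bij])
  also have "q / (\<delta> \<alpha> * g) = q ^ (1 - of_bool (m = 0)) / g"
    using q0 by (cases "m = 0") (simp_all add: \<delta>_def al1)
  also have "(\<Sum>\<mu>\<in>mchars. \<delta> \<mu> * G \<mu>) / (1 - q) = (\<Sum>\<mu>\<in>mchars. G \<mu>) / (1 - q) - 1 / q"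
    unfolding S using q0 q1 by (simp add: field_simps)
  finally show ?thesis by (simp only: q_def g_def G_def gauss_ratio_sum_def)
qed

lemma char_prod_char_pow:
  "char_prod (\<lambda>i :: 'n :: finite. char_pow \<nu> (h i)) = char_pow \<nu> (\<Sum>i\<in>UNIV. h i)"
  by (auto simp: char_prod_def char_pow_def fun_eq_iff power_sum)

text \<open>
  Orthogonality detects the monomial equation, and each character contributes a Jacobi sum.
\<close>

lemma card_torus_section:
  fixes \<psi> \<phi> :: "'a :: {field, finite} \<Rightarrow> qbar" and h :: "'n :: finite \<Rightarrow> nat"
  assumes ps: "nontrivial_additive_char \<psi>" and gen: "generates_mchars \<phi>"
    and h: "\<And>i. h i \<ge> 1" and d: "(\<Sum>i\<in>UNIV. h i) = d" and g: "Gcd (insert d (range h)) = 1" and y: "y \<noteq> 0"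
  shows "of_nat (card {t :: 'n \<Rightarrow> 'a. (\<forall>i. t i \<noteq> 0) \<and> (\<Prod>i\<in>UNIV. t i ^ h i) = 1 \<and> (\<Sum>i\<in>UNIV. t i) = y}) =
    (- 1) ^ (CARD('n) - 1) / (of_nat CARD('a) - 1) *
    (gauss_ratio_sum \<psi> d h y - (1 - of_nat CARD('a)) ^ CARD('n) / of_nat CARD('a))"
proof -
  note ph = generates_mcharsD[OF gen]
  define q :: qbar where "q = of_nat CARD('a)"
  have "q \<noteq> of_nat 1" unfolding q_def of_nat_eq_iff using card_ge_2[where ?'a='a] by simp
  hence q1: "q - 1 \<noteq> 0" by simp
  let ?A = "{t :: 'n \<Rightarrow> 'a. (\<forall>i. t i \<noteq> 0) \<and> (\<Sum>i\<in>UNIV. t i) = y}"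
  let ?M = "{t :: 'n \<Rightarrow> 'a. (\<forall>i. t i \<noteq> 0) \<and> (\<Prod>i\<in>UNIV. t i ^ h i) = 1 \<and> (\<Sum>i\<in>UNIV. t i) = y}"
  have "(q - 1) * of_nat (card ?M) = (\<Sum>t\<in>?M. q - 1)" by simp
  also have "\<dots> = (\<Sum>t\<in>{t \<in> ?A. (\<Prod>i\<in>UNIV. t i ^ h i) = 1}. q - 1)" by (rule sum.cong) auto
  also have "\<dots> = (\<Sum>t\<in>?A. if (\<Prod>i\<in>UNIV. t i ^ h i) = 1 then q - 1 else 0)" by (subst sum.inter_filter) simp_all
  also have "\<dots> = (\<Sum>t\<in>?A. \<Sum>\<nu>\<in>mchars. \<nu> (\<Prod>i\<in>UNIV. t i ^ h i))"
    by (intro sum.cong refl, subst sum_over_mchars[OF gen]) (auto simp: q_def of_nat_card_minus_1 simp del: One_nat_def)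
  also have "\<dots> = (\<Sum>\<nu>\<in>mchars. \<Sum>t\<in>?A. \<nu> (\<Prod>i\<in>UNIV. t i ^ h i))" by (rule sum.swap)
  also have "\<dots> = (\<Sum>\<nu>\<in>mchars. level_sum (\<lambda>i. char_pow \<nu> (h i)) y)"
    unfolding level_sum_def
    by (intro sum.cong refl) (simp add: mchars_prod mchars_power char_pow_def)
  also have "\<dots> = (\<Sum>\<nu>\<in>mchars. (- 1) ^ (CARD('n) - 1) *
      ((\<Prod>i\<in>UNIV. gauss \<psi> (char_pow \<nu> (h i))) / gauss_circ \<psi> (char_pow \<nu> d) * char_pow \<nu> d y
       - (if \<nu> = triv_char then (1 - q) ^ CARD('n) / q else 0)))"
  proof (intro sum.cong refl)
    fix \<nu> :: "'a \<Rightarrow> qbar" assume nu: "\<nu> \<in> mchars"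
    let ?\<eta> = "\<lambda>i. char_pow \<nu> (h i)"
    have cp: "char_prod ?\<eta> = char_pow \<nu> d" using char_prod_char_pow[of \<nu> h] d by simp
    have tr: "(\<forall>i. ?\<eta> i = triv_char) \<longleftrightarrow> \<nu> = triv_char"
    proof
      assume a: "\<forall>i. ?\<eta> i = triv_char"
      obtain k where k: "\<nu> = char_pow \<phi> k" using gen nu by (auto simp: generates_mchars_def)
      have "(CARD('a) - 1) dvd k * h i" for i using a unfolding k char_pow_mult char_pow_generator_triv_iff[OF gen] by blast
      hence "(CARD('a) - 1) dvd k" by (rule dvd_of_dvd_all_mult[OF g d])
      thus "\<nu> = triv_char" unfolding k char_pow_generator_triv_iff[OF gen] .
    qed simp
    have "level_sum ?\<eta> 1 = (- 1) ^ (CARD('n) - 1) * jacobi ?\<eta>"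
      by (simp add: jacobi_level_sum flip: mult.assoc power_add)
    also have "jacobi ?\<eta> = (\<Prod>i\<in>UNIV. gauss \<psi> (?\<eta> i)) / gauss_circ \<psi> (char_pow \<nu> d)
      - (if \<nu> = triv_char then (1 - q) ^ CARD('n) / q else 0)"
      using jacobi_gauss[OF ps, of ?\<eta>] nu by (simp only: cp tr q_def char_pow_mchars simp_thms)
    finally have l1: "level_sum ?\<eta> 1 = (- 1) ^ (CARD('n) - 1) * ((\<Prod>i\<in>UNIV. gauss \<psi> (?\<eta> i)) / gauss_circ \<psi> (char_pow \<nu> d)
      - (if \<nu> = triv_char then (1 - q) ^ CARD('n) / q else 0))" .
    have "level_sum ?\<eta> y = char_pow \<nu> d y * level_sum ?\<eta> 1"
      using level_sum_scale[of ?\<eta> y] nu y by (simp add: cp)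
    also have "\<dots> = (- 1) ^ (CARD('n) - 1) *
      ((\<Prod>i\<in>UNIV. gauss \<psi> (?\<eta> i)) / gauss_circ \<psi> (char_pow \<nu> d) * char_pow \<nu> d y
       - (if \<nu> = triv_char then (1 - q) ^ CARD('n) / q else 0))"
      unfolding l1 using y by (cases "\<nu> = triv_char") (simp_all add: algebra_simps)
    finally show "level_sum ?\<eta> y = \<dots>" .
  qed
  also have "\<dots> = (- 1) ^ (CARD('n) - 1) * (gauss_ratio_sum \<psi> d h y - (1 - q) ^ CARD('n) / q)"
    by (simp add: gauss_ratio_sum_def sum_subtractf finite_mchars[OF gen] flip: sum_distrib_left)
  finally show ?thesis using q1 by (simp add: q_def field_simps)
qed

lemma jacobi_pow_mod:
  fixes \<phi> :: "'a :: {field, finite} \<Rightarrow> qbar"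
  assumes "generates_mchars \<phi>" "d dvd CARD('a) - 1"
  shows "jacobi_pow \<phi> d (\<lambda>i. w i mod d) = jacobi_pow \<phi> d w"
proof -
  have "char_pow (root_char \<phi> d) (w i mod d) = char_pow (root_char \<phi> d) (w i)" for i
    by (simp add: root_char_pow_eq_iff[OF assms])
  thus ?thesis by (simp add: jacobi_pow_def)
qed

text \<open>
  For \<open>m\<close> nonzero the Jacobi sum is \<open>\<Prod>i. g(\<alpha>\<^bsup>h i\<^esup>)\<close> divided by \<open>q\<close>, which cancels the only factor in
  \<open>F_remove_eq\<close> that depends on \<open>m\<close>; for \<open>m = 0\<close> that factor is \<open>1\<close>.
\<close>

lemma jacobi_F_remove:
  fixes \<psi> \<phi> :: "'a :: {field, finite} \<Rightarrow> qbar" and h w :: "'n :: finite \<Rightarrow> nat"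
  assumes ps: "nontrivial_additive_char \<psi>" and gen: "generates_mchars \<phi>"
    and h: "\<And>i. h i \<ge> 1" and dh: "\<And>i. d * h i dvd CARD('a) - 1"
    and d: "(\<Sum>i\<in>UNIV. h i) = d" and g: "Gcd (insert d (range h)) = 1"
    and w: "\<And>i. w i = m * h i mod d" and m: "m < d" and l: "l \<noteq> 0"
  shows "jacobi_pow \<phi> d w ^ (1 - of_bool (m = 0)) * F_remove \<psi> \<phi> d h w (char_pow (root_char \<phi> d) m) l =
    gauss_ratio_sum \<psi> d h (of_nat d * l) / (1 - of_nat CARD('a)) - 1 / of_nat CARD('a)"
proof -
  note ph = generates_mcharsD[OF gen]
  define q :: qbar where "q = of_nat CARD('a)"
  have q0: "q \<noteq> 0" by (simp add: q_def)
  have dq: "d dvd CARD('a) - 1" using dh by (rule dvd_mult_left)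
  define \<alpha> where "\<alpha> = char_pow (root_char \<phi> d) m"
  have al: "\<alpha> \<in> mchars" using ph by (simp add: \<alpha>_def)
  define G where "G = (\<Prod>i\<in>UNIV. gauss \<psi> (char_pow \<alpha> (h i)))"
  have G0: "G \<noteq> 0" using al by (simp add: G_def gauss_nonzero[OF ps])
  have F: "F_remove \<psi> \<phi> d h w \<alpha> l = q ^ (1 - of_bool (m = 0)) / G *
      (gauss_ratio_sum \<psi> d h (of_nat d * l) / (1 - q) - 1 / q)"
    unfolding \<alpha>_def G_def q_def using m by (intro F_remove_eq ps gen h dh w l) simp_all
  have "jacobi_pow \<phi> d w ^ (1 - of_bool (m = 0)) * (q ^ (1 - of_bool (m = 0)) / G) = 1"
  proof (cases "m = 0")
    case True
    thus ?thesis using ps by (simp add: G_def \<alpha>_def)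
  next
    case False
    let ?\<eta> = "\<lambda>i. char_pow \<alpha> (h i)"
    have "w = (\<lambda>i. m * h i mod d)" using w by auto
    hence "jacobi_pow \<phi> d w = jacobi ?\<eta>"
      using jacobi_pow_mod[OF gen dq, of "\<lambda>i. m * h i"] by (simp add: jacobi_pow_def \<alpha>_def char_pow_mult)
    also have "\<dots> = G / q"
    proof -
      have "char_prod ?\<eta> = char_pow \<alpha> d" by (simp add: char_prod_char_pow d)
      hence "char_prod ?\<eta> = triv_char"
        by (simp add: \<alpha>_def char_pow_mult root_char_pow_triv_iff[OF gen dq])
      moreover have nt: "\<not> (\<forall>i. ?\<eta> i = triv_char)"
      proof
        assume "\<forall>i. ?\<eta> i = triv_char"
        hence "d dvd m * h i" for i unfolding \<alpha>_def char_pow_mult root_char_pow_triv_iff[OF gen dq] by blast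
        hence "d dvd m" by (rule dvd_of_dvd_all_mult[OF g d])
        thus False using m False by (auto dest: dvd_imp_le)
      qed
      ultimately show ?thesis
        using jacobi_gauss[OF ps, of ?\<eta>] al ps unfolding if_not_P[OF nt] by (simp add: G_def gauss_circ_def q_def)
    qed
    finally show ?thesis using False q0 G0 by simp
  qed
  thus ?thesis unfolding \<alpha>_def [symmetric] F q_def [symmetric] by (simp only: mult.assoc [symmetric] mult_1)
qed

section \<open>Characters of the group of roots of unity\<close>

definition root_vectors :: "nat \<Rightarrow> ('n \<Rightarrow> 'a :: field) set" where
  "root_vectors d = {\<xi>. \<forall>i. \<xi> i ^ d = 1}"

lemma sum_over_roots_of_unity:
  fixes \<phi> :: "'a :: {field, finite} \<Rightarrow> qbar"
  assumes gen: "generates_mchars \<phi>" and n: "n dvd CARD('a) - 1"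
  shows "(\<Sum>\<zeta>\<in>{\<zeta>. \<zeta> ^ n = 1}. \<phi> \<zeta> ^ a) = (if n dvd a then of_nat n else 0)"
proof -
  note ph = generates_mcharsD[OF gen]
  show ?thesis
  proof (cases "n dvd a")
    case True
    then obtain b where b: "a = n * b" by (rule dvdE)
    have "(\<Sum>\<zeta>\<in>{\<zeta>. \<zeta> ^ n = 1}. \<phi> \<zeta> ^ a) = (\<Sum>\<zeta>\<in>{\<zeta> :: 'a. \<zeta> ^ n = 1}. 1)"
      by (intro sum.cong refl) (simp add: b power_mult mcharsD[OF ph] flip: mchars_power[OF ph])
    thus ?thesis using True card_roots_of_unity[OF n] by simp
  next
    case False
    obtain g :: 'a where g: "g \<noteq> 0" "\<And>x. x \<noteq> 0 \<Longrightarrow> \<exists>k. x = g ^ k" by (rule ex_generator) blast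
    obtain m where m: "CARD('a) - 1 = n * m" using n by (rule dvdE)
    have pos: "n > 0" "m > 0" using m card_ge_2[where ?'a='a] by (auto intro!: Nat.gr0I)
    define z where "z = g ^ m"
    have zn: "z ^ n = 1" using power_card_minus_1[OF g(1)] unfolding m by (simp add: z_def mult.commute flip: power_mult)
    have z0: "z \<noteq> 0" using g by (simp add: z_def)
    have za: "\<phi> z ^ a \<noteq> 1"
    proof
      assume "\<phi> z ^ a = 1"
      hence "\<phi> (z ^ a) = 1" by (simp add: mchars_power[OF ph])
      hence "g ^ (m * a) = 1" by (simp add: generator_eq_1_iff[OF gen] z_def power_mult)
      moreover have "g ^ (m * a) = 1 \<longleftrightarrow> (CARD('a) - 1) dvd m * a"
        by (rule generator_power_eq_1_iff) (use g in auto)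
      ultimately have "n * m dvd m * a" by (simp only: m)
      thus False using False pos by (simp add: mult.commute)
    qed
    have "(\<Sum>\<zeta>\<in>{\<zeta>. \<zeta> ^ n = 1}. \<phi> \<zeta> ^ a) = (\<Sum>\<zeta>\<in>{\<zeta>. \<zeta> ^ n = 1}. \<phi> (z * \<zeta>) ^ a)"
      by (rule sum.reindex_bij_witness[of _ "\<lambda>x. z * x" "\<lambda>x. x / z"])
         (use zn z0 in \<open>auto simp: power_mult_distrib power_divide\<close>)
    also have "\<dots> = \<phi> z ^ a * (\<Sum>\<zeta>\<in>{\<zeta>. \<zeta> ^ n = 1}. \<phi> \<zeta> ^ a)"
      by (simp add: mcharsD[OF ph] power_mult_distrib sum_distrib_left)
    finally show ?thesis using za False by (simp add: mult_cancel_right1)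
  qed
qed

lemma sum_powers_root_of_unity:
  fixes \<phi> :: "'a :: {field, finite} \<Rightarrow> qbar"
  assumes gen: "generates_mchars \<phi>" and x: "x ^ d = 1"
  shows "(\<Sum>k<d. \<phi> x ^ k) = (if x = 1 then of_nat d else 0)"
proof (cases "x = 1")
  case True thus ?thesis using generates_mcharsD[OF gen] by (simp add: mcharsD)
next
  case False
  note ph = generates_mcharsD[OF gen]
  have "\<phi> x ^ d = 1" using x by (simp add: mcharsD[OF ph] flip: mchars_power[OF ph])
  hence "(\<phi> x - 1) * (\<Sum>k<d. \<phi> x ^ k) = 0" by (simp flip: power_diff_1_eq)
  thus ?thesis using False generator_eq_1_iff[OF gen, of x] by simp
qed

lemma weight_power_one:
  fixes \<xi> :: "'n :: finite \<Rightarrow> 'a :: field"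
  assumes "\<xi> \<in> root_vectors d"
  shows "(\<Prod>i\<in>UNIV. \<xi> i ^ h i) ^ d = 1"
proof -
  have "(\<xi> i ^ h i) ^ d = (\<xi> i ^ d) ^ h i" for i by (simp add: mult.commute flip: power_mult)
  thus ?thesis using assms by (simp add: prod_power_distrib root_vectors_def)
qed

text \<open>
  The condition that the weighted product of \<open>\<xi>\<close> equals \<open>\<epsilon>\<close> is detected by the \<open>d\<close> characters of the
  group of \<open>d\<close>th roots of unity.
\<close>

lemma weight_fibre_sum:
  fixes \<phi> :: "'a :: {field, finite} \<Rightarrow> qbar" and h :: "'n :: finite \<Rightarrow> nat"
  assumes gen: "generates_mchars \<phi>" and d: "d dvd CARD('a) - 1" and \<epsilon>: "\<epsilon> ^ d = 1"
  shows "of_nat d * (\<Sum>\<xi>\<in>{\<xi> \<in> root_vectors d. (\<Prod>i\<in>UNIV. \<xi> i ^ h i) = \<epsilon>}. f \<xi>) =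
    (\<Sum>k<d. inverse (\<phi> \<epsilon>) ^ k * (\<Sum>\<xi>\<in>root_vectors d. (\<Prod>i\<in>UNIV. \<phi> (\<xi> i) ^ (k * h i)) * f \<xi>))"
proof -
  note ph = generates_mcharsD[OF gen]
  have \<epsilon>0: "\<epsilon> \<noteq> 0" using \<epsilon> dvd_card_pos[OF d] by (auto simp: power_0_left)
  have ind: "(\<Sum>k<d. inverse (\<phi> \<epsilon>) ^ k * (\<Prod>i\<in>UNIV. \<phi> (\<xi> i) ^ (k * h i))) =
      (if (\<Prod>i\<in>UNIV. \<xi> i ^ h i) = \<epsilon> then of_nat d else 0)"
    if "\<xi> \<in> root_vectors d" for \<xi> :: "'n \<Rightarrow> 'a"
  proof -
    have "((\<Prod>i\<in>UNIV. \<xi> i ^ h i) / \<epsilon>) ^ d = 1" by (simp add: power_divide \<epsilon> weight_power_one[OF that])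
    from sum_powers_root_of_unity[OF gen this]
    have "(\<Sum>k<d. \<phi> ((\<Prod>i\<in>UNIV. \<xi> i ^ h i) / \<epsilon>) ^ k) = (if (\<Prod>i\<in>UNIV. \<xi> i ^ h i) = \<epsilon> then of_nat d else 0)"
      using \<epsilon>0 by simp
    moreover have "\<phi> ((\<Prod>i\<in>UNIV. \<xi> i ^ h i) / \<epsilon>) ^ k = inverse (\<phi> \<epsilon>) ^ k * (\<Prod>i\<in>UNIV. \<phi> (\<xi> i) ^ (k * h i))" for k
      by (simp add: mcharsD(3)[OF ph] mchars_inverse[OF ph] mchars_prod[OF ph] mchars_power[OF ph] divide_inverse
          power_mult_distrib prod_power_distrib mult.commute flip: power_mult)
    ultimately show ?thesis by simp
  qed
  have "of_nat d * (\<Sum>\<xi>\<in>{\<xi> \<in> root_vectors d. (\<Prod>i\<in>UNIV. \<xi> i ^ h i) = \<epsilon>}. f \<xi>) =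
    (\<Sum>\<xi>\<in>root_vectors d. if (\<Prod>i\<in>UNIV. \<xi> i ^ h i) = \<epsilon> then of_nat d * f \<xi> else 0)"
    by (subst sum.inter_filter [symmetric]) (simp_all add: sum_distrib_left)
  also have "\<dots> = (\<Sum>\<xi>\<in>root_vectors d. \<Sum>k<d. inverse (\<phi> \<epsilon>) ^ k * (\<Prod>i\<in>UNIV. \<phi> (\<xi> i) ^ (k * h i)) * f \<xi>)"
    by (intro sum.cong refl) (simp add: ind flip: sum_distrib_right)
  also have "\<dots> = (\<Sum>k<d. \<Sum>\<xi>\<in>root_vectors d. inverse (\<phi> \<epsilon>) ^ k * (\<Prod>i\<in>UNIV. \<phi> (\<xi> i) ^ (k * h i)) * f \<xi>)"
    by (rule sum.swap)
  finally show ?thesis by (simp only: sum_distrib_left mult.assoc)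
qed

lemma sum_char_over_weight_fibre:
  fixes \<phi> :: "'a :: {field, finite} \<Rightarrow> qbar" and h a :: "'n :: finite \<Rightarrow> nat"
  assumes gen: "generates_mchars \<phi>" and d: "d dvd CARD('a) - 1" and \<epsilon>: "\<epsilon> ^ d = 1"
  shows "of_nat d * (\<Sum>\<xi>\<in>{\<xi> \<in> root_vectors d. (\<Prod>i\<in>UNIV. \<xi> i ^ h i) = \<epsilon>}. \<phi> (\<Prod>i\<in>UNIV. \<xi> i ^ a i)) =
    (\<Sum>k<d. inverse (\<phi> \<epsilon>) ^ k * (if \<forall>i. d dvd a i + k * h i then of_nat d ^ CARD('n) else 0))"
proof -
  note ph = generates_mcharsD[OF gen]
  have "(\<Sum>\<xi>\<in>root_vectors d. (\<Prod>i\<in>UNIV. \<phi> (\<xi> i) ^ (k * h i)) * \<phi> (\<Prod>i\<in>UNIV. \<xi> i ^ a i)) =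
      (if \<forall>i. d dvd a i + k * h i then of_nat d ^ CARD('n) else 0)" for k
  proof -
    have "(\<Sum>\<xi>\<in>root_vectors d. (\<Prod>i\<in>UNIV. \<phi> (\<xi> i) ^ (k * h i)) * \<phi> (\<Prod>i\<in>UNIV. \<xi> i ^ a i)) =
        (\<Prod>i\<in>UNIV. \<Sum>\<zeta>\<in>{\<zeta>. \<zeta> ^ d = 1}. \<phi> \<zeta> ^ (a i + k * h i))"
      by (subst prod_sum_fun) (simp_all add: root_vectors_def mchars_prod[OF ph] mchars_power[OF ph] power_add
          prod.distrib mult.commute)
    thus ?thesis unfolding sum_over_roots_of_unity[OF gen d] by auto
  qed
  thus ?thesis unfolding weight_fibre_sum[OF gen d \<epsilon>] by simp
qed

text \<open>
  By the gcd condition only the trivial character contributes. In particular all fibres over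
  \<open>d\<close>th roots of unity are nonempty and of the same size.
\<close>

lemma card_weight_fibre:
  fixes h :: "'n :: finite \<Rightarrow> nat" and \<phi> :: "'a :: {field, finite} \<Rightarrow> qbar"
  assumes gen: "generates_mchars \<phi>" and d: "d dvd CARD('a) - 1" and \<epsilon>: "(\<epsilon> :: 'a) ^ d = 1"
    and s: "(\<Sum>i\<in>UNIV. h i) = d" and g: "Gcd (insert d (range h)) = 1"
  shows "card {\<xi> \<in> root_vectors d. (\<Prod>i\<in>UNIV. \<xi> i ^ h i) = \<epsilon>} = d ^ (CARD('n) - 1)"
proof -
  note ph = generates_mcharsD[OF gen]
  have d0: "d > 0" using d by (rule dvd_card_pos)
  let ?S = "{\<xi> \<in> root_vectors d. (\<Prod>i\<in>UNIV. \<xi> i ^ h i) = \<epsilon>}"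
  have iff: "(\<forall>i. d dvd k * h i) \<longleftrightarrow> k = 0" if "k < d" for k
  proof
    assume "\<forall>i. d dvd k * h i"
    hence "d dvd k" using dvd_of_dvd_all_mult[OF g s] by blast
    thus "k = 0" using that by (auto dest: dvd_imp_le)
  qed simp
  have "(of_nat (d * card ?S) :: qbar) = of_nat d * (\<Sum>\<xi>\<in>?S. \<phi> (\<Prod>i\<in>UNIV. \<xi> i ^ 0))"
    by (simp add: mcharsD[OF ph])
  also have "\<dots> = (\<Sum>k<d. inverse (\<phi> \<epsilon>) ^ k * (if k = 0 then of_nat d ^ CARD('n) else 0))"
    unfolding sum_char_over_weight_fibre[where a = "\<lambda>_. 0", OF gen d \<epsilon>] by (intro sum.cong refl) (simp add: iff)
  also have "\<dots> = (\<Sum>k<d. if k = 0 then of_nat d ^ CARD('n) else 0)" by (intro sum.cong refl) auto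
  also have "\<dots> = of_nat (d ^ CARD('n))" using d0 by simp
  finally have "d * card ?S = d ^ CARD('n)" by (simp only: of_nat_eq_iff)
  also have "\<dots> = d * d ^ (CARD('n) - 1)"
    using zero_less_card_finite[where ?'a='n] by (metis Suc_diff_1 power_Suc)
  finally show ?thesis using d0 by simp
qed

text \<open>
  Duality: a character that is trivial on the kernel of the weighted product is a power of it.
  Otherwise no \<open>k\<close> would contribute to \<open>sum_char_over_weight_fibre\<close>, but the sum is the
  nonzero number of elements of the kernel.
\<close>

lemma trivial_on_kernel:
  fixes h w :: "'n :: finite \<Rightarrow> nat" and \<phi> :: "'a :: {field, finite} \<Rightarrow> qbar"
  assumes gen: "generates_mchars \<phi>" and d: "d dvd CARD('a) - 1"
    and w: "\<And>i. w i < d"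
    and triv: "\<And>\<xi> :: 'n \<Rightarrow> 'a. \<xi> \<in> root_vectors d \<Longrightarrow> (\<Prod>i\<in>UNIV. \<xi> i ^ h i) = 1 \<Longrightarrow> \<phi> (\<Prod>i\<in>UNIV. \<xi> i ^ w i) = 1"
  shows "\<exists>k<d. \<forall>i. w i = k * h i mod d"
proof -
  note ph = generates_mcharsD[OF gen]
  have d0: "d > 0" using d by (rule dvd_card_pos)
  let ?S = "{\<xi> :: 'n \<Rightarrow> 'a. \<xi> \<in> root_vectors d \<and> (\<Prod>i\<in>UNIV. \<xi> i ^ h i) = 1}"
  have "(\<lambda>_. 1) \<in> ?S" by (simp add: root_vectors_def)
  hence "{\<lambda>_. 1} \<subseteq> ?S" by blast
  hence "card {\<lambda>_ :: 'n. 1 :: 'a} \<le> card ?S" by (intro card_mono) simp_all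
  moreover have "card {\<lambda>_ :: 'n. 1 :: 'a} = 1" by simp
  ultimately have c0: "card ?S \<noteq> 0" by linarith
  have "(\<Sum>\<xi>\<in>?S. \<phi> (\<Prod>i\<in>UNIV. \<xi> i ^ w i)) = (\<Sum>\<xi>\<in>?S. 1)"
    by (intro sum.cong refl) (simp add: triv)
  hence "of_nat d * (\<Sum>\<xi>\<in>?S. \<phi> (\<Prod>i\<in>UNIV. \<xi> i ^ w i)) \<noteq> 0"
    using d0 c0 by (simp del: card_eq_0_iff card_0_eq)
  hence "(\<Sum>k<d. inverse (\<phi> 1) ^ k * (if \<forall>i. d dvd w i + k * h i then of_nat d ^ CARD('n) else 0)) \<noteq> 0"
    by (subst (asm) sum_char_over_weight_fibre[OF gen d]) simp_all
  then obtain k where k': "k \<in> {..<d}"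
      "inverse (\<phi> 1) ^ k * (if \<forall>i. d dvd w i + k * h i then of_nat d ^ CARD('n) else 0) \<noteq> 0"
    by (rule sum.not_neutral_contains_not_neutral)
  hence k: "k < d" "\<forall>i. d dvd w i + k * h i" by (auto split: if_splits)
  \<comment> \<open>\<open>k = 0\<close> is possible here, hence the outer reduction\<close>
  show ?thesis
  proof (intro exI[of _ "(d - k) mod d"] conjI allI)
    fix i
    have "(d - k) * h i mod d = ((w i + k * h i) + (d - k) * h i) mod d" using k(2) by (metis mod_add_left_eq dvd_imp_mod_0 add_0)
    also have "(w i + k * h i) + (d - k) * h i = w i + d * h i" using k(1) by (simp add: add_mult_distrib [symmetric] add.assoc)
    also have "\<dots> mod d = w i" using w by simp
    finally show "w i = (d - k) mod d * h i mod d" by (simp add: mod_mult_left_eq)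
  qed (use d0 in simp)
qed


section \<open>The group action\<close>

lemma G_tilde_simps [simp]:
  "carrier (G_tilde d h) = {\<xi> \<in> root_vectors d. (\<Prod>i\<in>UNIV. \<xi> i ^ h i) = 1}"
  "x \<otimes>\<^bsub>G_tilde d h\<^esub> y = (\<lambda>i. x i * y i)" "\<one>\<^bsub>G_tilde d h\<^esub> = (\<lambda>_. 1)"
  by (auto simp: G_tilde_def root_vectors_def)

lemma prod_inverse_power: "(\<Prod>i\<in>A. inverse (x i) ^ h i) = inverse (\<Prod>i\<in>A. x i ^ h i)" for x :: "'n \<Rightarrow> 'k :: field"
  by (induction A rule: infinite_finite_induct) (simp_all add: power_inverse)

lemma G_tilde_comm_group: "comm_group (G_tilde d h :: ('n :: finite \<Rightarrow> 'a :: {field, finite}) monoid)" if "d > 0"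
proof (rule comm_groupI)
  fix x :: "'n \<Rightarrow> 'a" assume x: "x \<in> carrier (G_tilde d h)"
  hence "x i \<noteq> 0" for i using that by (auto simp: root_vectors_def power_0_left dest: spec[of _ i])
  thus "\<exists>y\<in>carrier (G_tilde d h). y \<otimes>\<^bsub>G_tilde d h\<^esub> x = \<one>\<^bsub>G_tilde d h\<^esub>"
    using x by (intro bexI[of _ "\<lambda>i. inverse (x i)"]) (auto simp: root_vectors_def prod_inverse_power, simp add: power_inverse)
qed (auto simp: root_vectors_def power_mult_distrib prod.distrib mult_ac)

lemma Delta_eq:
  assumes "(\<Sum>i\<in>UNIV. h i) = d"
  shows "Delta d h = (\<lambda>\<zeta> _. \<zeta>) ` {\<zeta> :: 'a :: {field, finite}. \<zeta> ^ d = 1}"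
  using assms by (auto simp: Delta_def root_vectors_def simp flip: power_sum)

lemma Delta_normal:
  assumes "d > 0" "(\<Sum>i\<in>UNIV. h i) = d"
  shows "Delta d h \<lhd> (G_tilde d h :: ('n :: finite \<Rightarrow> 'a :: {field, finite}) monoid)"
proof -
  interpret comm_group "G_tilde d h :: ('n \<Rightarrow> 'a) monoid" by (rule G_tilde_comm_group[OF assms(1)])
  show ?thesis
  proof (rule subgroup_imp_normal, rule subgroupI)
    show "Delta d h \<subseteq> carrier (G_tilde d h :: ('n \<Rightarrow> 'a) monoid)" by (auto simp: Delta_def)
    show "Delta d h \<noteq> ({} :: ('n \<Rightarrow> 'a) set)" unfolding Delta_eq[OF assms(2)] by (auto intro: exI[of _ 1])
  next
    fix x :: "'n \<Rightarrow> 'a" assume "x \<in> Delta d h"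
    then obtain z where z: "x = (\<lambda>_. z)" "z ^ d = 1" unfolding Delta_eq[OF assms(2)] by auto
    have z0: "z \<noteq> 0" using z(2) assms(1) by (auto simp: power_0_left)
    have D: "(\<lambda>_. inverse z) \<in> (Delta d h :: ('n \<Rightarrow> 'a) set)" unfolding Delta_eq[OF assms(2)] using z by (auto simp: power_inverse)
    have "inv\<^bsub>G_tilde d h\<^esub> x = (\<lambda>_. inverse z)"
      by (rule inv_equality) (use z z0 D \<open>x \<in> Delta d h\<close> in \<open>auto simp: Delta_def\<close>)
    thus "inv\<^bsub>G_tilde d h\<^esub> x \<in> Delta d h" using D by simp
  next
    fix x y :: "'n \<Rightarrow> 'a" assume "x \<in> Delta d h" "y \<in> Delta d h"
    thus "x \<otimes>\<^bsub>G_tilde d h\<^esub> y \<in> Delta d h"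
      unfolding Delta_eq[OF assms(2)] by (auto simp: power_mult_distrib)
  qed
qed

lemma inv_G_tilde:
  assumes "d > 0" "\<xi> \<in> carrier (G_tilde d h :: ('n :: finite \<Rightarrow> 'a :: {field, finite}) monoid)"
  shows "inv\<^bsub>G_tilde d h\<^esub> \<xi> = (\<lambda>i. inverse (\<xi> i))"
proof -
  interpret comm_group "G_tilde d h :: ('n \<Rightarrow> 'a) monoid" by (rule G_tilde_comm_group[OF assms(1)])
  have "\<xi> i \<noteq> 0" for i using assms by (auto simp: root_vectors_def power_0_left dest: spec[of _ i])
  thus ?thesis by (intro inv_equality) (use assms in \<open>auto simp: root_vectors_def prod_inverse_power, simp add: power_inverse\<close>)
qed

text \<open>
  Stated with explicit representatives, since the weights and the action are given coordinatewise.
\<close>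

lemma carrier_G_grp: "carrier (G_grp d h) = (\<lambda>\<xi>. (\<lambda>\<zeta> i. \<zeta> * \<xi> i) ` {\<zeta>. \<zeta> ^ d = 1}) ` carrier (G_tilde d h)"
  if "(\<Sum>i\<in>UNIV. h i) = d" for h :: "'n :: finite \<Rightarrow> nat"
  unfolding G_grp_def by (auto simp: FactGroup_def RCOSETS_def r_coset_def Delta_eq[OF that] image_iff)

lemma chi_eq:
  fixes h w :: "'n :: finite \<Rightarrow> nat" and \<phi> :: "'a :: {field, finite} \<Rightarrow> qbar"
  assumes ph: "\<phi> \<in> mchars" and s: "(\<Sum>i\<in>UNIV. h i) = d" and w: "d dvd (\<Sum>i\<in>UNIV. w i)"
  shows "chi \<phi> w ((\<lambda>\<zeta> i. \<zeta> * \<xi> i) ` {\<zeta>. \<zeta> ^ d = 1}) = \<phi> (\<Prod>i\<in>UNIV. \<xi> i ^ w i)"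
proof -
  have "(\<Prod>i\<in>UNIV. (\<zeta> * \<xi> i) ^ w i) = (\<Prod>i\<in>UNIV. \<xi> i ^ w i)" if z: "\<zeta> ^ d = 1" for \<zeta>
  proof -
    obtain k where "(\<Sum>i\<in>UNIV. w i) = d * k" using w by (rule dvdE)
    hence "(\<Prod>i\<in>UNIV. \<zeta> ^ w i) = 1" using z by (simp add: power_mult flip: power_sum)
    thus ?thesis by (simp add: power_mult_distrib prod.distrib)
  qed
  hence "(\<lambda>\<xi>. \<phi> (\<Prod>i\<in>UNIV. \<xi> i ^ w i)) ` (\<lambda>\<zeta> i. \<zeta> * \<xi> i) ` {\<zeta>. \<zeta> ^ d = 1} = {\<phi> (\<Prod>i\<in>UNIV. \<xi> i ^ w i)}"
    by (auto simp: image_iff intro!: exI[of _ 1])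
  thus ?thesis by (simp add: chi_def)
qed

lemma prod_power_mod:
  fixes \<xi> :: "'n :: finite \<Rightarrow> 'a :: field"
  assumes "\<xi> \<in> root_vectors d" "\<And>i. w i = m * h i mod d"
  shows "(\<Prod>i\<in>UNIV. \<xi> i ^ w i) = (\<Prod>i\<in>UNIV. \<xi> i ^ h i) ^ m"
proof -
  have "\<xi> i ^ w i = (\<xi> i ^ h i) ^ m" for i
  proof -
    have "\<xi> i ^ (m * h i) = \<xi> i ^ (d * (m * h i div d) + w i)" using assms(2) by simp
    also have "\<dots> = \<xi> i ^ w i" using assms(1) unfolding power_add power_mult by (simp add: root_vectors_def)
    finally show ?thesis by (simp add: mult.commute flip: power_mult)
  qed
  thus ?thesis by (simp add: prod_power_distrib)
qed

lemma W_sim_iff: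
  fixes h w w' :: "'n :: finite \<Rightarrow> nat" and \<phi> :: "'a :: {field, finite} \<Rightarrow> qbar"
  assumes gen: "generates_mchars \<phi>" and d: "d dvd CARD('a) - 1" and s: "(\<Sum>i\<in>UNIV. h i) = d"
    and w: "\<And>i. w i = m * h i mod d" "w \<in> W_set d" and w': "w' \<in> W_set d"
  shows "W_sim \<phi> d h w' w \<longleftrightarrow> (\<exists>k<d. \<forall>i. w' i = k * h i mod d)"
proof -
  note ph = generates_mcharsD[OF gen]
  have sw: "d dvd (\<Sum>i\<in>UNIV. w i)" "d dvd (\<Sum>i\<in>UNIV. w' i)" using w w' by (auto simp: W_set_def)
  have "W_sim \<phi> d h w' w \<longleftrightarrow> (\<forall>\<xi>\<in>carrier (G_tilde d h). \<phi> (\<Prod>i\<in>UNIV. \<xi> i ^ w' i) = \<phi> (\<Prod>i\<in>UNIV. \<xi> i ^ w i))"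
    unfolding W_sim_def carrier_G_grp[OF s] by (simp add: chi_eq[OF ph s] sw del: G_tilde_simps)
  also have "\<dots> \<longleftrightarrow> (\<forall>\<xi>\<in>{\<xi> :: 'n \<Rightarrow> 'a. \<xi> \<in> root_vectors d \<and> (\<Prod>i\<in>UNIV. \<xi> i ^ h i) = 1}. \<phi> (\<Prod>i\<in>UNIV. \<xi> i ^ w' i) = 1)"
    by (auto simp: prod_power_mod[OF _ w(1)] mcharsD[OF ph])
  also have "\<dots> \<longleftrightarrow> (\<exists>k<d. \<forall>i. w' i = k * h i mod d)"
  proof
    assume "\<forall>\<xi>\<in>{\<xi> :: 'n \<Rightarrow> 'a. \<xi> \<in> root_vectors d \<and> (\<Prod>i\<in>UNIV. \<xi> i ^ h i) = 1}. \<phi> (\<Prod>i\<in>UNIV. \<xi> i ^ w' i) = 1"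
    thus "\<exists>k<d. \<forall>i. w' i = k * h i mod d" using w' by (intro trivial_on_kernel[OF gen d]) (auto simp: W_set_def)
  next
    assume "\<exists>k<d. \<forall>i. w' i = k * h i mod d"
    then obtain k where k: "\<And>i. w' i = k * h i mod d" by blast
    show "\<forall>\<xi>\<in>{\<xi> :: 'n \<Rightarrow> 'a. \<xi> \<in> root_vectors d \<and> (\<Prod>i\<in>UNIV. \<xi> i ^ h i) = 1}. \<phi> (\<Prod>i\<in>UNIV. \<xi> i ^ w' i) = 1"
      by (auto simp: prod_power_mod[OF _ k] mcharsD[OF ph])
  qed
  finally show ?thesis .
qed

section \<open>Points of the hypersurface\<close>

lemma self_in_proj_point: "x \<in> proj_point x"
  unfolding proj_point_def by (auto intro: exI[of _ 1])

lemma proj_point_eq_iff: "proj_point x = proj_point y \<longleftrightarrow> (\<exists>t. t \<noteq> 0 \<and> y = (\<lambda>i. t * x i))"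
proof
  assume "proj_point x = proj_point y"
  hence "y \<in> proj_point x" using self_in_proj_point by blast
  thus "\<exists>t. t \<noteq> 0 \<and> y = (\<lambda>i. t * x i)" by (auto simp: proj_point_def)
next
  assume "\<exists>t. t \<noteq> 0 \<and> y = (\<lambda>i. t * x i)"
  then obtain t where t: "t \<noteq> 0" "y = (\<lambda>i. t * x i)" by blast
  show "proj_point x = proj_point y"
  proof (intro equalityI subsetI)
    fix z assume "z \<in> proj_point x"
    then obtain c where c: "z = (\<lambda>i. c * x i)" "c \<noteq> 0" by (auto simp: proj_point_def)
    hence "z = (\<lambda>i. (c / t) * y i)" using t by simp
    thus "z \<in> proj_point y" using c t unfolding proj_point_def by (auto intro!: exI[of _ "c / t"])
  next
    fix z assume "z \<in> proj_point y"
    then obtain c where c: "z = (\<lambda>i. c * y i)" "c \<noteq> 0" by (auto simp: proj_point_def)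
    hence "z = (\<lambda>i. (c * t) * x i)" using t by (simp add: mult.assoc)
    thus "z \<in> proj_point x" using c t unfolding proj_point_def by (auto intro!: exI[of _ "c * t"])
  qed
qed

definition on_cone :: "nat \<Rightarrow> ('n :: finite \<Rightarrow> nat) \<Rightarrow> 'a :: {field, finite} \<Rightarrow> ('n \<Rightarrow> 'a alg_closure) \<Rightarrow> bool" where
  "on_cone d h l x \<longleftrightarrow> (\<Sum>i\<in>UNIV. x i ^ d) = of_nat d * to_ac l * (\<Prod>i\<in>UNIV. x i ^ h i)"

text \<open>
  The vectors with \<open>\<Phi>(x) = \<xi> x\<close> on the affine cone, that is, normalised
  representatives of the points fixed by \<open>\<xi>\<^bsup>-1\<^esup> \<Phi>\<close>.
\<close>

definition twisted_points :: "nat \<Rightarrow> ('n :: finite \<Rightarrow> nat) \<Rightarrow> 'a :: {field, finite} \<Rightarrow> ('n \<Rightarrow> 'a) \<Rightarrow> ('n \<Rightarrow> 'a alg_closure) set" where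
  "twisted_points d h l \<xi> = {x. x \<noteq> (\<lambda>_. 0) \<and> (\<forall>i. x i ^ CARD('a) = to_ac (\<xi> i) * x i) \<and> on_cone d h l x}"

lemma on_cone_scale:
  assumes "(\<Sum>i\<in>UNIV. h i) = d" "c \<noteq> 0"
  shows "on_cone d h l (\<lambda>i. c * x i) \<longleftrightarrow> on_cone d h l x"
proof -
  have "(\<Sum>i\<in>UNIV. (c * x i) ^ d) = c ^ d * (\<Sum>i\<in>UNIV. x i ^ d)"
    by (simp add: power_mult_distrib sum_distrib_left)
  moreover have "(\<Prod>i\<in>UNIV. (c * x i) ^ h i) = c ^ d * (\<Prod>i\<in>UNIV. x i ^ h i)"
    using assms(1) by (simp add: power_mult_distrib prod.distrib flip: power_sum)
  ultimately show ?thesis using assms(2) by (simp add: on_cone_def mult.left_commute)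
qed

lemma proj_point_in_D_hyp:
  assumes "(\<Sum>i\<in>UNIV. h i) = d" "x \<noteq> (\<lambda>_. 0)"
  shows "proj_point x \<in> D_hyp d h l \<longleftrightarrow> on_cone d h l x"
proof -
  have "proj_point x \<in> proj_space" using assms(2) by (auto simp: proj_space_def)
  hence "proj_point x \<in> D_hyp d h l \<longleftrightarrow> (\<forall>y\<in>proj_point x. on_cone d h l y)"
    by (simp add: D_hyp_def on_cone_def)
  also have "\<dots> \<longleftrightarrow> on_cone d h l x"
    using on_cone_scale[OF assms(1), of _ l x] self_in_proj_point[of x] by (auto simp: proj_point_def)
  finally show ?thesis .
qed

lemma frob_proj_point: "frob (proj_point x) = proj_point (\<lambda>i. x i ^ CARD('a))"
  for x :: "'n \<Rightarrow> 'a :: {field, finite} alg_closure"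
proof (intro equalityI subsetI)
  fix y assume "y \<in> frob (proj_point x)"
  then obtain c where "y = (\<lambda>i. (c * x i) ^ CARD('a))" "c \<noteq> 0" by (auto simp: frob_def proj_point_def)
  thus "y \<in> proj_point (\<lambda>i. x i ^ CARD('a))"
    unfolding proj_point_def by (auto simp: power_mult_distrib intro!: exI[of _ "c ^ CARD('a)"])
next
  fix y assume "y \<in> proj_point (\<lambda>i. x i ^ CARD('a))"
  then obtain c where c: "y = (\<lambda>i. c * x i ^ CARD('a))" "c \<noteq> 0" by (auto simp: proj_point_def)
  obtain b where b: "b ^ CARD('a) = c" using nth_root_exists[of "CARD('a)" c] card_ge_2[where ?'a='a] by auto
  have "b \<noteq> 0" using b c card_ge_2[where ?'a='a] by (auto simp: power_0_left)
  moreover have "y = (\<lambda>i. (b * x i) ^ CARD('a))" using b c by (simp add: power_mult_distrib)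
  ultimately show "y \<in> frob (proj_point x)" unfolding frob_def proj_point_def
    by (intro image_eqI[of _ _ "\<lambda>i. b * x i"]) auto
qed

lemma roots_of_unity_nonzero: "\<xi> \<in> root_vectors d \<Longrightarrow> d > 0 \<Longrightarrow> \<xi> i \<noteq> 0"
  by (auto simp: root_vectors_def power_0_left dest: spec[of _ i])

abbreviation Delta_coset :: "nat \<Rightarrow> ('n \<Rightarrow> 'a :: field) \<Rightarrow> ('n \<Rightarrow> 'a) set" where
  "Delta_coset d \<xi> \<equiv> (\<lambda>\<zeta> i. \<zeta> * \<xi> i) ` {\<zeta>. \<zeta> ^ d = 1}"

lemma G_act_proj_point:
  fixes h :: "'n :: finite \<Rightarrow> nat" and \<xi> :: "'n \<Rightarrow> 'a :: {field, finite}"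
  assumes d: "d > 0" and s: "(\<Sum>i\<in>UNIV. h i) = d" and \<xi>: "\<xi> \<in> carrier (G_tilde d h)"
  shows "G_act (inv\<^bsub>G_grp d h\<^esub> (Delta_coset d \<xi>)) (proj_point y) = proj_point (\<lambda>i. y i / to_ac (\<xi> i))"
proof -
  interpret normal "Delta d h" "G_tilde d h :: ('n \<Rightarrow> 'a) monoid" by (rule Delta_normal[OF d s])
  have c: "Delta_coset d \<xi> \<in> carrier (G_grp d h)" unfolding carrier_G_grp[OF s] using \<xi> by blast
  have sub: "\<eta> \<in> carrier (G_tilde d h)" if "\<eta> \<in> Delta_coset d \<xi>" for \<eta>
    using that \<xi> s by (auto simp: root_vectors_def power_mult_distrib prod.distrib simp flip: power_sum)
  have "inv\<^bsub>G_grp d h\<^esub> (Delta_coset d \<xi>) = (\<Union>\<eta>\<in>Delta_coset d \<xi>. {inv\<^bsub>G_tilde d h\<^esub> \<eta>})"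
    using inv_FactGroup[of "Delta_coset d \<xi>"] c by (simp add: G_grp_def SET_INV_def)
  also have "\<dots> = (\<Union>\<eta>\<in>Delta_coset d \<xi>. {\<lambda>i. inverse (\<eta> i)})"
    by (intro SUP_cong refl) (simp only: inv_G_tilde[OF d sub])
  also have "\<dots> = (\<lambda>\<eta> i. inverse (\<eta> i)) ` Delta_coset d \<xi>"
    by (rule UNION_singleton_eq_range)
  finally have i: "inv\<^bsub>G_grp d h\<^esub> (Delta_coset d \<xi>) = (\<lambda>\<eta> i. inverse (\<eta> i)) ` Delta_coset d \<xi>" .
  show ?thesis
  proof (intro equalityI subsetI)
    fix z assume "z \<in> G_act (inv\<^bsub>G_grp d h\<^esub> (Delta_coset d \<xi>)) (proj_point y)"
    then obtain \<zeta> c where z: "z = (\<lambda>i. to_ac (inverse (\<zeta> * \<xi> i)) * (c * y i))" "\<zeta> ^ d = 1" "c \<noteq> 0"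
      unfolding G_act_def i proj_point_def by blast
    have "\<zeta> \<noteq> 0" using z(2) d by (auto simp: power_0_left)
    moreover have "z = (\<lambda>i. (c / to_ac \<zeta>) * (y i / to_ac (\<xi> i)))" by (simp add: z(1) field_simps)
    ultimately show "z \<in> proj_point (\<lambda>i. y i / to_ac (\<xi> i))"
      unfolding proj_point_def using z(3) by (auto intro!: exI[of _ "c / to_ac \<zeta>"])
  next
    fix z assume "z \<in> proj_point (\<lambda>i. y i / to_ac (\<xi> i))"
    then obtain c where c: "z = (\<lambda>i. c * (y i / to_ac (\<xi> i)))" "c \<noteq> 0" by (auto simp: proj_point_def)
    have "(\<lambda>i. inverse (\<xi> i)) \<in> inv\<^bsub>G_grp d h\<^esub> (Delta_coset d \<xi>)"
      unfolding i by (rule image_eqI[of _ _ \<xi>]) (auto simp: image_iff intro!: exI[of _ 1])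
    moreover have "(\<lambda>i. c * y i) \<in> proj_point y" using c unfolding proj_point_def by blast
    moreover have "z = (\<lambda>i. to_ac (inverse (\<xi> i)) * (c * y i))" by (simp add: c(1) field_simps)
    ultimately show "z \<in> G_act (inv\<^bsub>G_grp d h\<^esub> (Delta_coset d \<xi>)) (proj_point y)"
      unfolding G_act_def
      by (intro CollectI exI[of _ "\<lambda>i. inverse (\<xi> i)"] exI[of _ "\<lambda>i. c * y i"] conjI)
  qed
qed

lemma finite_frobenius_eigenspace:
  "finite {y :: 'a :: {field, finite} alg_closure. y ^ CARD('a) = c * y}"
proof -
  define p where "p = monom 1 (CARD('a)) - monom c 1"
  have "coeff p (CARD('a)) \<noteq> 0" using card_ge_2[where ?'a='a] by (auto simp: p_def)
  hence "p \<noteq> 0" by auto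
  moreover have "{y. y ^ CARD('a) = c * y} = {y. poly p y = 0}" by (auto simp: p_def poly_monom)
  ultimately show ?thesis using poly_roots_finite by simp
qed

lemma finite_functions:
  fixes B :: "'n :: finite \<Rightarrow> 'b set"
  assumes "\<And>i. finite (B i)"
  shows "finite {x. \<forall>i. x i \<in> B i}"
proof -
  have "{x. \<forall>i. x i \<in> B i} = PiE UNIV B" by (auto simp: PiE_def Pi_def)
  thus ?thesis using assms by (simp add: finite_PiE)
qed

lemma finite_twisted_points: "finite (twisted_points d h l \<xi>)" for \<xi> :: "'n :: finite \<Rightarrow> 'a :: {field, finite}"
proof (rule finite_subset)
  show "twisted_points d h l \<xi> \<subseteq> {x. \<forall>i. x i \<in> {y. y ^ CARD('a) = to_ac (\<xi> i) * y}}"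
    by (auto simp: twisted_points_def)
qed (intro finite_functions finite_frobenius_eigenspace)

text \<open>
  If \<open>\<Phi>(x) = t \<xi> x\<close>, rescaling \<open>x\<close> by a \<open>(q - 1)\<close>th root of \<open>1 / t\<close> makes \<open>t = 1\<close>; the remaining
  freedom is a scalar fixed by Frobenius.
\<close>

lemma card_twisted_points:
  fixes h :: "'n :: finite \<Rightarrow> nat" and \<xi> :: "'n \<Rightarrow> 'a :: {field, finite}"
  assumes d: "d > 0" and s: "(\<Sum>i\<in>UNIV. h i) = d" and \<xi>: "\<xi> \<in> carrier (G_tilde d h)"
  shows "card (twisted_points d h l \<xi>) =
    (CARD('a) - 1) * card {P \<in> D_hyp d h l. G_act (inv\<^bsub>G_grp d h\<^esub> (Delta_coset d \<xi>)) (frob P) = P}"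
proof -
  let ?T = "twisted_points d h l \<xi>"
  have \<xi>0: "\<xi> i \<noteq> 0" for i using roots_of_unity_nonzero[of \<xi> d] \<xi> d by simp
  have "{P \<in> D_hyp d h l. G_act (inv\<^bsub>G_grp d h\<^esub> (Delta_coset d \<xi>)) (frob P) = P} = proj_point ` ?T"
  proof (intro equalityI subsetI)
    fix P assume "P \<in> {P \<in> D_hyp d h l. G_act (inv\<^bsub>G_grp d h\<^esub> (Delta_coset d \<xi>)) (frob P) = P}"
    hence P: "P \<in> D_hyp d h l" "G_act (inv\<^bsub>G_grp d h\<^esub> (Delta_coset d \<xi>)) (frob P) = P" by auto
    then obtain x where x: "P = proj_point x" "x \<noteq> (\<lambda>_. 0)" by (auto simp: D_hyp_def proj_space_def)
    have "proj_point x = proj_point (\<lambda>i. x i ^ CARD('a) / to_ac (\<xi> i))"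
      using P(2) unfolding x(1) frob_proj_point G_act_proj_point[OF d s \<xi>] by simp
    then obtain t where t: "t \<noteq> 0" "(\<lambda>i. x i ^ CARD('a) / to_ac (\<xi> i)) = (\<lambda>i. t * x i)"
      unfolding proj_point_eq_iff by blast
    have tx: "x i ^ CARD('a) = t * to_ac (\<xi> i) * x i" for i
      using fun_cong[OF t(2), of i] \<xi>0[of i] by (simp add: field_simps)
    obtain b where b: "b ^ (CARD('a) - 1) = inverse t"
      using nth_root_exists[of "CARD('a) - 1" "inverse t"] card_ge_2[where ?'a='a] by auto
    have b0: "b \<noteq> 0" using b t(1) card_ge_2[where ?'a='a] by (auto simp: power_0_left)
    have bq: "b ^ CARD('a) * t = b" using t(1) by (simp only: power_card_split[where ?'a='a] b) simp
    \<comment> \<open>the representative on which \<open>t\<close> is normalised to \<open>1\<close>\<close>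
    define y where "y = (\<lambda>i. b * x i)"
    have "y i ^ CARD('a) = to_ac (\<xi> i) * y i" for i
    proof -
      have "y i ^ CARD('a) = (b ^ CARD('a) * t) * (to_ac (\<xi> i) * x i)"
        by (simp add: y_def power_mult_distrib tx mult_ac)
      thus ?thesis unfolding bq by (simp add: y_def)
    qed
    moreover have "y \<noteq> (\<lambda>_. 0)" using x(2) b0 by (auto simp: y_def fun_eq_iff)
    moreover have "on_cone d h l y"
      using P(1) x b0 proj_point_in_D_hyp[OF s x(2)] by (simp add: y_def on_cone_scale[OF s])
    moreover have "proj_point x = proj_point y" unfolding proj_point_eq_iff y_def using b0 by blast
    ultimately show "P \<in> proj_point ` ?T" using x(1) by (auto simp: twisted_points_def)
  next
    fix P assume "P \<in> proj_point ` ?T"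
    then obtain x where x: "P = proj_point x" "x \<noteq> (\<lambda>_. 0)" "\<And>i. x i ^ CARD('a) = to_ac (\<xi> i) * x i" "on_cone d h l x"
      by (auto simp: twisted_points_def)
    have "P \<in> D_hyp d h l" using x proj_point_in_D_hyp[OF s x(2)] by simp
    moreover have "(\<lambda>i. x i ^ CARD('a) / to_ac (\<xi> i)) = x" using x(3) \<xi>0 by (auto simp: fun_eq_iff)
    hence "G_act (inv\<^bsub>G_grp d h\<^esub> (Delta_coset d \<xi>)) (frob P) = P"
      unfolding x(1) frob_proj_point G_act_proj_point[OF d s \<xi>] by simp
    ultimately show "P \<in> {P \<in> D_hyp d h l. G_act (inv\<^bsub>G_grp d h\<^esub> (Delta_coset d \<xi>)) (frob P) = P}" by simp
  qed
  moreover have "card ?T = (CARD('a) - 1) * card (proj_point ` ?T)"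
  proof -
    have fib: "card {y \<in> ?T. proj_point y = P} = CARD('a) - 1" if "P \<in> proj_point ` ?T" for P
    proof -
      from that obtain x where P: "P = proj_point x" and xT: "x \<in> ?T" by blast
      hence x: "x \<noteq> (\<lambda>_. 0)" "\<And>i. x i ^ CARD('a) = to_ac (\<xi> i) * x i" "on_cone d h l x"
        by (auto simp: twisted_points_def)
      then obtain i0 where i0: "x i0 \<noteq> 0" by (auto simp: fun_eq_iff)
      have "{y \<in> ?T. proj_point y = P} = (\<lambda>c i. to_ac c * x i) ` (UNIV - {0})"
      proof (intro equalityI subsetI)
        fix y assume "y \<in> {y \<in> ?T. proj_point y = P}"
        hence y: "\<And>i. y i ^ CARD('a) = to_ac (\<xi> i) * y i" "proj_point x = proj_point y"
          by (auto simp: P twisted_points_def)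
        then obtain t where t: "t \<noteq> 0" "y = (\<lambda>i. t * x i)" unfolding proj_point_eq_iff by blast
        have "t ^ CARD('a) * (to_ac (\<xi> i0) * x i0) = t * (to_ac (\<xi> i0) * x i0)"
          using y(1)[of i0] x(2)[of i0] by (simp add: t(2) power_mult_distrib mult_ac)
        hence "t ^ CARD('a) = t" using i0 \<xi>0 by simp
        then obtain c where "t = to_ac c" using frobenius_fixed_iff by blast
        thus "y \<in> (\<lambda>c i. to_ac c * x i) ` (UNIV - {0})" using t by auto
      next
        fix y assume "y \<in> (\<lambda>c i. to_ac c * x i) ` (UNIV - {0})"
        then obtain c where c: "y = (\<lambda>i. to_ac c * x i)" "c \<noteq> 0" by auto
        have "y i ^ CARD('a) = to_ac (\<xi> i) * y i" for i
        proof -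
          have "y i ^ CARD('a) = to_ac (c ^ CARD('a)) * x i ^ CARD('a)" by (simp add: c(1) power_mult_distrib)
          thus ?thesis using x(2)[of i] by (simp only: power_card c(1) mult.left_commute)
        qed
        moreover have "y \<noteq> (\<lambda>_. 0)" using i0 c by (auto simp: fun_eq_iff)
        moreover have "on_cone d h l y" using x(3) c by (simp add: on_cone_scale[OF s])
        moreover have "proj_point x = proj_point y" unfolding proj_point_eq_iff using c by (intro exI[of _ "to_ac c"]) simp
        ultimately show "y \<in> {y \<in> ?T. proj_point y = P}" by (simp add: P twisted_points_def)
      qed
      moreover have "inj_on (\<lambda>c i. to_ac c * x i) (UNIV - {0})"
        using i0 by (auto simp: inj_on_def fun_eq_iff dest: spec[of _ i0])
      ultimately show ?thesis by (simp add: card_image card_Diff_singleton)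
    qed
    have "card ?T = (\<Sum>P\<in>proj_point ` ?T. \<Sum>x\<in>{y \<in> ?T. proj_point y = P}. 1)"
      by (subst sum.group) (simp_all add: finite_twisted_points)
    thus ?thesis using fib by simp
  qed
  ultimately show ?thesis by simp
qed

text \<open>
  All values of the character are \<open>1\<close>. The sum over cosets becomes a sum over representatives, each
  coset being counted once for each element of \<open>\<Delta>\<close>.
\<close>

lemma N1_eq_twisted_points:
  fixes \<phi> :: "'a :: {field, finite} \<Rightarrow> qbar" and h w :: "'n :: finite \<Rightarrow> nat"
  assumes gen: "generates_mchars \<phi>" and d: "d dvd CARD('a) - 1"
    and s: "(\<Sum>i\<in>UNIV. h i) = d" and g: "Gcd (insert d (range h)) = 1"
    and w: "\<And>i. w i = m * h i mod d" "w \<in> W_set d"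
  shows "N1 \<phi> d h l w = of_nat (\<Sum>\<xi>\<in>carrier (G_tilde d h). card (twisted_points d h l \<xi>)) /
     (of_nat (d ^ (CARD('n) - 1)) * (of_nat CARD('a) - 1))"
proof -
  note ph = generates_mcharsD[OF gen]
  have d0: "d > 0" using d by (rule dvd_card_pos)
  let ?G = "G_tilde d h :: ('n \<Rightarrow> 'a) monoid"
  let ?Q = "G_grp d h :: ('n \<Rightarrow> 'a) set monoid"
  let ?D = "Delta d h :: ('n \<Rightarrow> 'a) set"
  interpret normal ?D ?G by (rule Delta_normal[OF d0 s])
  define N where "N c = card {P \<in> D_hyp d h l. G_act (inv\<^bsub>?Q\<^esub> c) (frob P) = P}" for c
  have car: "carrier ?Q = rcosets\<^bsub>?G\<^esub> ?D" by (simp add: G_grp_def FactGroup_def)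
  have rep: "\<exists>\<xi>\<in>carrier ?G. c = Delta_coset d \<xi>" if "c \<in> carrier ?Q" for c
    using that unfolding carrier_G_grp[OF s] by blast
  have sw: "d dvd (\<Sum>i\<in>UNIV. w i)" using w by (simp add: W_set_def)
  have chi1: "chi \<phi> w c = 1" if c: "c \<in> carrier ?Q" for c
  proof -
    obtain \<xi> where \<xi>: "\<xi> \<in> carrier ?G" "c = Delta_coset d \<xi>" using rep[OF c] by blast
    hence "(\<Prod>i\<in>UNIV. \<xi> i ^ w i) = 1" using prod_power_mod[of \<xi> d w m h] w by simp
    thus ?thesis using chi_eq[OF ph s sw, of \<xi>] \<xi> mcharsD(4)[OF ph] by simp
  qed
  have N: "card (twisted_points d h l \<xi>) = (CARD('a) - 1) * N c" if c: "c \<in> carrier ?Q" and \<xi>: "\<xi> \<in> c" for c \<xi>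
  proof -
    obtain \<xi>0 where \<xi>0: "\<xi>0 \<in> carrier ?G" "c = Delta_coset d \<xi>0" using rep[OF c] by blast
    then obtain \<zeta> where z: "\<zeta> ^ d = 1" "\<xi> = (\<lambda>i. \<zeta> * \<xi>0 i)" using \<xi> by blast
    have z0: "\<zeta> \<noteq> 0" using z(1) d0 by (auto simp: power_0_left)
    have "\<xi> \<in> carrier ?G" using z \<xi>0 s by (auto simp: root_vectors_def power_mult_distrib prod.distrib simp flip: power_sum)
    moreover have "Delta_coset d \<xi> = c"
    proof (intro equalityI subsetI)
      fix \<eta> assume "\<eta> \<in> Delta_coset d \<xi>"
      then obtain u where "u ^ d = 1" "\<eta> = (\<lambda>i. u * (\<zeta> * \<xi>0 i))" using z by auto
      thus "\<eta> \<in> c" unfolding \<xi>0(2) using z by (intro image_eqI[of _ _ "u * \<zeta>"]) (auto simp: power_mult_distrib mult.assoc)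
    next
      fix \<eta> assume "\<eta> \<in> c"
      then obtain u where "u ^ d = 1" "\<eta> = (\<lambda>i. u * \<xi>0 i)" using \<xi>0 by auto
      thus "\<eta> \<in> Delta_coset d \<xi>" using z z0 by (intro image_eqI[of _ _ "u / \<zeta>"]) (auto simp: power_divide)
    qed
    ultimately show ?thesis using card_twisted_points[OF d0 s, of \<xi> l] by (simp add: N_def)
  qed
  have "(\<Sum>\<xi>\<in>carrier ?G. card (twisted_points d h l \<xi>)) = (\<Sum>\<xi>\<in>\<Union>(carrier ?Q). card (twisted_points d h l \<xi>))"
    unfolding car rcosets_part_G[OF subgroup_axioms] ..
  also have "\<dots> = (\<Sum>c\<in>carrier ?Q. \<Sum>\<xi>\<in>c. card (twisted_points d h l \<xi>))"
  proof (subst sum.Union_disjoint)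
    show "\<forall>A\<in>carrier ?Q. \<forall>B\<in>carrier ?Q. A \<noteq> B \<longrightarrow> A \<inter> B = {}"
      using rcos_disjoint[OF subgroup_axioms] unfolding car by (auto simp: pairwise_def disjnt_def)
  qed auto
  also have "\<dots> = (\<Sum>c\<in>carrier ?Q. card ?D * ((CARD('a) - 1) * N c))"
  proof (rule sum.cong[OF refl])
    fix c assume c: "c \<in> carrier ?Q"
    have "card c = card ?D" using card_rcosets_equal[of c ?D] c car subset by simp
    thus "(\<Sum>\<xi>\<in>c. card (twisted_points d h l \<xi>)) = card ?D * ((CARD('a) - 1) * N c)" using N[OF c] by simp
  qed
  finally have T: "(\<Sum>\<xi>\<in>carrier ?G. card (twisted_points d h l \<xi>)) = card ?D * ((CARD('a) - 1) * (\<Sum>c\<in>carrier ?Q. N c))"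
    by (simp add: sum_distrib_left)
  have "Coset.order ?Q * card ?D = card (carrier ?G)"
    using lagrange[OF subgroup_axioms] unfolding Coset.order_def car .
  also have "\<dots> = d ^ (CARD('n) - 1)" using card_weight_fibre[OF gen d, of 1 h] s g by simp
  finally have L: "Coset.order ?Q * card ?D = d ^ (CARD('n) - 1)" .
  hence nz: "Coset.order ?Q \<noteq> 0" "card ?D \<noteq> 0" using d0 by (metis mult_is_0 power_not_zero less_not_refl)+
  have q: "(of_nat CARD('a) - 1 :: qbar) = of_nat (CARD('a) - 1)" by (rule of_nat_card_minus_1 [symmetric])
  have "N1 \<phi> d h l w = of_nat (\<Sum>c\<in>carrier ?Q. N c) / of_nat (Coset.order ?Q)"
    by (simp add: N1_def chi1 N_def)
  also have "\<dots> = of_nat (card ?D * ((CARD('a) - 1) * (\<Sum>c\<in>carrier ?Q. N c))) / (of_nat (Coset.order ?Q * card ?D) * of_nat (CARD('a) - 1))"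
    using nz card_ge_2[where ?'a='a] by (simp add: field_simps del: of_nat_sum)
  finally show ?thesis unfolding T L q .
qed

section \<open>Counting the points with nonzero coordinates\<close>

text \<open>
  One solution \<open>x0\<close> of the power equations has the right monomial up to a \<open>d\<close>th root of unity, and
  the others are obtained by acting with roots of unity in each coordinate.
\<close>

lemma card_roots_with_product:
  fixes h :: "'n :: finite \<Rightarrow> nat" and u :: "'n \<Rightarrow> 'a :: {field, finite}" and \<phi> :: "'a \<Rightarrow> qbar"
  assumes gen: "generates_mchars \<phi>" and d: "d dvd CARD('a) - 1" and s: "(\<Sum>i\<in>UNIV. h i) = d"
    and g: "Gcd (insert d (range h)) = 1"
    and u: "\<And>i. u i \<noteq> 0" and v: "v \<noteq> 0" and uv: "(\<Prod>i\<in>UNIV. u i ^ h i) = v ^ d"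
  shows "card {x. (\<forall>i. x i ^ d = to_ac (u i)) \<and> (\<Prod>i\<in>UNIV. x i ^ h i) = to_ac v} = d ^ (CARD('n) - 1)"
proof -
  let ?X = "{x. (\<forall>i. x i ^ d = to_ac (u i)) \<and> (\<Prod>i\<in>UNIV. x i ^ h i) = to_ac v}"
  have d0: "d > 0" using d by (rule dvd_card_pos)
  have "\<exists>x0. \<forall>i. x0 i ^ d = to_ac (u i)" by (intro choice allI nth_root_exists d0)
  then obtain x0 where x0: "\<And>i. x0 i ^ d = to_ac (u i)" by blast
  have x00: "x0 i \<noteq> 0" for i using x0[of i] u[of i] d0 by (auto simp: power_0_left)
  define p where "p = (\<Prod>i\<in>UNIV. x0 i ^ h i)"
  have p0: "p \<noteq> 0" by (simp add: p_def x00)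
  have "p ^ d = (\<Prod>i\<in>UNIV. (x0 i ^ d) ^ h i)"
    by (simp add: p_def prod_power_distrib mult.commute flip: power_mult)
  also have "\<dots> = to_ac (\<Prod>i\<in>UNIV. u i ^ h i)" by (simp add: x0 to_ac_prod)
  also have "\<dots> = to_ac v ^ d" by (simp add: uv)
  finally have "(to_ac v / p) ^ d = 1" using p0 v by (simp add: power_divide)
  then obtain \<epsilon> where \<epsilon>: "to_ac v / p = to_ac \<epsilon>" "\<epsilon> ^ d = 1" by (rule root_of_unity_in_range[OF d])
  have pv: "p * to_ac \<epsilon> = to_ac v" using \<epsilon>(1) p0 by (simp add: field_simps)
  have prod: "(\<Prod>i\<in>UNIV. (x0 i * to_ac (\<eta> i)) ^ h i) = p * to_ac (\<Prod>i\<in>UNIV. \<eta> i ^ h i)" for \<eta>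
    by (simp add: power_mult_distrib prod.distrib p_def to_ac_prod)
  have "?X = (\<lambda>\<eta> i. x0 i * to_ac (\<eta> i)) ` {\<eta> \<in> root_vectors d. (\<Prod>i\<in>UNIV. \<eta> i ^ h i) = \<epsilon>}"
  proof (intro equalityI subsetI)
    fix x assume "x \<in> ?X"
    hence x: "\<And>i. x i ^ d = to_ac (u i)" "(\<Prod>i\<in>UNIV. x i ^ h i) = to_ac v" by auto
    have "\<exists>\<zeta>. x i / x0 i = to_ac \<zeta> \<and> \<zeta> ^ d = 1" for i
    proof -
      have "(x i / x0 i) ^ d = 1" using u[of i] by (simp add: power_divide x(1) x0)
      then obtain \<zeta> where "x i / x0 i = to_ac \<zeta>" "\<zeta> ^ d = 1" by (rule root_of_unity_in_range[OF d])
      thus ?thesis by blast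
    qed
    then obtain \<eta> where \<eta>: "\<And>i. x i / x0 i = to_ac (\<eta> i)" "\<And>i. \<eta> i ^ d = 1" by metis
    have xe: "x = (\<lambda>i. x0 i * to_ac (\<eta> i))" using x00 by (simp add: fun_eq_iff flip: \<eta>(1))
    have "p * to_ac (\<Prod>i\<in>UNIV. \<eta> i ^ h i) = p * to_ac \<epsilon>" using x(2) unfolding xe prod pv .
    hence "to_ac (\<Prod>i\<in>UNIV. \<eta> i ^ h i) = to_ac \<epsilon>" using p0 by (simp only: mult_cancel_left simp_thms)
    hence "(\<Prod>i\<in>UNIV. \<eta> i ^ h i) = \<epsilon>" by (simp only: to_ac_eq_iff)
    thus "x \<in> (\<lambda>\<eta> i. x0 i * to_ac (\<eta> i)) ` {\<eta> \<in> root_vectors d. (\<Prod>i\<in>UNIV. \<eta> i ^ h i) = \<epsilon>}"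
      using xe \<eta>(2) by (intro image_eqI[of _ _ \<eta>]) (auto simp: root_vectors_def)
  next
    fix x assume "x \<in> (\<lambda>\<eta> i. x0 i * to_ac (\<eta> i)) ` {\<eta> \<in> root_vectors d. (\<Prod>i\<in>UNIV. \<eta> i ^ h i) = \<epsilon>}"
    then obtain \<eta> where \<eta>: "x = (\<lambda>i. x0 i * to_ac (\<eta> i))" "\<And>i. \<eta> i ^ d = 1" "(\<Prod>i\<in>UNIV. \<eta> i ^ h i) = \<epsilon>"
      by (auto simp: root_vectors_def)
    have "x i ^ d = to_ac (u i)" for i
    proof -
      have "x i ^ d = to_ac (u i) * to_ac (\<eta> i ^ d)" by (simp add: \<eta>(1) power_mult_distrib x0)
      thus ?thesis by (simp only: \<eta>(2) to_ac_1 mult_1_right)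
    qed
    moreover have "(\<Prod>i\<in>UNIV. x i ^ h i) = to_ac v" unfolding \<eta>(1) prod \<eta>(3) pv ..
    ultimately show "x \<in> ?X" by simp
  qed
  moreover have "inj_on (\<lambda>\<eta> i. x0 i * to_ac (\<eta> i)) {\<eta> \<in> root_vectors d. (\<Prod>i\<in>UNIV. \<eta> i ^ h i) = \<epsilon>}"
    using x00 by (auto simp: inj_on_def fun_eq_iff)
  ultimately show ?thesis using card_weight_fibre[OF gen d \<epsilon>(2) s g] by (simp add: card_image)
qed

text \<open>
  A vector with nonzero coordinates determines \<open>\<xi>\<close>, so the sum counts vectors. With
  \<open>v = \<Prod>i. x i ^ h i\<close> and \<open>t i = x i ^ d / v\<close> the equation of the cone reads \<open>\<Sum>i. t i = d * l\<close>, the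
  monomial relation becomes \<open>\<Prod>i. t i ^ h i = 1\<close>, and \<open>v\<close> is free.
\<close>

lemma card_nonzero_points:
  fixes h :: "'n :: finite \<Rightarrow> nat" and l :: "'a :: {field, finite}" and \<phi> :: "'a \<Rightarrow> qbar"
  assumes gen: "generates_mchars \<phi>" and d: "d dvd CARD('a) - 1" and s: "(\<Sum>i\<in>UNIV. h i) = d"
    and g: "Gcd (insert d (range h)) = 1"
  shows "(\<Sum>\<xi>\<in>carrier (G_tilde d h). card {x \<in> twisted_points d h l \<xi>. \<forall>i. x i \<noteq> 0}) =
    d ^ (CARD('n) - 1) * (CARD('a) - 1) *
    card {t :: 'n \<Rightarrow> 'a. (\<forall>i. t i \<noteq> 0) \<and> (\<Prod>i\<in>UNIV. t i ^ h i) = 1 \<and> (\<Sum>i\<in>UNIV. t i) = of_nat d * l}"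
proof -
  let ?T = "{t :: 'n \<Rightarrow> 'a. (\<forall>i. t i \<noteq> 0) \<and> (\<Prod>i\<in>UNIV. t i ^ h i) = 1 \<and> (\<Sum>i\<in>UNIV. t i) = of_nat d * l}"
  have d0: "d > 0" using d by (rule dvd_card_pos)
  define A where "A \<xi> = {x \<in> twisted_points d h l \<xi>. \<forall>i. x i \<noteq> 0}" for \<xi> :: "'n \<Rightarrow> 'a"
  define B where "B = (\<lambda>(t :: 'n \<Rightarrow> 'a, v). {x. (\<forall>i. x i ^ d = to_ac (t i * v)) \<and> (\<Prod>i\<in>UNIV. x i ^ h i) = to_ac v})"
  have finA: "finite (A \<xi>)" for \<xi> by (simp add: A_def finite_twisted_points)
  have powdistr: "(\<Prod>i\<in>UNIV. (t i * v) ^ h i) = (\<Prod>i\<in>UNIV. t i ^ h i) * v ^ d" for t :: "'n \<Rightarrow> 'a" and v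
    using s by (simp add: power_mult_distrib prod.distrib flip: power_sum)
  have AB: "(\<Union>\<xi>\<in>carrier (G_tilde d h). A \<xi>) = (\<Union>p\<in>?T \<times> (UNIV - {0}). B p)"
  proof (intro equalityI subsetI)
    fix x assume "x \<in> (\<Union>\<xi>\<in>carrier (G_tilde d h). A \<xi>)"
    then obtain \<xi> where \<xi>: "\<And>i. \<xi> i ^ d = 1" "(\<Prod>i\<in>UNIV. \<xi> i ^ h i) = 1"
      and x: "\<And>i. x i ^ CARD('a) = to_ac (\<xi> i) * x i" "on_cone d h l x" "\<And>i. x i \<noteq> 0"
      by (auto simp: A_def twisted_points_def root_vectors_def)
    have "(\<Prod>i\<in>UNIV. x i ^ h i) ^ CARD('a) = (\<Prod>i\<in>UNIV. (x i ^ CARD('a)) ^ h i)"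
      by (simp add: prod_power_distrib mult.commute flip: power_mult)
    also have "\<dots> = to_ac (\<Prod>i\<in>UNIV. \<xi> i ^ h i) * (\<Prod>i\<in>UNIV. x i ^ h i)"
      by (simp add: x(1) power_mult_distrib prod.distrib to_ac_prod)
    also have "\<dots> = (\<Prod>i\<in>UNIV. x i ^ h i)" by (simp only: \<xi>(2) to_ac_1 mult_1)
    finally obtain v where v: "(\<Prod>i\<in>UNIV. x i ^ h i) = to_ac v" using frobenius_fixed_iff by blast
    have v0: "v \<noteq> 0"
    proof
      assume "v = 0"
      hence "(\<Prod>i\<in>UNIV. x i ^ h i) = 0" using v by simp
      thus False using x(3) by simp
    qed
    have "\<exists>u. x i ^ d = to_ac u" for i
    proof -
      have "(x i ^ d) ^ CARD('a) = (x i ^ CARD('a)) ^ d" by (simp add: mult.commute flip: power_mult)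
      also have "\<dots> = to_ac (\<xi> i ^ d) * x i ^ d" by (simp add: x(1) power_mult_distrib)
      also have "\<dots> = x i ^ d" by (simp only: \<xi>(1) to_ac_1 mult_1)
      finally show ?thesis using frobenius_fixed_iff by blast
    qed
    then obtain u where u: "\<And>i. x i ^ d = to_ac (u i)" by metis
    have u0: "u i \<noteq> 0" for i using u[of i] x(3)[of i] by auto
    define t where "t i = u i / v" for i
    have tv: "t i * v = u i" for i using v0 by (simp add: t_def)
    have "to_ac (\<Prod>i\<in>UNIV. u i ^ h i) = (\<Prod>i\<in>UNIV. x i ^ h i) ^ d"
      by (simp add: to_ac_prod prod_power_distrib mult.commute flip: u power_mult)
    also have "\<dots> = to_ac (v ^ d)" by (simp add: v)
    finally have "(\<Prod>i\<in>UNIV. u i ^ h i) = v ^ d" by (simp only: to_ac_eq_iff)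
    hence "(\<Prod>i\<in>UNIV. t i ^ h i) * v ^ d = v ^ d" using powdistr[of t v] by (simp add: tv)
    hence t1: "(\<Prod>i\<in>UNIV. t i ^ h i) = 1" using v0 by simp
    have "to_ac (\<Sum>i\<in>UNIV. u i) = to_ac (of_nat d * l * v)"
      using x(2) by (simp add: on_cone_def u v to_ac_sum)
    hence "(\<Sum>i\<in>UNIV. u i) = of_nat d * l * v" by (simp only: to_ac_eq_iff)
    hence t2: "(\<Sum>i\<in>UNIV. t i) = of_nat d * l" using v0 by (simp add: t_def flip: sum_divide_distrib)
    have "t \<in> ?T" using t1 t2 u0 v0 by (simp add: t_def)
    moreover have "x \<in> B (t, v)" by (simp only: B_def prod.case mem_Collect_eq tv u v simp_thms)
    ultimately show "x \<in> (\<Union>p\<in>?T \<times> (UNIV - {0}). B p)" using v0 by blast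
  next
    fix x assume "x \<in> (\<Union>p\<in>?T \<times> (UNIV - {0}). B p)"
    then obtain t v where t: "t \<in> ?T" and v0: "v \<noteq> 0" and "x \<in> B (t, v)" by blast
    hence x: "\<And>i. x i ^ d = to_ac (t i * v)" "(\<Prod>i\<in>UNIV. x i ^ h i) = to_ac v"
      by (simp_all only: B_def prod.case mem_Collect_eq simp_thms)
    obtain e where e: "CARD('a) - 1 = d * e" using d by (rule dvdE)
    define \<xi> where "\<xi> i = (t i * v) ^ e" for i
    have tv0: "t i * v \<noteq> 0" for i using t v0 by simp
    have x0: "x i \<noteq> 0" for i
    proof
      assume "x i = 0"
      hence "to_ac (t i * v) = 0" using x(1)[of i] d0 by (simp add: power_0_left)
      thus False using tv0[of i] by (simp only: to_ac_eq_0_iff)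
    qed
    have xq: "x i ^ (CARD('a) - 1) = to_ac (\<xi> i)" for i
      unfolding e power_mult x(1) \<xi>_def to_ac_power ..
    have "x i ^ CARD('a) = to_ac (\<xi> i) * x i" for i
      by (simp only: power_card_split[where ?'a='a] xq)
    moreover have "\<xi> i ^ d = 1" for i
      using power_card_minus_1[OF tv0[of i]] unfolding e \<xi>_def by (simp only: mult.commute power_mult [symmetric])
    moreover have "to_ac (\<Prod>i\<in>UNIV. \<xi> i ^ h i) = (\<Prod>i\<in>UNIV. x i ^ h i) ^ (CARD('a) - 1)"
      by (simp add: to_ac_prod prod_power_distrib mult.commute flip: xq power_mult del: One_nat_def)
    hence "to_ac (\<Prod>i\<in>UNIV. \<xi> i ^ h i) = to_ac (v ^ (CARD('a) - 1))" by (simp only: x(2) to_ac_power)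
    hence "(\<Prod>i\<in>UNIV. \<xi> i ^ h i) = 1" unfolding to_ac_eq_iff power_card_minus_1[OF v0] .
    moreover have "on_cone d h l x"
    proof -
      have "(\<Sum>i\<in>UNIV. x i ^ d) = to_ac ((\<Sum>i\<in>UNIV. t i) * v)"
        unfolding sum_distrib_right to_ac_sum x(1) ..
      also have "(\<Sum>i\<in>UNIV. t i) = of_nat d * l" using t by simp
      finally show ?thesis by (simp add: on_cone_def x(2))
    qed
    ultimately have "\<xi> \<in> carrier (G_tilde d h)" "x \<in> A \<xi>"
      using x0 by (auto simp: A_def twisted_points_def root_vectors_def fun_eq_iff)
    thus "x \<in> (\<Union>\<xi>\<in>carrier (G_tilde d h). A \<xi>)" by blast
  qed
  have disjA: "A \<xi> \<inter> A \<xi>' = {}" if "\<xi> \<noteq> \<xi>'" for \<xi> \<xi>'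
  proof (rule ccontr)
    assume "A \<xi> \<inter> A \<xi>' \<noteq> {}"
    then obtain x where x: "x \<in> A \<xi>" "x \<in> A \<xi>'" by blast
    have "\<xi> i = \<xi>' i" for i
    proof -
      have "to_ac (\<xi> i) * x i = to_ac (\<xi>' i) * x i" "x i \<noteq> 0" using x by (auto simp: A_def twisted_points_def)
      thus ?thesis by simp
    qed
    thus False using that by blast
  qed
  have disjB: "B p \<inter> B p' = {}" if "p \<in> ?T \<times> (UNIV - {0})" "p' \<in> ?T \<times> (UNIV - {0})" "p \<noteq> p'" for p p'
  proof (rule ccontr)
    obtain t v t' v' where p: "p = (t, v)" "p' = (t', v')" by (cases p, cases p')
    assume "B p \<inter> B p' \<noteq> {}"
    then obtain x where "x \<in> B (t, v)" "x \<in> B (t', v')" unfolding p by blast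
    hence "to_ac v = to_ac v'" "\<And>i. to_ac (t i * v) = to_ac (t' i * v')"
      by (simp_all add: B_def del: to_ac_eq_iff to_ac_mult)
    hence "v = v'" "\<And>i. t i * v = t' i * v'" by (simp_all only: to_ac_eq_iff)
    moreover have "v \<noteq> 0" using that p by simp
    ultimately have "t = t'" "v = v'" by (auto simp: fun_eq_iff)
    thus False using that(3) p by simp
  qed
  have cardB: "card (B p) = d ^ (CARD('n) - 1)" if p: "p \<in> ?T \<times> (UNIV - {0})" for p
  proof -
    obtain t v where tv: "p = (t, v)" "t \<in> ?T" "v \<noteq> 0" using p by blast
    have "(\<Prod>i\<in>UNIV. (t i * v) ^ h i) = v ^ d" using tv(2) by (simp add: powdistr)
    from card_roots_with_product[OF gen d s g _ tv(3) this] show ?thesis using tv by (simp add: B_def)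
  qed
  have finB: "finite (B p)" if "p \<in> ?T \<times> (UNIV - {0})" for p
    using cardB[OF that] d0 by (intro card_ge_0_finite) simp
  have "(\<Sum>\<xi>\<in>carrier (G_tilde d h). card (A \<xi>)) = card (\<Union>\<xi>\<in>carrier (G_tilde d h). A \<xi>)"
    using finA disjA by (subst card_UN_disjoint) auto
  also have "\<dots> = (\<Sum>p\<in>?T \<times> (UNIV - {0}). card (B p))"
    unfolding AB using finB disjB by (intro card_UN_disjoint) auto
  also have "\<dots> = (\<Sum>p\<in>?T \<times> (UNIV - {0 :: 'a}). d ^ (CARD('n) - 1))" by (intro sum.cong refl cardB)
  also have "\<dots> = card (?T \<times> (UNIV - {0 :: 'a})) * d ^ (CARD('n) - 1)" by simp
  also have "card (?T \<times> (UNIV - {0 :: 'a})) = card ?T * (CARD('a) - 1)"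
    by (simp add: card_cartesian_product card_Diff_singleton)
  finally show ?thesis unfolding A_def by (simp only: mult_ac)
qed

section \<open>Counting the points with a vanishing coordinate\<close>

text \<open>
  The trivial character takes the value \<open>1\<close> at \<open>0\<close> here: a vanishing coordinate leaves the
  corresponding root of unity free, and the sum over it is nonzero only for the trivial character.
\<close>

definition extended_char :: "('a :: {field, finite} \<Rightarrow> qbar) \<Rightarrow> 'a \<Rightarrow> qbar" where
  "extended_char \<eta> u = (if u = 0 then of_bool (\<eta> = triv_char) else \<eta> u)"

definition boundary_vectors :: "('n :: finite \<Rightarrow> 'a :: {field, finite}) set" where
  "boundary_vectors = {u. (\<Sum>i\<in>UNIV. u i) = 0 \<and> (\<exists>i. u i = 0) \<and> (\<exists>i. u i \<noteq> 0)}"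

text \<open>
  For \<open>u\<close> nonzero all \<open>d\<close>th roots \<open>y\<close> of \<open>u\<close> satisfy \<open>y\<^bsup>q-1\<^esup> = u\<^bsup>(q-1)/d\<^esup>\<close>, so a single \<open>\<zeta>\<close> contributes.
\<close>

lemma twisted_root_count:
  fixes \<phi> :: "'a :: {field, finite} \<Rightarrow> qbar"
  assumes gen: "generates_mchars \<phi>" and d: "d dvd CARD('a) - 1"
  shows "(\<Sum>\<zeta>\<in>{\<zeta>. \<zeta> ^ d = 1}. \<phi> \<zeta> ^ a * of_nat (card {y. y ^ CARD('a) = to_ac \<zeta> * y \<and> y ^ d = to_ac u})) =
    of_nat d * extended_char (char_pow (root_char \<phi> d) a) u"
proof (cases "u = 0")
  case True
  have d0: "d > 0" using d by (rule dvd_card_pos)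
  have "{y :: 'a alg_closure. y ^ CARD('a) = to_ac \<zeta> * y \<and> y ^ d = to_ac u} = {0}" for \<zeta>
    using True d0 card_ge_2[where ?'a='a] by (auto simp: power_0_left)
  hence "card {y :: 'a alg_closure. y ^ CARD('a) = to_ac \<zeta> * y \<and> y ^ d = to_ac u} = 1" for \<zeta> by simp
  thus ?thesis using True
    by (simp add: sum_over_roots_of_unity[OF gen d] extended_char_def root_char_pow_triv_iff[OF gen d])
next
  case u: False
  note ph = generates_mcharsD[OF gen]
  obtain e where e: "CARD('a) - 1 = d * e" using d by (rule dvdE)
  have d0: "d > 0" using d by (rule dvd_card_pos)
  define z where "z = u ^ e"
  have zd: "z ^ d = 1" using power_card_minus_1[OF u] unfolding e z_def by (simp add: mult.commute flip: power_mult)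
  have eig: "y ^ CARD('a) = to_ac \<zeta> * y \<longleftrightarrow> \<zeta> = z" if y: "y ^ d = to_ac u" for y :: "'a alg_closure" and \<zeta>
  proof -
    have y0: "y \<noteq> 0"
    proof
      assume "y = 0"
      hence "to_ac u = 0" using y d0 by (simp add: power_0_left)
      thus False using u by simp
    qed
    have "y ^ CARD('a) = y ^ (CARD('a) - 1) * y" by (rule power_card_split)
    also have "y ^ (CARD('a) - 1) = to_ac z" unfolding e power_mult y z_def to_ac_power ..
    finally show ?thesis using y0 by auto
  qed
  have c: "card {y. y ^ CARD('a) = to_ac \<zeta> * y \<and> y ^ d = to_ac u} = (if \<zeta> = z then d else 0)" for \<zeta>
  proof (cases "\<zeta> = z")
    case True
    hence "{y. y ^ CARD('a) = to_ac \<zeta> * y \<and> y ^ d = to_ac u} = {y. y ^ d = to_ac u}" using eig by blast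
    thus ?thesis using True card_nth_roots_closure[OF d, of "to_ac u"] u by simp
  next
    case False
    hence "{y. y ^ CARD('a) = to_ac \<zeta> * y \<and> y ^ d = to_ac u} = {}" using eig by blast
    thus ?thesis using False by (simp only: card.empty if_False)
  qed
  have "(\<Sum>\<zeta>\<in>{\<zeta>. \<zeta> ^ d = 1}. \<phi> \<zeta> ^ a * of_nat (card {y. y ^ CARD('a) = to_ac \<zeta> * y \<and> y ^ d = to_ac u})) =
     (\<Sum>\<zeta>\<in>{\<zeta>. \<zeta> ^ d = 1}. if \<zeta> = z then \<phi> z ^ a * of_nat d else 0)"
    unfolding c by (intro sum.cong refl) auto
  also have "\<dots> = \<phi> z ^ a * of_nat d" using zd by simp
  also have "\<phi> z = root_char \<phi> d u" using root_char_power[OF ph u, of d] d0 unfolding e z_def by simp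
  finally show ?thesis using u by (simp add: extended_char_def char_pow_def)
qed

lemma card_eigenvectors:
  fixes U :: "('n :: finite \<Rightarrow> 'a :: {field, finite}) set"
  shows "card {x. (\<forall>i. x i ^ CARD('a) = to_ac (\<xi> i) * x i) \<and> (\<exists>u\<in>U. \<forall>i. x i ^ d = to_ac (u i))} =
    (\<Sum>u\<in>U. \<Prod>i\<in>UNIV. card {y. y ^ CARD('a) = to_ac (\<xi> i) * y \<and> y ^ d = to_ac (u i)})"
proof -
  define C where "C u i = {y. y ^ CARD('a) = to_ac (\<xi> i) * y \<and> y ^ d = to_ac (u i)}" for u :: "'n \<Rightarrow> 'a" and i
  have finC: "finite (C u i)" for u i
    by (rule finite_subset[OF _ finite_frobenius_eigenspace[of "to_ac (\<xi> i)"]]) (auto simp: C_def)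
  have "{x. (\<forall>i. x i ^ CARD('a) = to_ac (\<xi> i) * x i) \<and> (\<exists>u\<in>U. \<forall>i. x i ^ d = to_ac (u i))} =
     (\<Union>u\<in>U. {x. \<forall>i. x i \<in> C u i})" by (auto simp: C_def)
  also have "card \<dots> = (\<Sum>u\<in>U. card {x. \<forall>i. x i \<in> C u i})"
  proof (rule card_UN_disjoint)
    show "\<forall>u\<in>U. \<forall>u'\<in>U. u \<noteq> u' \<longrightarrow> {x. \<forall>i. x i \<in> C u i} \<inter> {x. \<forall>i. x i \<in> C u' i} = {}"
    proof (intro ballI impI)
      fix u u' :: "'n \<Rightarrow> 'a" assume "u \<noteq> u'"
      then obtain i where "u i \<noteq> u' i" by (auto simp: fun_eq_iff)
      hence "C u i \<inter> C u' i = {}" by (auto simp: C_def)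
      thus "{x. \<forall>i. x i \<in> C u i} \<inter> {x. \<forall>i. x i \<in> C u' i} = {}" by blast
    qed
  qed (simp_all add: finite_functions finC)
  also have "\<dots> = (\<Sum>u\<in>U. \<Prod>i\<in>UNIV. card (C u i))"
  proof (rule sum.cong[OF refl])
    fix u :: "'n \<Rightarrow> 'a"
    have "{x. \<forall>i. x i \<in> C u i} = PiE UNIV (C u)" by (auto simp: PiE_def Pi_def)
    thus "card {x. \<forall>i. x i \<in> C u i} = (\<Prod>i\<in>UNIV. card (C u i))" by (simp add: card_PiE)
  qed
  finally show ?thesis by (simp only: C_def)
qed

text \<open>
  If a coordinate vanishes, so does the monomial of the equation, and the cone condition depends only
  on the vector \<open>u\<close> of the \<open>d\<close>th powers of the coordinates. The condition on \<open>\<xi>\<close> is expanded in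
  characters, after which the sum over \<open>\<xi>\<close> factors over the coordinates.
\<close>

lemma card_boundary_points:
  fixes h :: "'n :: finite \<Rightarrow> nat" and l :: "'a :: {field, finite}" and \<phi> :: "'a \<Rightarrow> qbar"
  assumes gen: "generates_mchars \<phi>" and d: "d dvd CARD('a) - 1" and h: "\<And>i. h i \<ge> 1"
  shows "of_nat (\<Sum>\<xi>\<in>carrier (G_tilde d h). card {x \<in> twisted_points d h l \<xi>. \<exists>i. x i = 0}) =
    of_nat d ^ (CARD('n) - 1) * (\<Sum>k<d. \<Sum>u\<in>boundary_vectors.
       \<Prod>i\<in>UNIV. extended_char (char_pow (root_char \<phi> d) (k * h i)) (u i))"
proof -
  note ph = generates_mcharsD[OF gen]
  have d0: "d > 0" using d by (rule dvd_card_pos)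
  define c where "c \<zeta> u = card {y :: 'a alg_closure. y ^ CARD('a) = to_ac \<zeta> * y \<and> y ^ d = to_ac u}" for \<zeta> u :: 'a
  have bd: "card {x \<in> twisted_points d h l \<xi>. \<exists>i. x i = 0} = (\<Sum>u\<in>boundary_vectors. \<Prod>i\<in>UNIV. c (\<xi> i) (u i))"
    if \<xi>: "\<xi> \<in> root_vectors d" for \<xi> :: "'n \<Rightarrow> 'a"
  proof -
    have "{x \<in> twisted_points d h l \<xi>. \<exists>i. x i = 0} =
       {x. (\<forall>i. x i ^ CARD('a) = to_ac (\<xi> i) * x i) \<and> (\<exists>u\<in>boundary_vectors. \<forall>i. x i ^ d = to_ac (u i))}"
    proof (intro equalityI subsetI)
      fix x assume "x \<in> {x \<in> twisted_points d h l \<xi>. \<exists>i. x i = 0}"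
      hence x: "x \<noteq> (\<lambda>_. 0)" "\<And>i. x i ^ CARD('a) = to_ac (\<xi> i) * x i" "on_cone d h l x" "\<exists>i. x i = 0"
        by (auto simp: twisted_points_def)
      have "\<exists>u. x i ^ d = to_ac u" for i
      proof -
        have "(x i ^ d) ^ CARD('a) = (x i ^ CARD('a)) ^ d" by (simp add: mult.commute flip: power_mult)
        also have "\<dots> = to_ac (\<xi> i ^ d) * x i ^ d" by (simp add: x(2) power_mult_distrib)
        also have "\<dots> = x i ^ d" using \<xi> by (simp add: root_vectors_def del: to_ac_power)
        finally show ?thesis using frobenius_fixed_iff by blast
      qed
      then obtain u where u: "\<And>i. x i ^ d = to_ac (u i)" by metis
      have u0: "u i = 0 \<longleftrightarrow> x i = 0" for i using u[of i] d0 by (metis power_eq_0_iff to_ac_eq_0_iff)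
      obtain i0 where "x i0 = 0" using x(4) by blast
      hence "(\<Prod>i\<in>UNIV. x i ^ h i) = 0" using h[of i0] by (intro prod_zero) (auto intro!: bexI[of _ i0] simp: power_0_left)
      hence "to_ac (\<Sum>i\<in>UNIV. u i) = to_ac 0" using x(3) by (simp add: on_cone_def u to_ac_sum)
      hence "(\<Sum>i\<in>UNIV. u i) = 0" by (simp only: to_ac_eq_iff)
      moreover have "\<exists>i. u i \<noteq> 0" using x(1) u0 by (auto simp: fun_eq_iff)
      ultimately have "u \<in> boundary_vectors" using x(4) u0 by (simp add: boundary_vectors_def)
      thus "x \<in> {x. (\<forall>i. x i ^ CARD('a) = to_ac (\<xi> i) * x i) \<and> (\<exists>u\<in>boundary_vectors. \<forall>i. x i ^ d = to_ac (u i))}"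
        using x(2) u by blast
    next
      fix x assume "x \<in> {x. (\<forall>i. x i ^ CARD('a) = to_ac (\<xi> i) * x i) \<and> (\<exists>u\<in>boundary_vectors. \<forall>i. x i ^ d = to_ac (u i))}"
      then obtain u where x: "\<And>i. x i ^ CARD('a) = to_ac (\<xi> i) * x i" and u: "u \<in> boundary_vectors" "\<And>i. x i ^ d = to_ac (u i)"
        by blast
      have u0: "u i = 0 \<longleftrightarrow> x i = 0" for i using u(2)[of i] d0 by (metis power_eq_0_iff to_ac_eq_0_iff)
      obtain i0 where i0: "x i0 = 0" using u(1) u0 by (auto simp: boundary_vectors_def)
      hence "(\<Prod>i\<in>UNIV. x i ^ h i) = 0" using h[of i0] by (intro prod_zero) (auto intro!: bexI[of _ i0] simp: power_0_left)
      moreover have "(\<Sum>i\<in>UNIV. x i ^ d) = to_ac (\<Sum>i\<in>UNIV. u i)" by (simp add: u(2) to_ac_sum)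
      hence "(\<Sum>i\<in>UNIV. x i ^ d) = 0" using u(1) by (simp add: boundary_vectors_def)
      ultimately have "on_cone d h l x" by (simp add: on_cone_def)
      moreover have "x \<noteq> (\<lambda>_. 0)" using u(1) u0 by (auto simp: boundary_vectors_def)
      ultimately show "x \<in> {x \<in> twisted_points d h l \<xi>. \<exists>i. x i = 0}" using x i0 by (auto simp: twisted_points_def)
    qed
    thus ?thesis unfolding c_def using card_eigenvectors[of \<xi> boundary_vectors d] by (simp only:)
  qed
  let ?b = "\<lambda>\<xi> :: 'n \<Rightarrow> 'a. card {x \<in> twisted_points d h l \<xi>. \<exists>i. x i = 0}"
  have "(of_nat (d * (\<Sum>\<xi>\<in>carrier (G_tilde d h). ?b \<xi>)) :: qbar) =
     (\<Sum>\<xi>\<in>{\<xi> \<in> root_vectors d. (\<Prod>i\<in>UNIV. \<xi> i ^ h i) = 1}. of_nat d * of_nat (?b \<xi>))"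
    by (simp add: sum_distrib_left)
  also have "\<dots> = (\<Sum>k<d. \<Sum>\<xi>\<in>root_vectors d. (\<Prod>i\<in>UNIV. \<phi> (\<xi> i) ^ (k * h i)) * of_nat (?b \<xi>))"
    using weight_fibre_sum[where \<epsilon> = 1 and h = h and f = "\<lambda>\<xi>. of_nat (?b \<xi>)", OF gen d] by (simp add: mcharsD(4)[OF ph] flip: sum_distrib_left)
  also have "\<dots> = (\<Sum>k<d. of_nat d ^ CARD('n) * (\<Sum>u\<in>boundary_vectors.
       \<Prod>i\<in>UNIV. extended_char (char_pow (root_char \<phi> d) (k * h i)) (u i)))"
  proof (rule sum.cong[OF refl])
    fix k
    have "(\<Sum>\<xi>\<in>root_vectors d. (\<Prod>i\<in>UNIV. \<phi> (\<xi> i) ^ (k * h i)) * of_nat (?b \<xi>)) =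
       (\<Sum>\<xi>\<in>root_vectors d. \<Sum>u\<in>boundary_vectors. \<Prod>i\<in>UNIV. \<phi> (\<xi> i) ^ (k * h i) * of_nat (c (\<xi> i) (u i)))"
      by (intro sum.cong refl) (simp add: bd sum_distrib_left prod.distrib)
    also have "\<dots> = (\<Sum>u\<in>boundary_vectors. \<Sum>\<xi>\<in>root_vectors d. \<Prod>i\<in>UNIV. \<phi> (\<xi> i) ^ (k * h i) * of_nat (c (\<xi> i) (u i)))"
      by (rule sum.swap)
    also have "\<dots> = (\<Sum>u\<in>boundary_vectors. \<Prod>i\<in>UNIV. \<Sum>\<zeta>\<in>{\<zeta>. \<zeta> ^ d = 1}. \<phi> \<zeta> ^ (k * h i) * of_nat (c \<zeta> (u i)))"
      by (intro sum.cong refl, subst prod_sum_fun) (simp_all add: root_vectors_def)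
    also have "\<dots> = of_nat d ^ CARD('n) * (\<Sum>u\<in>boundary_vectors.
       \<Prod>i\<in>UNIV. extended_char (char_pow (root_char \<phi> d) (k * h i)) (u i))"
      unfolding c_def twisted_root_count[OF gen d] by (simp add: prod.distrib sum_distrib_left)
    finally show "(\<Sum>\<xi>\<in>root_vectors d. (\<Prod>i\<in>UNIV. \<phi> (\<xi> i) ^ (k * h i)) * of_nat (?b \<xi>)) = \<dots>" .
  qed
  also have "\<dots> = of_nat d * (of_nat d ^ (CARD('n) - 1) * (\<Sum>k<d. \<Sum>u\<in>boundary_vectors.
       \<Prod>i\<in>UNIV. extended_char (char_pow (root_char \<phi> d) (k * h i)) (u i)))"
  proof -
    have "of_nat d ^ CARD('n) = (of_nat d * of_nat d ^ (CARD('n) - 1) :: qbar)"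
      using zero_less_card_finite[where ?'a='n] by (metis Suc_diff_1 power_Suc)
    thus ?thesis by (simp only: sum_distrib_left mult.assoc)
  qed
  finally show ?thesis using d0 by simp
qed

text \<open>
  Shifting the free coordinate shows that all hyperplanes \<open>\<Sum>i. u i = c\<close> give the same sum.
\<close>

lemma hyperplane_sum_free_coordinate:
  fixes f :: "'n :: finite \<Rightarrow> 'a :: {field, finite} \<Rightarrow> qbar"
  assumes i0: "\<And>u. f i0 u = 1"
  shows "of_nat CARD('a) * (\<Sum>u\<in>{u. (\<Sum>i\<in>UNIV. u i) = 0}. \<Prod>i\<in>UNIV. f i (u i)) = (\<Prod>i\<in>UNIV. \<Sum>u\<in>UNIV. f i u)"
proof -
  define shift where "shift c u = u(i0 := u i0 + c)" for c and u :: "'n \<Rightarrow> 'a"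
  have sum_shift: "(\<Sum>i\<in>UNIV. shift c u i) = (\<Sum>i\<in>UNIV. u i) + c" for u :: "'n \<Rightarrow> 'a" and c
    by (simp add: shift_def sum.remove[of UNIV i0] add_ac)
  have prod_shift: "(\<Prod>i\<in>UNIV. f i (shift c u i)) = (\<Prod>i\<in>UNIV. f i (u i))" for u c
    by (intro prod.cong refl) (simp add: shift_def i0)
  have shift_shift: "shift c (shift (- c) u) = u" "shift (- c) (shift c u) = u" for u c
    by (simp_all add: shift_def fun_eq_iff)
  have level: "(\<Sum>u\<in>{u. (\<Sum>i\<in>UNIV. u i) = c}. \<Prod>i\<in>UNIV. f i (u i)) = (\<Sum>u\<in>{u. (\<Sum>i\<in>UNIV. u i) = 0}. \<Prod>i\<in>UNIV. f i (u i))" for c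
    by (rule sum.reindex_bij_witness[of _ "shift c" "shift (- c)"])
       (simp_all add: sum_shift prod_shift shift_shift)
  have "(\<Prod>i\<in>UNIV. \<Sum>u\<in>UNIV. f i u) = (\<Sum>u\<in>UNIV. \<Prod>i\<in>UNIV. f i (u i))" by (subst prod_sum_fun) simp_all
  also have "\<dots> = (\<Sum>c\<in>UNIV. \<Sum>u\<in>{u \<in> UNIV. (\<Sum>i\<in>UNIV. u i) = c}. \<Prod>i\<in>UNIV. f i (u i))"
    by (rule sum.group [symmetric]) simp_all
  also have "\<dots> = of_nat CARD('a) * (\<Sum>u\<in>{u. (\<Sum>i\<in>UNIV. u i) = 0}. \<Prod>i\<in>UNIV. f i (u i))"
  proof -
    have "(\<Sum>u\<in>{u \<in> UNIV. (\<Sum>i\<in>UNIV. u i) = c}. \<Prod>i\<in>UNIV. f i (u i)) =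
        (\<Sum>u\<in>{u. (\<Sum>i\<in>UNIV. u i) = 0}. \<Prod>i\<in>UNIV. f i (u i))" for c
      using level[of c] by simp
    thus ?thesis by (simp only: sum_constant)
  qed
  finally show ?thesis ..
qed

text \<open>
  The hyperplane is the disjoint union of the boundary vectors, the vectors with nonzero coordinates
  and the zero vector, and its total is known from the free coordinate \<open>i0\<close>.
\<close>

lemma boundary_vector_sum:
  fixes \<eta> :: "'n :: finite \<Rightarrow> 'a :: {field, finite} \<Rightarrow> qbar"
  assumes m: "\<And>i. \<eta> i \<in> mchars" and i0: "\<eta> i0 = triv_char"
  shows "(\<Sum>u\<in>boundary_vectors. \<Prod>i\<in>UNIV. extended_char (\<eta> i) (u i)) =
    (if \<forall>i. \<eta> i = triv_char then of_nat CARD('a) ^ (CARD('n) - 1) - 1 else 0) - level_sum \<eta> 0"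
proof -
  define F where "F u = (\<Prod>i\<in>UNIV. extended_char (\<eta> i) (u i))" for u
  define q :: qbar where "q = of_nat CARD('a)"
  have q0: "q \<noteq> 0" by (simp add: q_def)
  let ?nz = "{u :: 'n \<Rightarrow> 'a. (\<forall>i. u i \<noteq> 0) \<and> (\<Sum>i\<in>UNIV. u i) = 0}"
  have "(\<Sum>u\<in>{u :: 'n \<Rightarrow> 'a. (\<Sum>i\<in>UNIV. u i) = 0}. F u) = (\<Sum>u\<in>boundary_vectors \<union> (?nz \<union> {\<lambda>_. 0}). F u)"
    by (rule sum.cong) (auto simp: boundary_vectors_def fun_eq_iff)
  also have "\<dots> = (\<Sum>u\<in>boundary_vectors. F u) + (\<Sum>u\<in>?nz \<union> {\<lambda>_. 0}. F u)"
    by (rule sum.union_disjoint) (auto simp: boundary_vectors_def)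
  also have "(\<Sum>u\<in>?nz \<union> {\<lambda>_. 0}. F u) = (\<Sum>u\<in>?nz. F u) + F (\<lambda>_. 0)"
    by (subst sum.union_disjoint) auto
  also have "(\<Sum>u\<in>?nz. F u) = level_sum \<eta> 0"
    unfolding level_sum_def by (intro sum.cong refl) (simp add: F_def extended_char_def)
  also have "F (\<lambda>_. 0) = (if \<forall>i. \<eta> i = triv_char then 1 else 0)"
    by (auto simp: F_def extended_char_def)
  finally have 1: "(\<Sum>u\<in>{u :: 'n \<Rightarrow> 'a. (\<Sum>i\<in>UNIV. u i) = 0}. F u) =
     (\<Sum>u\<in>boundary_vectors. F u) + (level_sum \<eta> 0 + (if \<forall>i. \<eta> i = triv_char then 1 else 0))" .
  have ext_triv: "extended_char triv_char u = 1" for u :: 'a by (simp add: extended_char_def)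
  have ext_sum: "(\<Sum>u\<in>UNIV. extended_char (\<eta> i) u) = (if \<eta> i = triv_char then q else 0)" for i
  proof (cases "\<eta> i = triv_char")
    case False
    have "(\<Sum>u\<in>{u. u \<noteq> 0}. extended_char (\<eta> i) u) = (\<Sum>u\<in>{u. u \<noteq> 0}. \<eta> i u)"
      by (intro sum.cong refl) (simp add: extended_char_def)
    thus ?thesis using False sum_mchar[OF m, of i] by (simp add: sum_split_0[of "extended_char (\<eta> i)"]) (simp add: extended_char_def)
  qed (simp add: ext_triv q_def)
  have "q * (\<Sum>u\<in>{u :: 'n \<Rightarrow> 'a. (\<Sum>i\<in>UNIV. u i) = 0}. F u) = (\<Prod>i\<in>UNIV. if \<eta> i = triv_char then q else 0)"
    unfolding F_def using hyperplane_sum_free_coordinate[of "\<lambda>i. extended_char (\<eta> i)" i0, folded q_def]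
    by (simp add: ext_sum i0 ext_triv)
  also have "\<dots> = (if \<forall>i. \<eta> i = triv_char then q ^ CARD('n) else 0)" by auto
  also have "\<dots> = q * (if \<forall>i. \<eta> i = triv_char then q ^ (CARD('n) - 1) else 0)"
  proof -
    have "q ^ CARD('n) = q * q ^ (CARD('n) - 1)"
      using zero_less_card_finite[where ?'a='n] by (metis Suc_diff_1 power_Suc)
    thus ?thesis by simp
  qed
  finally have 2: "(\<Sum>u\<in>{u :: 'n \<Rightarrow> 'a. (\<Sum>i\<in>UNIV. u i) = 0}. F u) = (if \<forall>i. \<eta> i = triv_char then q ^ (CARD('n) - 1) else 0)"
    using q0 by (simp only: mult_cancel_left simp_thms)
  show ?thesis
  proof (cases "\<forall>i. \<eta> i = triv_char")
    case True
    show ?thesis using 1 unfolding 2 unfolding if_P[OF True] F_def q_def by (simp add: algebra_simps)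
  next
    case False
    show ?thesis using 1 unfolding 2 unfolding if_not_P[OF False] F_def by (simp add: eq_neg_iff_add_eq_0 add.commute)
  qed
qed

section \<open>The point count\<close>

text \<open>
  The trivial character \<open>k = 0\<close> counts points of a linear hyperplane. A nontrivial character for
  which some component is trivial gives a Jacobi sum, and one without trivial components gives \<open>0\<close>,
  since every boundary vector has a vanishing coordinate.
\<close>

lemma boundary_contribution:
  fixes h :: "'n :: finite \<Rightarrow> nat" and \<psi> \<phi> :: "'a :: {field, finite} \<Rightarrow> qbar"
  assumes ps: "nontrivial_additive_char \<psi>" and gen: "generates_mchars \<phi>" and d: "d dvd CARD('a) - 1"
    and s: "(\<Sum>i\<in>UNIV. h i) = d" and g: "Gcd (insert d (range h)) = 1"
  shows "(\<Sum>k<d. \<Sum>u\<in>boundary_vectors. \<Prod>i\<in>UNIV. extended_char (char_pow (root_char \<phi> d) (k * h i)) (u i)) =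
    of_nat CARD('a) ^ (CARD('n) - 1) - 1
      - ((of_nat CARD('a) - 1) ^ CARD('n) + (- 1) ^ CARD('n) * (of_nat CARD('a) - 1)) / of_nat CARD('a)
    + (of_nat CARD('a) - 1) * ((- 1) ^ (CARD('n) - 1) *
      (\<Sum>k\<in>{k \<in> {0<..<d}. \<exists>i. d dvd k * h i}. jacobi_pow \<phi> d (\<lambda>i. k * h i)))"
proof -
  note ph = generates_mcharsD[OF gen]
  have d0: "d > 0" using d by (rule dvd_card_pos)
  define \<eta> where "\<eta> k i = char_pow (root_char \<phi> d) (k * h i)" for k i
  define E where "E k = (\<Sum>u\<in>boundary_vectors. \<Prod>i\<in>UNIV. extended_char (\<eta> k i) (u i))" for k
  have m: "\<eta> k i \<in> mchars" for k i using ph by (simp add: \<eta>_def)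
  have tr: "\<eta> k i = triv_char \<longleftrightarrow> d dvd k * h i" for k i
    unfolding \<eta>_def by (rule root_char_pow_triv_iff[OF gen d])
  have E0: "E 0 = of_nat CARD('a) ^ (CARD('n) - 1) - 1
      - ((of_nat CARD('a) - 1) ^ CARD('n) + (- 1) ^ CARD('n) * (of_nat CARD('a) - 1)) / of_nat CARD('a)"
  proof -
    have a: "\<forall>i. \<eta> 0 i = triv_char" by (simp add: tr)
    have "E 0 = of_nat CARD('a) ^ (CARD('n) - 1) - 1 - level_sum (\<eta> 0) 0"
      unfolding E_def using a by (subst boundary_vector_sum[of "\<eta> 0" undefined]) (simp_all add: m)
    thus ?thesis unfolding level_sum_0_triv[OF ps a] .
  qed
  have E1: "E k = (if \<exists>i. d dvd k * h i
      then (of_nat CARD('a) - 1) * ((- 1) ^ (CARD('n) - 1) * jacobi_pow \<phi> d (\<lambda>i. k * h i)) else 0)" if k: "k \<in> {0<..<d}" for k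
  proof (cases "\<exists>i. d dvd k * h i")
    case True
    then obtain i0 where i0: "\<eta> k i0 = triv_char" using tr by blast
    have nt: "\<not> (\<forall>i. \<eta> k i = triv_char)"
    proof
      assume "\<forall>i. \<eta> k i = triv_char"
      hence "d dvd k" using dvd_of_dvd_all_mult[OF g s] tr by blast
      thus False using k by (auto dest: dvd_imp_le)
    qed
    have "char_prod (\<eta> k) = char_pow (char_pow (root_char \<phi> d) k) d"
      using char_prod_char_pow[of "char_pow (root_char \<phi> d) k" h] s by (simp add: \<eta>_def[abs_def] char_pow_mult)
    hence cp: "char_prod (\<eta> k) = triv_char" by (simp add: char_pow_mult root_char_pow_triv_iff[OF gen d])
    have "E k = - level_sum (\<eta> k) 0"
      unfolding E_def using boundary_vector_sum[of "\<eta> k" i0, OF m i0] unfolding if_not_P[OF nt] by simp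
    also have "\<dots> = (of_nat CARD('a) - 1) * (- 1) ^ (CARD('n) - 1) * jacobi (\<eta> k)"
      using level_sum_0[of "\<eta> k", OF m cp nt] by simp
    also have "jacobi (\<eta> k) = jacobi_pow \<phi> d (\<lambda>i. k * h i)" by (simp add: jacobi_pow_def \<eta>_def[abs_def])
    finally show ?thesis using True by (simp add: mult.assoc)
  next
    case False
    have "(\<Prod>i\<in>UNIV. extended_char (\<eta> k i) (u i)) = 0" if u: "u \<in> boundary_vectors" for u
    proof -
      obtain i where "u i = 0" using u by (auto simp: boundary_vectors_def)
      hence "extended_char (\<eta> k i) (u i) = 0" using False by (simp add: extended_char_def tr)
      thus ?thesis by (intro prod_zero) auto
    qed
    hence "E k = 0" unfolding E_def by (intro sum.neutral ballI)
    thus ?thesis using False by (simp only: if_False)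
  qed
  have "(\<Sum>k<d. E k) = E 0 + (\<Sum>k\<in>{0<..<d}. E k)"
  proof -
    have "{..<d} = insert 0 {0<..<d}" using d0 by auto
    thus ?thesis by simp
  qed
  also have "(\<Sum>k\<in>{0<..<d}. E k) = (\<Sum>k\<in>{k \<in> {0<..<d}. \<exists>i. d dvd k * h i}.
      (of_nat CARD('a) - 1) * ((- 1) ^ (CARD('n) - 1) * jacobi_pow \<phi> d (\<lambda>i. k * h i)))"
    by (subst sum.inter_filter) (simp_all add: E1)
  finally show ?thesis unfolding E0 by (simp only: E_def \<eta>_def sum_distrib_left)
qed

text \<open>
  By \<open>W_sim_iff\<close> the class of \<open>w\<close> is parametrised by the multiples \<open>k * h\<close>, bijectively because
  of the gcd condition.
\<close>

lemma sum_over_sim_class: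
  fixes h w :: "'n :: finite \<Rightarrow> nat" and \<phi> :: "'a :: {field, finite} \<Rightarrow> qbar"
  assumes gen: "generates_mchars \<phi>" and d: "d dvd CARD('a) - 1"
    and s: "(\<Sum>i\<in>UNIV. h i) = d" and g: "Gcd (insert d (range h)) = 1"
    and w: "\<And>i. w i = m * h i mod d" "w \<in> W_set d"
  shows "(\<Sum>w'\<in>{w' \<in> W_set d. W_sim \<phi> d h w' w \<and> (\<exists>i. w' i = 0) \<and> \<not> (\<forall>i. w' i = 0)}. jacobi_pow \<phi> d w') =
    (\<Sum>k\<in>{k \<in> {0<..<d}. \<exists>i. d dvd k * h i}. jacobi_pow \<phi> d (\<lambda>i. k * h i))"
proof -
  have d0: "d > 0" using d by (rule dvd_card_pos)
  define r where "r k = (\<lambda>i. k * h i mod d)" for k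
  have z: "(\<forall>i. r k i = 0) \<longleftrightarrow> k = 0" if "k < d" for k
  proof
    assume "\<forall>i. r k i = 0"
    hence "d dvd k * h i" for i by (auto simp: r_def)
    hence "d dvd k" by (rule dvd_of_dvd_all_mult[OF g s])
    thus "k = 0" using that by (auto dest: dvd_imp_le)
  qed (simp add: r_def)
  have rW: "r k \<in> W_set d" for k
  proof -
    have "(\<Sum>i\<in>UNIV. r k i) mod d = (\<Sum>i\<in>UNIV. k * h i) mod d" unfolding r_def by (rule mod_sum_eq)
    also have "\<dots> = 0" by (simp add: s flip: sum_distrib_left)
    finally show ?thesis using d0 by (auto simp: W_set_def r_def)
  qed
  have set_eq: "{w' \<in> W_set d. W_sim \<phi> d h w' w \<and> (\<exists>i. w' i = 0) \<and> \<not> (\<forall>i. w' i = 0)} =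
     r ` {k \<in> {0<..<d}. \<exists>i. d dvd k * h i}"
  proof (intro equalityI subsetI)
    fix w' assume w': "w' \<in> {w' \<in> W_set d. W_sim \<phi> d h w' w \<and> (\<exists>i. w' i = 0) \<and> \<not> (\<forall>i. w' i = 0)}"
    then obtain k where k: "k < d" "\<And>i. w' i = k * h i mod d" using W_sim_iff[OF gen d s w] by blast
    hence wr: "w' = r k" by (auto simp: r_def)
    have nz: "\<not> (\<forall>i. r k i = 0)" using w' unfolding wr mem_Collect_eq by (elim conjE)
    have k0: "k \<noteq> 0" using nz unfolding z[OF k(1)] .
    obtain i where "w' i = 0" using w' by blast
    hence "d dvd k * h i" using k(2)[of i] by auto
    hence "k \<in> {k \<in> {0<..<d}. \<exists>i. d dvd k * h i}" using k(1) k0 by auto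
    thus "w' \<in> r ` {k \<in> {0<..<d}. \<exists>i. d dvd k * h i}" unfolding wr by (rule imageI)
  next
    fix w' assume "w' \<in> r ` {k \<in> {0<..<d}. \<exists>i. d dvd k * h i}"
    then obtain k i where k: "w' = r k" "0 < k" "k < d" "d dvd k * h i" by auto
    have "\<not> (\<forall>i. w' i = 0)" using z[OF k(3)] k by blast
    moreover have "w' i = 0" using k by (simp add: r_def)
    moreover have "W_sim \<phi> d h w' w" using W_sim_iff[OF gen d s w rW, of k] k(1,3) by (auto simp: r_def)
    ultimately show "w' \<in> {w' \<in> W_set d. W_sim \<phi> d h w' w \<and> (\<exists>i. w' i = 0) \<and> \<not> (\<forall>i. w' i = 0)}"
      using rW k(1) by blast
  qed
  have inj: "inj_on r {k \<in> {0<..<d}. \<exists>i. d dvd k * h i}"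
  proof (rule linorder_inj_onI)
    fix a b assume ab: "a < b" "a \<in> {k \<in> {0<..<d}. \<exists>i. d dvd k * h i}" "b \<in> {k \<in> {0<..<d}. \<exists>i. d dvd k * h i}"
    show "r a \<noteq> r b"
    proof
      assume "r a = r b"
      have "d dvd (b - a) * h i" for i
      proof -
        have "b * h i mod d = a * h i mod d" using fun_cong[OF \<open>r a = r b\<close>, of i] by (simp add: r_def)
        hence "d dvd b * h i - a * h i" using ab(1) by (subst (asm) mod_eq_dvd_iff_nat) simp_all
        thus ?thesis by (simp add: diff_mult_distrib)
      qed
      hence "d dvd b - a" by (rule dvd_of_dvd_all_mult[OF g s])
      thus False using ab by (auto dest: dvd_imp_le)
    qed
  qed auto
  show ?thesis unfolding set_eq sum.reindex[OF inj]
    by (simp add: comp_def r_def jacobi_pow_mod[OF gen d])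
qed

text \<open>
  The error term of \<open>card_torus_section\<close> coming from the trivial character cancels against the number
  of points with nonzero coordinates on the hyperplane in \<open>boundary_contribution\<close>; what is left of
  their difference is the summand with \<open>1 / q\<close>.
\<close>

lemma N1_eq:
  fixes \<psi> \<phi> :: "'a :: {field, finite} \<Rightarrow> qbar" and h w :: "'n :: finite \<Rightarrow> nat"
  assumes ps: "nontrivial_additive_char \<psi>" and gen: "generates_mchars \<phi>"
    and h: "\<And>i. h i \<ge> 1" and d: "d dvd CARD('a) - 1" and s: "(\<Sum>i\<in>UNIV. h i) = d"
    and g: "Gcd (insert d (range h)) = 1" and w: "\<And>i. w i = m * h i mod d" "w \<in> W_set d" and l: "l \<noteq> 0"
  shows "N1 \<phi> d h l w =
    (- 1) ^ CARD('n) * (gauss_ratio_sum \<psi> d h (of_nat d * l) / (1 - of_nat CARD('a)) - 1 / of_nat CARD('a))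
    + (1 - of_nat CARD('a) ^ (CARD('n) - 1)) / (1 - of_nat CARD('a))
    + (- 1) ^ (CARD('n) - 1) * (\<Sum>k\<in>{k \<in> {0<..<d}. \<exists>i. d dvd k * h i}. jacobi_pow \<phi> d (\<lambda>i. k * h i))"
proof -
  have d0: "d > 0" using d by (rule dvd_card_pos)
  define q :: qbar where "q = of_nat CARD('a)"
  define E where "E = gauss_ratio_sum \<psi> d h (of_nat d * l)"
  define S where "S = (\<Sum>k\<in>{k \<in> {0<..<d}. \<exists>i. d dvd k * h i}. jacobi_pow \<phi> d (\<lambda>i. k * h i))"
  define e :: qbar where "e = (- 1) ^ CARD('n)"
  have e1: "(- 1) ^ (CARD('n) - 1) = - e" unfolding e_def minus_one_power_CARD by simp
  have ee: "e * e = 1" by (simp add: e_def flip: power_add)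
  have q0: "q \<noteq> 0" by (simp add: q_def)
  have "q \<noteq> of_nat 1" unfolding q_def of_nat_eq_iff using card_ge_2[where ?'a='a] by simp
  hence q1: "q - 1 \<noteq> 0" by simp
  have D0: "(of_nat d :: qbar) ^ (CARD('n) - 1) \<noteq> 0" using d0 by simp
  let ?T = "\<lambda>\<xi>. twisted_points d h l \<xi>"
  define M where "M = card {t :: 'n \<Rightarrow> 'a. (\<forall>i. t i \<noteq> 0) \<and> (\<Prod>i\<in>UNIV. t i ^ h i) = 1 \<and> (\<Sum>i\<in>UNIV. t i) = of_nat d * l}"
  have split: "card (?T \<xi>) = card {x \<in> ?T \<xi>. \<forall>i. x i \<noteq> 0} + card {x \<in> ?T \<xi>. \<exists>i. x i = 0}" for \<xi>
  proof -
    have "?T \<xi> = {x \<in> ?T \<xi>. \<forall>i. x i \<noteq> 0} \<union> {x \<in> ?T \<xi>. \<exists>i. x i = 0}" by blast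
    thus ?thesis using card_Un_disjoint[of "{x \<in> ?T \<xi>. \<forall>i. x i \<noteq> 0}" "{x \<in> ?T \<xi>. \<exists>i. x i = 0}"]
      finite_twisted_points[of d h l \<xi>] by auto
  qed
  have T: "of_nat (\<Sum>\<xi>\<in>carrier (G_tilde d h). card (?T \<xi>)) =
     of_nat d ^ (CARD('n) - 1) * ((q - 1) * of_nat M +
      (q ^ (CARD('n) - 1) - 1 - ((q - 1) ^ CARD('n) + e * (q - 1)) / q + (q - 1) * (- e * S)))"
  proof -
    have "(\<Sum>\<xi>\<in>carrier (G_tilde d h). card (?T \<xi>)) = (\<Sum>\<xi>\<in>carrier (G_tilde d h). card {x \<in> ?T \<xi>. \<forall>i. x i \<noteq> 0})
        + (\<Sum>\<xi>\<in>carrier (G_tilde d h). card {x \<in> ?T \<xi>. \<exists>i. x i = 0})"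
      by (subst split) (rule sum.distrib)
    also have "(\<Sum>\<xi>\<in>carrier (G_tilde d h). card {x \<in> ?T \<xi>. \<forall>i. x i \<noteq> 0}) = d ^ (CARD('n) - 1) * (CARD('a) - 1) * M"
      unfolding M_def by (rule card_nonzero_points[OF gen d s g])
    finally have "(of_nat (\<Sum>\<xi>\<in>carrier (G_tilde d h). card (?T \<xi>)) :: qbar) =
        of_nat d ^ (CARD('n) - 1) * of_nat (CARD('a) - 1) * of_nat M
        + of_nat (\<Sum>\<xi>\<in>carrier (G_tilde d h). card {x \<in> ?T \<xi>. \<exists>i. x i = 0})"
      by (simp only: of_nat_add of_nat_mult of_nat_power)
    thus ?thesis
      unfolding card_boundary_points[OF gen d h] boundary_contribution[OF ps gen d s g] of_nat_card_minus_1
        e1 q_def [symmetric] S_def [symmetric] e_def [symmetric]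
      by (simp only: distrib_left mult.assoc)
  qed
  have dl: "of_nat d * l \<noteq> 0" using l of_nat_nonzero[OF d] by simp
  have "of_nat M = - e / (q - 1) * (E - (1 - q) ^ CARD('n) / q)"
    unfolding M_def E_def q_def e1 [symmetric] by (rule card_torus_section[OF ps gen h s g dl])
  moreover have "(1 - q) ^ CARD('n) = e * (q - 1) ^ CARD('n)" by (simp add: e_def flip: power_mult_distrib)
  ultimately have Mq: "(q - 1) * of_nat M = - e * E + (q - 1) ^ CARD('n) / q"
    using q1 q0 ee by (simp add: field_simps)
  have "N1 \<phi> d h l w = of_nat (\<Sum>\<xi>\<in>carrier (G_tilde d h). card (?T \<xi>)) / (of_nat d ^ (CARD('n) - 1) * (q - 1))"
    unfolding N1_eq_twisted_points[OF gen d s g w] q_def by simp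
  also have "\<dots> = (- e * E + (q - 1) ^ CARD('n) / q + (q ^ (CARD('n) - 1) - 1
       - ((q - 1) ^ CARD('n) + e * (q - 1)) / q + (q - 1) * (- e * S))) / (q - 1)"
    unfolding T Mq by (rule mult_divide_mult_cancel_left[OF D0])
  also have "\<dots> = e * (E / (1 - q) - 1 / q) + (1 - q ^ (CARD('n) - 1)) / (1 - q) + - e * S"
  proof -
    have "(- a * x + y / b + (z - 1 - (y + a * c) / b + c * (- a * t))) / c = a * (x / - c - 1 / b) + (1 - z) / - c + - a * t"
      if "b \<noteq> 0" "c \<noteq> 0" for a b c x y z t :: qbar
      using that by (simp add: field_simps)
    from this[OF q0 q1] show ?thesis by simp
  qed
  finally show ?thesis unfolding e1 unfolding q_def E_def S_def e_def .
qed

text \<open>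
  A common parameter is \<open>\<phi>\<^sub>d\<^bsup>m\<^esup>\<close> times a character of order dividing both \<open>d\<close> and some \<open>h i\<close>, hence equal
  to \<open>\<phi>\<^sub>d\<^bsup>m\<^esup>\<close>; and the lower parameters are distinct, so it is cancelled once.
\<close>

lemma F_red_eq_F_remove:
  fixes \<psi> \<phi> :: "'a :: {field, finite} \<Rightarrow> qbar" and h w :: "'n :: finite \<Rightarrow> nat"
  assumes gen: "generates_mchars \<phi>" and h: "\<And>i. h i \<ge> 1" and dh: "\<And>i. d * h i dvd CARD('a) - 1"
    and w: "\<And>i. w i = m * h i mod d" and m: "m < d" and cop: "\<And>i. coprime d (h i)"
  shows "F_red \<psi> \<phi> d h w l = F_remove \<psi> \<phi> d h w (char_pow (root_char \<phi> d) m) l"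
proof -
  note ph = generates_mcharsD[OF gen]
  have dq: "d dvd CARD('a) - 1" using dh by (rule dvd_mult_left)
  have hq: "h i dvd CARD('a) - 1" for i using dh[of i] by (rule dvd_mult_right)
  define \<alpha> where "\<alpha> = char_pow (root_char \<phi> d) m"
  have al: "\<alpha> \<in> mchars" using ph by (simp add: \<alpha>_def)
  have ald: "char_pow \<alpha> d = triv_char"
    unfolding \<alpha>_def char_pow_mult root_char_pow_triv_iff[OF gen dq] by simp
  define A where "A = upper_params \<phi> d h w"
  define B where "B = lower_params \<phi> d"
  note Aeq = upper_params_eq[where h = h and w = w, OF gen dh w, folded A_def \<alpha>_def]
  have inA: "\<beta> \<in># A \<longleftrightarrow> (\<exists>i. \<exists>k<h i. \<beta> = char_mult \<alpha> (char_pow (root_char \<phi> (h i)) k))" for \<beta>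
    unfolding Aeq by (subst set_mset_sum) auto
  have inB: "\<beta> \<in># B \<longleftrightarrow> (\<exists>k<d. \<beta> = char_pow (root_char \<phi> d) k)" for \<beta>
    unfolding B_def lower_params_def by auto
  have cB: "count B \<beta> \<le> 1" for \<beta>
  proof -
    have "inj_on (char_pow (root_char \<phi> d)) {..<d}"
      by (auto simp: inj_on_def root_char_pow_eq_iff[OF gen dq])
    hence "B = mset_set (char_pow (root_char \<phi> d) ` {..<d})"
      unfolding B_def lower_params_def by (rule image_mset_mset_set)
    thus ?thesis by (simp add: count_mset_set')
  qed
  have alA: "\<alpha> \<in># A"
    unfolding inA using al h by (intro exI[of _ undefined] exI[of _ 0]) (simp add: Suc_le_eq)
  have alB: "\<alpha> \<in># B" unfolding inB \<alpha>_def using m by blast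
  have common: "\<beta> = \<alpha>" if bA: "\<beta> \<in># A" and bB: "\<beta> \<in># B" for \<beta>
  proof -
    obtain i k where k: "\<beta> = char_mult \<alpha> (char_pow (root_char \<phi> (h i)) k)" using bA inA by blast
    obtain j where j: "\<beta> = char_pow (root_char \<phi> d) j" using bB inB by blast
    have "char_pow \<beta> d = triv_char" unfolding j char_pow_mult root_char_pow_triv_iff[OF gen dq] by simp
    hence "char_pow (root_char \<phi> (h i)) (k * d) = triv_char"
      using ph by (simp add: k char_pow_char_mult ald char_pow_mult)
    hence "h i dvd k * d" by (simp add: root_char_pow_triv_iff[OF gen hq])
    hence "h i dvd k" using cop[of i] by (metis coprime_commute coprime_dvd_mult_left_iff)
    hence "char_pow (root_char \<phi> (h i)) k = triv_char" by (simp add: root_char_pow_triv_iff[OF gen hq])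
    thus ?thesis using al by (simp add: k)
  qed
  have cnt: "count A \<beta> \<ge> 1 \<and> count B \<beta> = 1" if "\<beta> = \<alpha>" for \<beta>
    using alA alB cB[of \<alpha>] that by (metis One_nat_def Suc_le_eq count_greater_zero_iff le_antisym)
  have cnt0: "count A \<beta> = 0 \<or> count B \<beta> = 0" if "\<beta> \<noteq> \<alpha>" for \<beta>
    using common[of \<beta>] that by (metis not_in_iff)
  have "A - B = A - {#\<alpha>#}"
  proof (rule multiset_eqI)
    fix \<beta> show "count (A - B) \<beta> = count (A - {#\<alpha>#}) \<beta>"
      using cnt[of \<beta>] cnt0[of \<beta>] by (cases "\<beta> = \<alpha>") auto
  qed
  moreover have "B - A = B - {#\<alpha>#}"
  proof (rule multiset_eqI)
    fix \<beta> show "count (B - A) \<beta> = count (B - {#\<alpha>#}) \<beta>"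
      using cnt[of \<beta>] cnt0[of \<beta>] by (cases "\<beta> = \<alpha>") auto
  qed
  ultimately show ?thesis unfolding F_red_def F_remove_def A_def B_def \<alpha>_def by simp
qed

theorem corollary3p5:
  fixes \<psi> \<phi> :: "'a :: {field, finite} \<Rightarrow> qbar"
    and d m :: nat
    and h w :: "'n :: finite \<Rightarrow> nat"
    and l :: 'a
  assumes "nontrivial_additive_char \<psi>"
    and "generates_mchars \<phi>"
    and "d \<ge> 2"
    and "CARD('n) \<ge> 2"
    and "\<And>i. h i \<ge> 1"
    and "(\<Sum>i\<in>UNIV. h i) = d"
    and "Gcd (insert d (range h)) = 1"
    and "\<And>i. d * h i dvd CARD('a) - 1"
    and "w \<in> W_set d"
    and "W_sim \<phi> d h w (\<lambda>_. 0)"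
    and "m < d"
    and "\<And>i. w i = m * h i mod d"
    and "l \<noteq> 0"
  shows "N1 \<phi> d h l w =
           (- 1) ^ CARD('n) * jacobi_pow \<phi> d w ^ (1 - of_bool (m = 0)) *
             F_remove \<psi> \<phi> d h w (char_pow (root_char \<phi> d) m) l
           + (1 - of_nat CARD('a) ^ (CARD('n) - 1)) / (1 - of_nat CARD('a))
           + (- 1) ^ (CARD('n) - 1) *
             (\<Sum>w'\<in>{w' \<in> W_set d. W_sim \<phi> d h w' w \<and> (\<exists>i. w' i = 0) \<and> \<not> (\<forall>i. w' i = 0)}.
                jacobi_pow \<phi> d w')
         \<and> ((\<forall>i. coprime d (h i)) \<longrightarrow>
             N1 \<phi> d h l w =
               (- 1) ^ CARD('n) * jacobi_pow \<phi> d w ^ (1 - of_bool (m = 0)) *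
                 F_red \<psi> \<phi> d h w l
               + (1 - of_nat CARD('a) ^ (CARD('n) - 1)) / (1 - of_nat CARD('a)))"
proof -
  have dq: "d dvd CARD('a) - 1" using assms(8) by (rule dvd_mult_left)
  note C = sum_over_sim_class[OF assms(2) dq assms(6,7,12,9)]
  have first: "N1 \<phi> d h l w =
           (- 1) ^ CARD('n) * jacobi_pow \<phi> d w ^ (1 - of_bool (m = 0)) *
             F_remove \<psi> \<phi> d h w (char_pow (root_char \<phi> d) m) l
           + (1 - of_nat CARD('a) ^ (CARD('n) - 1)) / (1 - of_nat CARD('a))
           + (- 1) ^ (CARD('n) - 1) *
             (\<Sum>w'\<in>{w' \<in> W_set d. W_sim \<phi> d h w' w \<and> (\<exists>i. w' i = 0) \<and> \<not> (\<forall>i. w' i = 0)}.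
                jacobi_pow \<phi> d w')"
    unfolding C mult.assoc jacobi_F_remove[OF assms(1,2,5,8,6,7,12,11,13)]
    by (rule N1_eq[OF assms(1,2,5) dq assms(6,7,12,9,13)])
  have "N1 \<phi> d h l w =
               (- 1) ^ CARD('n) * jacobi_pow \<phi> d w ^ (1 - of_bool (m = 0)) *
                 F_red \<psi> \<phi> d h w l
               + (1 - of_nat CARD('a) ^ (CARD('n) - 1)) / (1 - of_nat CARD('a))" if cop: "\<forall>i. coprime d (h i)"
  proof -
    have "\<not> d dvd k * h i" if "k \<in> {0<..<d}" for k i
    proof
      assume "d dvd k * h i"
      hence "d dvd k" using cop by (simp add: coprime_dvd_mult_left_iff)
      thus False using that by (auto dest: dvd_imp_le)
    qed
    hence e: "{k \<in> {0<..<d}. \<exists>i. d dvd k * h i} = {}" by blast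
    have "F_red \<psi> \<phi> d h w l = F_remove \<psi> \<phi> d h w (char_pow (root_char \<phi> d) m) l"
      using cop by (intro F_red_eq_F_remove assms) simp
    thus ?thesis using first unfolding C e by simp
  qed
  thus ?thesis using first by blast
qed

end
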